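(* Let $0<p<1$, $0<q<\infty$, $0<s\le\infty$. Then $(H^{p,q},\ell^s)=\ell(s,q\ast s,1/p-1)$.
   Context: $\mathbb{D}$ is the open unit disk, $\mathbb{T}$ its boundary, $m$ normalized Lebesgue measure on $\mathbb{T}$, $H(\mathbb{D})$ the analytic functions on $\mathbb{D}$. $W$ is the space of complex sequences indexed by $\mathbb{N}_0=\{0,1,2,\dots\}$; $f(z)=\sum a_nz^n\in H(\mathbb{D})$ is identified with $\{a_n\}\in W$. $\ell^s\subset W$ is the space of $s$-summable sequences ($s<\infty$) or bounded sequences ($s=\infty$). For vector subspaces $E,X$ of $W$, $(E,X)=\{\lambda\in W:\{\lambda_nw_n\}\in X\text{ for all }w\in E\}$. For $0<q,s\le\infty$: $q\ast s=s$ if $q=\infty$; $q\ast s=\frac{qs}{q-s}$ if $0<s<q<\infty$; $q\ast s=\infty$ if $0<q\le s\le\infty$. Dyadic block spaces: $I_0=\{0\}$, $I_n=\mathbb{N}_0\cap[2^{n-1},2^n)$ for $n\ge1$. For $0<p,q\le\infty$, $\ell(p,q)$ is the set of $x\in W$ for which the sequence $n\mapsto\|\{x_k\}_{k\in I_n}\|_{\ell^p}$ is in $\ell^q$. For real $\alpha$ let $w_\alpha(0)=1$, $w_\alpha(n)=n^\alpha$ for $n\ge1$; $\ell(p,q,\alpha)=\{y\in W:\{w_\alpha(n)y_n\}\in\ell(p,q)\}$. $H^{p,q}$: for measurable $f$ on $\mathbb{T}$ let $\lambda_f(s)=m(\{|f|>s\})$, $f^*(s)=\inf\{t\ge0:\lambda_f(t)\le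 s\}$, and for $0<q<\infty$, $\|f\|_{p,q}=(\int_0^1[f^*(s)s^{1/p}]^q\frac{ds}{s})^{1/q}$. The Smirnov class $N^+$ consists of $f\in H(\mathbb{D})$ in the Nevanlinna class with $\lim_{r\to1^-}\int_{\mathbb{T}}\log^+|f(rz)|\,dm=\int_{\mathbb{T}}\log^+|f|\,dm$, where $f$ on $\mathbb{T}$ is the nontangential boundary function. $H^{p,q}$ is the set of $f\in N^+$ with $\|f\|_{p,q}<\infty$ for the boundary function. *)

theory Defs
  imports "HOL-Analysis.Analysis"
begin

section \<open>Sequence spaces and coefficient multipliers\<close>

text \<open>Exponents in $(0,\infty]$ have type \<^typ>\<open>ennreal\<close>, with \<^term>\<open>\<infinity> :: ennreal\<close> in the role of $\infty$;
  the definitions are meant for positive exponents only.\<close>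

definition ell :: "ennreal \<Rightarrow> (nat \<Rightarrow> complex) set" where
  "ell s = {w. if s = \<infinity> then bounded (range w)
               else summable (\<lambda>n. norm (w n) powr enn2real s)}"

definition multipliers :: "(nat \<Rightarrow> complex) set \<Rightarrow> (nat \<Rightarrow> complex) set \<Rightarrow> (nat \<Rightarrow> complex) set" where
  "multipliers E X = {l. \<forall>w\<in>E. (\<lambda>n. l n * w n) \<in> X}"

definition exponent_star :: "ennreal \<Rightarrow> ennreal \<Rightarrow> ennreal" where
  "exponent_star q s = (if q = \<infinity> then s else if s < q then q * s / (q - s) else \<infinity>)"

definition dyadic_block :: "nat \<Rightarrow> nat set" where
  "dyadic_block n = (if n = 0 then {0} else {2 ^ (n - 1)..<2 ^ n})"

definition block_norm :: "ennreal \<Rightarrow> (nat \<Rightarrow> complex) \<Rightarrow> nat \<Rightarrow> real" where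
  "block_norm p x n =
     (if p = \<infinity> then (SUP k\<in>dyadic_block n. norm (x k))
      else (\<Sum>k\<in>dyadic_block n. norm (x k) powr enn2real p) powr (1 / enn2real p))"

definition ell_mixed :: "ennreal \<Rightarrow> ennreal \<Rightarrow> (nat \<Rightarrow> complex) set" where
  "ell_mixed p q = {x. (\<lambda>n. complex_of_real (block_norm p x n)) \<in> ell q}"

definition power_weight :: "real \<Rightarrow> nat \<Rightarrow> real" where
  "power_weight \<alpha> n = (if n = 0 then 1 else real n powr \<alpha>)"

definition ell_mixed_weighted :: "ennreal \<Rightarrow> ennreal \<Rightarrow> real \<Rightarrow> (nat \<Rightarrow> complex) set" where
  "ell_mixed_weighted p q \<alpha> =
     {y. (\<lambda>n. complex_of_real (power_weight \<alpha> n) * y n) \<in> ell_mixed p q}"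


section \<open>Boundary values and the Smirnov class\<close>

definition circle_measure :: "complex measure" where
  "circle_measure =
     distr (uniform_measure lborel {0..<2 * pi}) (restrict_space borel (sphere 0 1)) cis"

text \<open>The approach regions are empty for $M \le 1$; for $M > 1$ they are the usual
  nontangential regions at \<^term>\<open>\<zeta>\<close>.\<close>

definition stolz_region :: "real \<Rightarrow> complex \<Rightarrow> complex set" where
  "stolz_region M \<zeta> = {z \<in> ball 0 1. norm (z - \<zeta>) < M * (1 - norm z)}"

definition has_nontangential_limit :: "(complex \<Rightarrow> complex) \<Rightarrow> complex \<Rightarrow> complex \<Rightarrow> bool" where
  "has_nontangential_limit f \<zeta> l \<longleftrightarrow>
     (\<forall>M>1. (f \<longlongrightarrow> l) (at \<zeta> within stolz_region M \<zeta>))"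

text \<open>A function in the Nevanlinna class has a nontangential limit at almost every point of the
  circle, so that the value \<^term>\<open>0\<close> chosen at the remaining points is immaterial.\<close>

definition boundary_fun :: "(complex \<Rightarrow> complex) \<Rightarrow> complex \<Rightarrow> complex" where
  "boundary_fun f \<zeta> =
     (if \<exists>l. has_nontangential_limit f \<zeta> l then THE l. has_nontangential_limit f \<zeta> l else 0)"

text \<open>Here \<^term>\<open>ln 0 = (0::real)\<close> is harmless: $\log^+ 0 = 0$.\<close>

definition log_plus :: "real \<Rightarrow> real" where
  "log_plus x = max 0 (ln x)"

definition log_plus_integral :: "(complex \<Rightarrow> complex) \<Rightarrow> ennreal" where
  "log_plus_integral g = (\<integral>\<^sup>+ z. ennreal (log_plus (norm (g z))) \<partial>circle_measure)"

definition nevanlinna_class :: "(complex \<Rightarrow> complex) set" where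
  "nevanlinna_class =
     {f. f holomorphic_on ball 0 1 \<and>
         (SUP r\<in>{0..<1::real}. log_plus_integral (\<lambda>z. f (complex_of_real r * z))) < \<infinity>}"

definition smirnov_class :: "(complex \<Rightarrow> complex) set" where
  "smirnov_class =
     {f \<in> nevanlinna_class.
        ((\<lambda>r. log_plus_integral (\<lambda>z. f (complex_of_real r * z)))
           \<longlongrightarrow> log_plus_integral (boundary_fun f)) (at_left (1::real))}"


section \<open>Hardy--Lorentz spaces\<close>

definition distribution_fun :: "(complex \<Rightarrow> complex) \<Rightarrow> real \<Rightarrow> real" where
  "distribution_fun g t = measure circle_measure {z \<in> space circle_measure. t < norm (g z)}"

text \<open>For measurable \<^term>\<open>g\<close> and \<^term>\<open>s > (0::real)\<close> the infimum is over a nonempty set, because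
  \<^term>\<open>g\<close> is finite-valued; only such \<^term>\<open>s\<close> matter below.\<close>

definition decreasing_rearrangement :: "(complex \<Rightarrow> complex) \<Rightarrow> real \<Rightarrow> real" where
  "decreasing_rearrangement g s = Inf {t. 0 \<le> t \<and> distribution_fun g t \<le> s}"

definition lorentz_integral :: "real \<Rightarrow> real \<Rightarrow> (complex \<Rightarrow> complex) \<Rightarrow> ennreal" where
  "lorentz_integral p q g =
     (\<integral>\<^sup>+ s\<in>{0<..<1}. ennreal ((decreasing_rearrangement g s * s powr (1 / p)) powr q / s) \<partial>lborel)"

definition lorentz_norm :: "real \<Rightarrow> real \<Rightarrow> (complex \<Rightarrow> complex) \<Rightarrow> ennreal" where
  "lorentz_norm p q g =
     (if lorentz_integral p q g = \<infinity> then \<infinity>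
      else ennreal (enn2real (lorentz_integral p q g) powr (1 / q)))"

definition hardy_lorentz :: "real \<Rightarrow> real \<Rightarrow> (complex \<Rightarrow> complex) set" where
  "hardy_lorentz p q = {f \<in> smirnov_class. lorentz_norm p q (boundary_fun f) < \<infinity>}"

text \<open>The space of coefficient sequences with which a space of analytic functions on the disk is
  identified.\<close>

definition coeff_space :: "(complex \<Rightarrow> complex) set \<Rightarrow> (nat \<Rightarrow> complex) set" where
  "coeff_space F = {a. \<exists>f\<in>F. \<forall>z\<in>ball 0 1. (\<lambda>n. a n * z ^ n) sums f z}"

end

theory Submission
  imports Defs "HOL-Complex_Analysis.Complex_Analysis" "HOL-Probability.Probability"
begin

text \<open>
  The theorem reduces to a two-sided description of the coefficients $(a_k)$ of functions in
  $H^{p,q}$ on dyadic blocks, followed by the duality between sequence spaces.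

  For the size estimate, a function in the Smirnov class satisfies
  $\log^+|f(z)| \le P_z[\log^+|f|]$, where $P_z$ denotes the Poisson integral of the boundary values
  at $z$. With $G = \max(1,|f|)$ on the circle and a large integer $N$, Jensen's inequality gives
  $|f(z)| \le P_z[G^{1/N}]^N$. Splitting $G^{1/N}$ at the level of the rearrangement at $2^{-n}$ bounds
  the mean of $|f|$ over the circle of radius $1-2^{-n}$, hence $\max_{k\in I_n}|a_k|$, by two
  geometric convolutions of the sequence $2^{-j/p} f^{\ast}(2^{-j})$, which lies in $\ell^q$.

  For the converse, the functions $\sum_n d_n (1-r_n z)^{-K}$ with $r_n = 1-2^{-n}$ and $d_n \ge 0$ have
  positive coefficients, so no cancellation occurs, and they are dominated on the circle by a
  decreasing function of $|1-z|$, which makes their rearrangement explicit.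

  Nontangential boundary values come from Fatou's theorem. It is obtained for bounded functions from
  a weak type inequality for Poisson integrals, and for the Nevanlinna class by writing $f$ as a
  quotient of bounded functions: the denominator is a limit, by Montel's theorem, of functions
  $e^{-p_k}$ with polynomials $p_k$ such that $\mathrm{Re}\, p_k$ approximates $\log^+|f(r_k\,\cdot)|$ on the circle.
\<close>

section \<open>Normalized Lebesgue measure on the circle\<close>

text \<open>For p < 1 the boundary function need not be integrable, so the coefficients cannot be
  read off from it as Fourier coefficients. The estimate is made on the circle of radius 1 - 2^-n
  instead, where the pointwise majorant exp(P_z[log^+ |f|]) is available. The power N is dictated by
  p: the part of G above the level at 2^-n is summed with exponent 1/(N+1), and its tail converges
  once 1/(N+1) < p. The part below that level carries the weight 2^(-n(1/p-1)), which decays because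
  p < 1. In the converse direction the kernel exponent K exceeds 1/p, so that kernels more
  concentrated than the scale 2^-j contribute geometrically little at that scale. Both estimates are
  uniform on a block. Hence only the l^s norm of the multiplier on each block matters, and what
  remains is to multiply nonnegative l^q sequences into l^s. There a gliding hump and the Abel-Dini
  theorem give the necessary conditions for all positive exponents, including those below 1.\<close>

lemma space_circle_measure [simp]: "space circle_measure = sphere 0 1"
  by (simp add: circle_measure_def space_restrict_space)

lemma sets_circle_measure [measurable_cong]:
  "sets circle_measure = sets (restrict_space borel (sphere 0 1))"
  by (simp add: circle_measure_def)

lemma cis_measurable_circle:
  "cis \<in> measurable (uniform_measure lborel {0..<2 * pi}) (restrict_space borel (sphere 0 1))"
proof -
  have "cis \<in> measurable lborel (restrict_space borel (sphere 0 1))"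
    by (intro measurable_restrict_space2) (auto intro!: borel_measurable_continuous_onI continuous_intros simp: cis_conv_exp)
  then show ?thesis
    by (simp add: uniform_measure_def)
qed

interpretation circle: prob_space circle_measure
  unfolding circle_measure_def
  by (rule prob_space.prob_space_distr[OF _ cis_measurable_circle], rule prob_space_uniform_measure) auto

lemma continuous_on_sphere_measurable:
  fixes g :: "complex \<Rightarrow> 'b::topological_space"
  assumes "continuous_on (sphere 0 1) g"
  shows "g \<in> borel_measurable circle_measure"
proof -
  have "g \<in> borel_measurable (restrict_space borel (sphere 0 1))"
    by (rule borel_measurable_continuous_on_restrict[OF assms])
  then show ?thesis
    using measurable_cong_sets[OF sets_circle_measure refl] by blast
qed

lemma continuous_on_sphere_integrable:
  fixes g :: "complex \<Rightarrow> 'b::euclidean_space"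
  assumes "continuous_on (sphere 0 1) g"
  shows "integrable circle_measure g"
proof -
  have "bounded (g ` sphere 0 1)"
    by (intro compact_imp_bounded compact_continuous_image assms) auto
  then obtain B where "\<forall>w\<in>sphere 0 1. norm (g w) \<le> B"
    by (auto simp: bounded_iff)
  then show ?thesis
    by (intro circle.integrable_const_bound[where B = B] continuous_on_sphere_measurable assms) auto
qed

lemma nn_integral_circle:
  assumes "g \<in> borel_measurable circle_measure"
  shows "(\<integral>\<^sup>+ w. g w \<partial>circle_measure) = (\<integral>\<^sup>+ x\<in>{0..<2 * pi}. g (cis x) \<partial>lborel) / ennreal (2 * pi)"
proof -
  have m: "(\<lambda>x. g (cis x)) \<in> borel_measurable lborel"
  proof -
    have "g \<in> borel_measurable (restrict_space borel (sphere 0 1))"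
      using assms measurable_cong_sets[OF sets_circle_measure refl] by blast
    then have "g \<circ> cis \<in> borel_measurable (uniform_measure lborel {0..<2 * pi})"
      using cis_measurable_circle by (rule measurable_comp[rotated])
    then show ?thesis
      by (simp add: o_def uniform_measure_def)
  qed
  have "(\<integral>\<^sup>+ w. g w \<partial>circle_measure) = (\<integral>\<^sup>+ x. g (cis x) \<partial>uniform_measure lborel {0..<2 * pi})"
    unfolding circle_measure_def
    by (rule nn_integral_distr[OF cis_measurable_circle])
       (use assms sets_circle_measure measurable_cong_sets in \<open>auto simp: circle_measure_def\<close>)
  also have "\<dots> = (\<integral>\<^sup>+ x\<in>{0..<2 * pi}. g (cis x) \<partial>lborel) / ennreal (2 * pi)"
    by (subst nn_integral_uniform_measure) (use m in auto)
  finally show ?thesis .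
qed

text \<open>The parameter interval \<open>{0..1}\<close> is that of \<open>circlepath\<close>, so
  the next lemma can identify this integral with a contour integral; there the factor
  \<open>1 / u\<close> cancels the derivative of the path up to a constant.\<close>

lemma circle_has_integral:
  fixes g :: "complex \<Rightarrow> complex"
  assumes "continuous_on (sphere 0 1) g"
  shows "((\<lambda>t. g (cis (2 * pi * t))) has_integral (\<integral>w. g w \<partial>circle_measure)) {0..1}"
proof -
  have gm: "g \<in> borel_measurable (restrict_space borel (sphere 0 1))"
    by (rule borel_measurable_continuous_on_restrict[OF assms])
  have "continuous_on UNIV (\<lambda>x. g (cis x))"
    by (rule continuous_on_compose2[OF assms]) (auto intro!: continuous_intros)
  then have cont: "continuous_on S (\<lambda>x. g (cis x))" for S
    using continuous_on_subset by blast
  have int: "integral\<^sup>L circle_measure g = (\<integral>x. g (cis x) \<partial>uniform_measure lborel {0..<2 * pi})"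
    unfolding circle_measure_def by (rule integral_distr[OF cis_measurable_circle gm])
  also have "\<dots> = (\<integral>x. (indicator {0..<2 * pi} x / (2 * pi)) *\<^sub>R g (cis x) \<partial>lborel)"
  proof -
    have *: "uniform_measure lborel {0..<2 * pi} = density lborel (\<lambda>x. ennreal (indicator {0..<2 * pi} x / (2 * pi)))"
      unfolding uniform_measure_def
      by (rule density_cong) (auto simp: ennreal_divide_numeral indicator_def divide_ennreal[symmetric] simp del: divide_ennreal)
    show ?thesis
      unfolding * by (subst integral_density) (use cont[of UNIV] in \<open>auto intro!: borel_measurable_continuous_onI\<close>)
  qed
  also have "\<dots> = (\<integral>x. (1 / (2 * pi)) *\<^sub>R (indicator {0..<2 * pi} x *\<^sub>R g (cis x)) \<partial>lborel)"
    by (simp add: scaleR_conv_of_real)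
  also have "\<dots> = (1 / (2 * pi)) *\<^sub>R (LINT x:{0..<2 * pi}|lborel. g (cis x))"
    unfolding set_lebesgue_integral_def by (rule integral_scaleR_right)
  also have "(LINT x:{0..<2 * pi}|lborel. g (cis x)) = integral {0..<2 * pi} (\<lambda>x. g (cis x))"
  proof (rule set_borel_integral_eq_integral(2))
    have "set_integrable lborel {0..2 * pi} (\<lambda>x. g (cis x))"
      by (rule borel_integrable_atLeastAtMost') (rule cont)
    then show "set_integrable lborel {0..<2 * pi} (\<lambda>x. g (cis x))"
      by (rule set_integrable_subset) auto
  qed
  also have "\<dots> = integral {0..2 * pi} (\<lambda>x. g (cis x))"
    by (rule integral_subset_negligible) (auto intro: negligible_subset[of "{2 * pi}"])
  finally have eq: "integral\<^sup>L circle_measure g = (1 / (2 * pi)) *\<^sub>R integral {0..2 * pi} (\<lambda>x. g (cis x))" .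
  have "(\<lambda>x. g (cis x)) integrable_on {0..2 * pi}"
    by (rule integrable_continuous_interval) (rule cont)
  then have "((\<lambda>x. g (cis x)) has_integral integral {0..2 * pi} (\<lambda>x. g (cis x))) (cbox 0 (2 * pi))"
    by (simp add: has_integral_integral)
  from has_integral_affinity[OF this, of "2 * pi" 0]
  have "((\<lambda>t. g (cis (2 * pi * t))) has_integral (1 / (2 * pi)) *\<^sub>R integral {0..2 * pi} (\<lambda>x. g (cis x)))
          ((\<lambda>x. (1 / (2 * pi)) *\<^sub>R x) ` cbox 0 (2 * pi))"
    by simp
  also have "(\<lambda>x. (1 / (2 * pi)) *\<^sub>R x) ` cbox 0 (2 * pi) = {0..1}"
  proof -
    have "(\<lambda>x. (1 / (2 * pi)) *\<^sub>R x + 0) ` cbox 0 (2 * pi) = cbox ((1 / (2 * pi)) *\<^sub>R 0 + 0) ((1 / (2 * pi)) *\<^sub>R (2 * pi) + 0)"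
      by (subst image_affinity_cbox) auto
    then show ?thesis by simp
  qed
  finally show ?thesis
    using eq by simp
qed

lemma circle_has_contour_integral:
  assumes "continuous_on (sphere 0 1) g"
  shows "((\<lambda>u. g u / u) has_contour_integral 2 * of_real pi * \<i> * (\<integral>w. g w \<partial>circle_measure)) (circlepath 0 1)"
proof -
  have "((\<lambda>t. 2 * of_real pi * \<i> * g (cis (2 * pi * t))) has_integral
          2 * of_real pi * \<i> * (\<integral>w. g w \<partial>circle_measure)) {0..1}"
    by (rule has_integral_mult_right) (rule circle_has_integral[OF assms])
  then show ?thesis
    unfolding has_contour_integral_def
  proof (rule has_integral_eq[rotated])
    fix t :: real assume "t \<in> {0..1}"
    moreover have "circlepath 0 1 t = cis (2 * pi * t)"
      by (simp add: circlepath cis_conv_exp mult_ac)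
    ultimately show "2 * of_real pi * \<i> * g (cis (2 * pi * t))
        = g (circlepath 0 1 t) / circlepath 0 1 t * vector_derivative (circlepath 0 1) (at t within {0..1})"
      by (simp add: vector_derivative_circlepath01 cis_conv_exp mult_ac)
  qed
qed

section \<open>The Poisson kernel\<close>

definition poisson :: "complex \<Rightarrow> complex \<Rightarrow> real" where
  "poisson z w = (1 - (norm z)\<^sup>2) / (norm (w - z))\<^sup>2"

lemma poisson_nonneg: "norm z < 1 \<Longrightarrow> 0 \<le> poisson z w"
  by (simp add: poisson_def power_le_one less_imp_le)

lemma continuous_on_poisson [continuous_intros]:
  assumes "norm z < 1"
  shows "continuous_on (sphere 0 1) (poisson z)"
  unfolding poisson_def using assms by (auto intro!: continuous_intros)

lemma poisson_measurable [measurable]: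
  "norm z < 1 \<Longrightarrow> poisson z \<in> borel_measurable circle_measure"
  by (rule continuous_on_sphere_measurable) (rule continuous_on_poisson)

lemma poisson_le:
  assumes "norm z < 1" "norm w = 1"
  shows "poisson z w \<le> 2 / (1 - norm z)"
proof -
  have "1 - norm z \<le> norm (w - z)"
    using norm_triangle_ineq2[of w z] assms by simp
  then have "(1 - norm z)\<^sup>2 \<le> (norm (w - z))\<^sup>2"
    using assms by (intro power_mono) auto
  then have "poisson z w \<le> (1 - (norm z)\<^sup>2) / (1 - norm z)\<^sup>2"
    unfolding poisson_def using assms by (intro divide_left_mono mult_pos_pos) (auto simp: power_le_one zero_less_power2)
  also have "1 - (norm z)\<^sup>2 = (1 - norm z) * (1 + norm z)"
    by (simp add: power2_eq_square algebra_simps)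
  also have "\<dots> / (1 - norm z)\<^sup>2 = (1 + norm z) / (1 - norm z)"
    using assms by (simp add: power2_eq_square)
  also have "\<dots> \<le> 2 / (1 - norm z)"
    using assms by (intro divide_right_mono) auto
  finally show ?thesis .
qed

text \<open>Conjugation followed by multiplication with the unimodular \<open>u * w\<close> carries
  u - r w to w - r u. This symmetry lets averages of Poisson integrals over a circle collapse to
  plain integrals.\<close>

lemma poisson_symmetric:
  assumes "norm w = 1" "norm u = 1"
  shows "poisson (of_real r * w) u = poisson (of_real r * u) w"
proof -
  have "norm (u - of_real r * w) = norm (cnj (u - of_real r * w) * (u * w))"
    using assms by (simp only: norm_mult complex_mod_cnj mult_1_right)
  also have "cnj (u - of_real r * w) * (u * w) = (cnj u * u) * w - of_real r * (cnj w * w) * u"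
    by (simp add: algebra_simps)
  also have "\<dots> = w - of_real r * u"
    using assms by (simp add: complex_norm_square[symmetric] mult.commute[of "cnj _"])
  finally show ?thesis
    using assms by (simp add: poisson_def norm_mult)
qed

text \<open>On the circle |u - z|^2 u = (u - z)(1 - cnj z u). The Cauchy integral of
  \<open>F u / (1 - cnj z * u)\<close> at z is therefore the mean of F(u) / |u - z|^2, and the
  missing factor 1 - |z|^2 is the value of 1 - cnj z u at u = z.\<close>

theorem poisson_formula:
  assumes cont: "continuous_on (cball 0 1) F" and hol: "F holomorphic_on ball 0 1" and z: "norm z < 1"
  shows "(\<integral>w. of_real (poisson z w) * F w \<partial>circle_measure) = F z"
proof -
  define G where "G = (\<lambda>u. F u / (1 - cnj z * u))"
  have nz: "1 - cnj z * u \<noteq> 0" if "u \<in> cball 0 1" for u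
  proof
    assume "1 - cnj z * u = 0"
    then have "norm (cnj z * u) = 1" by (metis eq_iff_diff_eq_0 norm_one)
    moreover have "norm (cnj z * u) < 1"
      using z that mult_left_le[of "norm u" "norm z"] by (simp add: norm_mult)
    ultimately show False by simp
  qed
  have "((\<lambda>u. G u / (u - z)) has_contour_integral 2 * of_real pi * \<i> * G z) (circlepath 0 1)"
    unfolding G_def using nz z
    by (intro Cauchy_integral_circlepath continuous_intros holomorphic_intros cont hol) auto
  moreover have "((\<lambda>u. (F u / of_real ((norm (u - z))\<^sup>2)) / u) has_contour_integral
      2 * of_real pi * \<i> * (\<integral>w. F w / of_real ((norm (w - z))\<^sup>2) \<partial>circle_measure)) (circlepath 0 1)"
    using z by (intro circle_has_contour_integral continuous_intros continuous_on_subset[OF cont]) auto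
  then have "((\<lambda>u. G u / (u - z)) has_contour_integral
      2 * of_real pi * \<i> * (\<integral>w. F w / of_real ((norm (w - z))\<^sup>2) \<partial>circle_measure)) (circlepath 0 1)"
  proof (rule has_contour_integral_eq)
    fix u assume "u \<in> path_image (circlepath 0 1)"
    then have u: "norm u = 1" by simp
    then have "u \<noteq> 0" by auto
    have "of_real ((norm (u - z))\<^sup>2) * u = (u - z) * (cnj u * u - cnj z * u)"
      by (subst complex_norm_square) (simp add: algebra_simps)
    also have "cnj u * u = 1"
      using u by (simp add: complex_norm_square[symmetric] mult.commute[of "cnj _"])
    finally show "F u / of_real ((norm (u - z))\<^sup>2) / u = G u / (u - z)"
      unfolding G_def by (simp add: divide_divide_eq_left mult.commute)
  qed
  ultimately have "(\<integral>w. F w / of_real ((norm (w - z))\<^sup>2) \<partial>circle_measure) = G z"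
    using has_contour_integral_unique by fastforce
  also have "G z = F z / of_real (1 - (norm z)\<^sup>2)"
    unfolding G_def by (simp only: of_real_diff complex_norm_square of_real_1 mult.commute)
  finally have *: "(\<integral>w. F w / of_real ((norm (w - z))\<^sup>2) \<partial>circle_measure) = F z / of_real (1 - (norm z)\<^sup>2)" .
  have "(\<integral>w. of_real (poisson z w) * F w \<partial>circle_measure)
      = (\<integral>w. of_real (1 - (norm z)\<^sup>2) * (F w / of_real ((norm (w - z))\<^sup>2)) \<partial>circle_measure)"
    by (simp add: poisson_def)
  also have "\<dots> = of_real (1 - (norm z)\<^sup>2) * (F z / of_real (1 - (norm z)\<^sup>2))"
    by (simp only: integral_mult_right_zero *)
  also have "\<dots> = F z"
  proof -
    have "(norm z)\<^sup>2 < 1" using z by (simp add: power_less_one_iff abs_square_less_1)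
    then have "complex_of_real (1 - (norm z)\<^sup>2) \<noteq> 0" by (metis diff_gt_0_iff_gt less_irrefl of_real_eq_0_iff)
    then show ?thesis by simp
  qed
  finally show ?thesis .
qed

lemma circle_mean_value:
  assumes "continuous_on (cball 0 1) F" and "F holomorphic_on ball 0 1"
  shows "(\<integral>w. F w \<partial>circle_measure) = F 0"
proof -
  have "(\<integral>w. F w \<partial>circle_measure) = (\<integral>w. of_real (poisson 0 w) * F w \<partial>circle_measure)"
    by (intro Bochner_Integration.integral_cong) (auto simp: poisson_def)
  then show ?thesis
    using poisson_formula[OF assms, of 0] by simp
qed

lemma integral_poisson:
  assumes "norm z < 1"
  shows "(\<integral>w. poisson z w \<partial>circle_measure) = 1"
proof -
  have "complex_of_real (\<integral>w. poisson z w \<partial>circle_measure) = (\<integral>w. of_real (poisson z w) * 1 \<partial>circle_measure)"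
    by simp
  also have "\<dots> = 1"
    by (rule poisson_formula) (use assms in auto)
  finally show ?thesis by (metis of_real_eq_1_iff)
qed

text \<open>Packaged as a measure so that the Jensen inequalities proved below for
  \<open>prob_space\<close> apply to Poisson integrals.\<close>

definition poisson_measure :: "complex \<Rightarrow> complex measure" where
  "poisson_measure z = density circle_measure (\<lambda>w. ennreal (poisson z w))"

lemma space_poisson_measure [simp]: "space (poisson_measure z) = sphere 0 1"
  by (simp add: poisson_measure_def)

lemma sets_poisson_measure [measurable_cong]: "sets (poisson_measure z) = sets circle_measure"
  by (simp add: poisson_measure_def)

lemma nn_integral_poisson:
  assumes "norm z < 1"
  shows "(\<integral>\<^sup>+ w. ennreal (poisson z w) \<partial>circle_measure) = 1"
  by (subst nn_integral_eq_integral)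
     (use assms in \<open>auto simp: integral_poisson poisson_nonneg intro!: continuous_on_sphere_integrable continuous_on_poisson\<close>)

lemma prob_space_poisson_measure:
  assumes "norm z < 1"
  shows "prob_space (poisson_measure z)"
proof
  show "emeasure (poisson_measure z) (space (poisson_measure z)) = 1"
  proof -
    have "emeasure (poisson_measure z) (space circle_measure)
        = (\<integral>\<^sup>+ w. ennreal (poisson z w) * indicator (space circle_measure) w \<partial>circle_measure)"
      unfolding poisson_measure_def
      by (rule emeasure_density) (use assms sets.top[of circle_measure] in auto)
    also have "\<dots> = (\<integral>\<^sup>+ w. ennreal (poisson z w) \<partial>circle_measure)"
      by (rule nn_integral_cong) simp
    finally show ?thesis
      using assms by (simp add: nn_integral_poisson)
  qed
qed

lemma nn_integral_poisson_measure:
  assumes "norm z < 1" "g \<in> borel_measurable circle_measure"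
  shows "(\<integral>\<^sup>+ w. g w \<partial>poisson_measure z) = (\<integral>\<^sup>+ w. ennreal (poisson z w) * g w \<partial>circle_measure)"
  unfolding poisson_measure_def using assms by (intro nn_integral_density) auto

lemma integral_poisson_measure:
  fixes g :: "complex \<Rightarrow> 'b::{banach, second_countable_topology}"
  assumes "norm z < 1" "g \<in> borel_measurable circle_measure"
  shows "(\<integral>w. g w \<partial>poisson_measure z) = (\<integral>w. poisson z w *\<^sub>R g w \<partial>circle_measure)"
  unfolding poisson_measure_def using assms
  by (intro integral_density) (auto simp: poisson_nonneg)

section \<open>Lebesgue measure of arcs\<close>

text \<open>Up to pi / 3 the derivative of sin y - y / 2 is nonnegative because cos y >= 1/2. Beyond
  pi / 3 the sine stays above sqrt 3 / 2, while v <= pi / 2 <= 1.6 <= sqrt 3.\<close>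

lemma half_le_sin:
  assumes "0 \<le> v" "v \<le> pi / 2"
  shows "v / 2 \<le> sin v"
proof (cases "v \<le> pi / 3")
  case True
  have "cos (pi / 3) \<le> cos y" if "0 \<le> y" "y \<le> v" for y
    using that True by (intro cos_monotone_0_pi_le) auto
  then have "sin 0 - 0 / 2 \<le> sin v - v / 2"
    by (intro DERIV_nonneg_imp_nondecreasing[of 0 v "\<lambda>y. sin y - y / 2"])
       (use assms in \<open>auto intro!: derivative_eq_intros simp: cos_60\<close>)
  then show ?thesis by simp
next
  case False
  have "sqrt 3 / 2 \<le> sin v"
    using False assms sin_monotone_2pi_le[of "pi / 3" v] by (auto simp: sin_60)
  moreover have "v \<le> sqrt 3"
  proof -
    have "1.6 \<le> sqrt (3::real)" by (rule real_le_rsqrt) (simp add: power2_eq_square)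
    moreover have "pi \<le> 3.2" using pi_approx by simp
    ultimately show ?thesis using assms by simp
  qed
  ultimately show ?thesis by simp
qed

text \<open>A chord shorter than d subtends an angle of at most 2 d, so the arc is covered by an
  interval of length 4 d around \<open>t0\<close> and its translates by 2 pi and -2 pi, which
  account for the wrap-around of the parameter. The total 12 d / (2 pi) is below 2 d since pi >
  3.\<close>

lemma emeasure_circle_ball_le:
  assumes x: "norm x = 1" and d: "0 < d"
  shows "emeasure circle_measure (sphere 0 1 \<inter> ball x d) \<le> ennreal (2 * d)"
proof -
  obtain t0 where t0: "0 \<le> t0" "t0 < 2 * pi" "x = cis t0"
    using Arg2pi[of x] x by (auto simp: cis_conv_exp is_Arg_def)
  define I where "I k = {t0 + 2 * pi * k - 2 * d .. t0 + 2 * pi * k + 2 * d}" for k :: real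
  have I_sets: "I k \<in> sets lborel" and I_measure: "emeasure lborel (I k) = ennreal (4 * d)" for k
    using d by (simp_all add: I_def)
  have sub: "t \<in> I (- 1) \<union> I 0 \<union> I 1" if t: "0 \<le> t" "t < 2 * pi" "dist x (cis t) < d" for t
  proof -
    have key: "\<bar>u\<bar> \<le> 2 * d" if "\<bar>u\<bar> \<le> pi" "cis u = cis (t - t0)" for u
    proof -
      have "d > norm (cis t - cis t0)"
        using t t0 by (simp add: dist_norm norm_minus_commute)
      also have "norm (cis t - cis t0) = norm (cis (t - t0) - 1)"
      proof -
        have "cis t - cis t0 = cis t0 * (cis (t - t0) - 1)"
          by (simp add: algebra_simps cis_mult)
        then show ?thesis by (simp add: norm_mult)
      qed
      also have "\<dots> = norm (cis u - 1)" using that by simp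
      also have "\<dots> = 2 * \<bar>sin (u / 2)\<bar>"
        using dist_exp_i_1[of u] by (simp add: cis_conv_exp)
      also have "\<bar>sin (u / 2)\<bar> = sin (\<bar>u\<bar> / 2)"
      proof (cases "0 \<le> u")
        case True
        then have "0 \<le> sin (u / 2)" using that by (intro sin_ge_zero) auto
        then show ?thesis using True by simp
      next
        case False
        then have "0 \<le> sin (- u / 2)" using that by (intro sin_ge_zero) auto
        then show ?thesis using False by simp
      qed
      finally have "2 * sin (\<bar>u\<bar> / 2) < d" .
      moreover have "\<bar>u\<bar> / 2 / 2 \<le> sin (\<bar>u\<bar> / 2)"
        using that by (intro half_le_sin) auto
      ultimately show ?thesis by linarith
    qed
    consider "\<bar>t - t0\<bar> \<le> pi" | "t - t0 > pi" | "t - t0 < - pi" by linarith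
    then show ?thesis
    proof cases
      case 1 then show ?thesis using key[of "t - t0"] by (auto simp: I_def abs_le_iff)
    next
      case 2
      have "cis (t - t0 - 2 * pi) = cis (t - t0)"
        by (simp add: cis.ctr cos_diff sin_diff complex_eq_iff)
      then show ?thesis using key[of "t - t0 - 2 * pi"] 2 t t0 by (auto simp: I_def abs_le_iff)
    next
      case 3
      have "cis (t - t0 + 2 * pi) = cis (t - t0)"
        by (simp add: cis.ctr cos_add sin_add complex_eq_iff)
      then show ?thesis using key[of "t - t0 + 2 * pi"] 3 t t0 by (auto simp: I_def abs_le_iff)
    qed
  qed
  have meas: "sphere 0 1 \<inter> ball x d \<in> sets circle_measure"
    by (auto simp: sets_circle_measure sets_restrict_space)
  then have "emeasure circle_measure (sphere 0 1 \<inter> ball x d)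
      = (\<integral>\<^sup>+ w. indicator (sphere 0 1 \<inter> ball x d) w \<partial>circle_measure)"
    by simp
  also have "\<dots> = (\<integral>\<^sup>+ t\<in>{0..<2 * pi}. indicator (sphere 0 1 \<inter> ball x d) (cis t) \<partial>lborel) / ennreal (2 * pi)"
    by (rule nn_integral_circle) (use meas in simp)
  also have "(\<integral>\<^sup>+ t\<in>{0..<2 * pi}. indicator (sphere 0 1 \<inter> ball x d) (cis t) \<partial>lborel)
      \<le> (\<integral>\<^sup>+ t. indicator (I (- 1)) t + indicator (I 0) t + indicator (I 1) t \<partial>lborel)"
  proof (rule nn_integral_mono)
    fix t :: real
    show "indicator (sphere 0 1 \<inter> ball x d) (cis t) * indicator {0..<2 * pi} t
      \<le> (indicator (I (- 1)) t + indicator (I 0) t + indicator (I 1) t :: ennreal)"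
      using sub[of t] by (auto split: split_indicator)
  qed
  also have "\<dots> = emeasure lborel (I (- 1)) + emeasure lborel (I 0) + emeasure lborel (I 1)"
    using I_sets by (subst nn_integral_add | simp)+
  also have "\<dots> = ennreal (12 * d)"
    using d by (simp add: I_measure ennreal_plus[symmetric] del: ennreal_plus)
  finally have "emeasure circle_measure (sphere 0 1 \<inter> ball x d) \<le> ennreal (12 * d) / ennreal (2 * pi)"
    by (simp add: divide_right_mono_ennreal)
  also have "\<dots> = ennreal (12 * d / (2 * pi))"
    using d by (intro divide_ennreal) auto
  also have "\<dots> \<le> ennreal (2 * d)"
    using d pi_gt3 by (intro ennreal_leI) (auto simp: field_simps)
  finally show ?thesis .
qed

section \<open>Continuous functions on the circle as limits of real parts of polynomials\<close>

text \<open>On the circle cnj(z^i) z^j = z^(j-i) for i <= j, so Re X Re Y = (Re (X Y) + Re (cnj X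
  Y)) / 2 is again the real part of a polynomial. Traces of these harmonic functions thus form an
  algebra.\<close>

lemma Re_poly_mult_on_circle:
  "\<exists>r. \<forall>z\<in>sphere 0 1. Re (poly p z) * Re (poly q z) = Re (poly r z)"
proof -
  define H where "H = {f::complex \<Rightarrow> real. \<exists>r. \<forall>z\<in>sphere 0 1. f z = Re (poly r z)}"
  have add: "(\<lambda>z. f z + g z) \<in> H" if fg: "f \<in> H" "g \<in> H" for f g
  proof -
    obtain r r' where "\<forall>z\<in>sphere 0 1. f z = Re (poly r z)" "\<forall>z\<in>sphere 0 1. g z = Re (poly r' z)"
      using fg by (auto simp: H_def)
    then have "\<forall>z\<in>sphere 0 1. f z + g z = Re (poly (r + r') z)" by simp
    then show ?thesis unfolding H_def by blast
  qed
  have zero: "(\<lambda>z. 0) \<in> H"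
    unfolding H_def by (auto intro!: exI[of _ 0])
  have sum: "finite A \<Longrightarrow> (\<And>i. i \<in> A \<Longrightarrow> f i \<in> H) \<Longrightarrow> (\<lambda>z. \<Sum>i\<in>A. f i z) \<in> H" for A :: "nat set" and f
    by (induction A rule: finite_induct) (auto intro: zero add)
  have mono: "(\<lambda>z. Re (c * z ^ k)) \<in> H" for c k
    unfolding H_def by (auto intro!: exI[of _ "monom c k"] simp: poly_monom)
  have cong: "f \<in> H" if "g \<in> H" "\<forall>z\<in>sphere 0 1. f z = g z" for f g
    using that by (auto simp: H_def)
  have prod: "(\<lambda>z. Re (a * z ^ i) * Re (b * z ^ j)) \<in> H" if "i \<le> j" for a b i j
  proof (rule cong)
    show "(\<lambda>z. Re (a * b / 2 * z ^ (i + j)) + Re (cnj a * b / 2 * z ^ (j - i))) \<in> H"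
      by (intro add mono)
    show "\<forall>z\<in>sphere 0 1. Re (a * z ^ i) * Re (b * z ^ j)
        = Re (a * b / 2 * z ^ (i + j)) + Re (cnj a * b / 2 * z ^ (j - i))"
    proof
      fix z :: complex assume "z \<in> sphere 0 1"
      then have zz: "cnj z * z = 1"
        by (simp add: complex_norm_square[symmetric] mult.commute[of "cnj _"])
      have "cnj (z ^ i) * z ^ j = (cnj z * z) ^ i * z ^ (j - i)"
        using that by (simp add: power_mult_distrib power_add[symmetric] mult.assoc)
      then have e: "z ^ (j - i) = cnj (z ^ i) * z ^ j" using zz by simp
      have "Re X * Re Y = Re (X * Y / 2) + Re (cnj X * Y / 2)" for X Y
        by (simp add: field_simps)
      from this[of "a * z ^ i" "b * z ^ j"]
      show "Re (a * z ^ i) * Re (b * z ^ j) = Re (a * b / 2 * z ^ (i + j)) + Re (cnj a * b / 2 * z ^ (j - i))"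
        unfolding e by (simp add: power_add mult_ac)
    qed
  qed
  have prod': "(\<lambda>z. Re (a * z ^ i) * Re (b * z ^ j)) \<in> H" for a b i j
    using prod[of i j a b] prod[of j i b a] by (cases "i \<le> j") (auto simp: mult.commute)
  have "(\<lambda>z. \<Sum>i\<le>degree p. \<Sum>j\<le>degree q. Re (coeff p i * z ^ i) * Re (coeff q j * z ^ j)) \<in> H"
    by (intro sum prod') auto
  also have "(\<lambda>z. \<Sum>i\<le>degree p. \<Sum>j\<le>degree q. Re (coeff p i * z ^ i) * Re (coeff q j * z ^ j))
      = (\<lambda>z. Re (poly p z) * Re (poly q z))"
    by (simp add: poly_altdef Re_sum sum_product)
  finally show ?thesis by (auto simp: H_def)
qed

text \<open>Stone-Weierstrass, with real polynomial functions of the plane rewritten on the circle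
  as real parts of complex polynomials. The approximant is harmonic in the whole disk, so it acts as
  an approximate solution of the Dirichlet problem.\<close>

lemma Re_poly_approx_on_circle:
  fixes u :: "complex \<Rightarrow> real"
  assumes "continuous_on (sphere 0 1) u" "0 < e"
  obtains p where "\<And>w. norm w = 1 \<Longrightarrow> \<bar>u w - Re (poly p w)\<bar> < e"
proof -
  obtain g where g: "real_polynomial_function g" and ug: "\<And>w. w \<in> sphere 0 1 \<Longrightarrow> \<bar>u w - g w\<bar> < e"
    using Stone_Weierstrass_real_polynomial_function[of "sphere 0 1" u e] assms by auto
  from g have "\<exists>p. \<forall>z\<in>sphere 0 1. g z = Re (poly p z)"
  proof induction
    case (linear f)
    \<comment> \<open>A real-linear functional on the plane is the real part of multiplication by
      the constant f(1) - i f(i).\<close>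
    have "f z = Re (poly [:0, of_real (f 1) - \<i> * of_real (f \<i>):] z)" for z
    proof -
      have "z = Re z *\<^sub>R 1 + Im z *\<^sub>R \<i>"
        by (simp add: complex_eq_iff)
      then have "f z = f (Re z *\<^sub>R 1 + Im z *\<^sub>R \<i>)" by (rule arg_cong)
      also have "\<dots> = Re z * f 1 + Im z * f \<i>"
        using linear by (simp only: linear_simps real_scaleR_def)
      finally show ?thesis by simp
    qed
    then show ?case by blast
  next
    case (const c)
    show ?case by (rule exI[of _ "[:of_real c:]"]) simp
  next
    case (add f g)
    then obtain r r' where "\<forall>z\<in>sphere 0 1. f z = Re (poly r z)" "\<forall>z\<in>sphere 0 1. g z = Re (poly r' z)"
      by auto
    then show ?case by (intro exI[of _ "r + r'"]) simp
  next
    case (mult f g)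
    then obtain r r' where "\<forall>z\<in>sphere 0 1. f z = Re (poly r z)" "\<forall>z\<in>sphere 0 1. g z = Re (poly r' z)"
      by auto
    then show ?case using Re_poly_mult_on_circle[of r r'] by simp
  qed
  then obtain p where p: "\<forall>z\<in>sphere 0 1. g z = Re (poly p z)" by blast
  show ?thesis
    by (rule that[of p]) (use p ug in auto)
qed

lemma norm_le_on_disk:
  assumes "continuous_on (cball 0 1) f" "f holomorphic_on ball 0 1"
    and "\<And>w. norm w = 1 \<Longrightarrow> norm (f w) \<le> B" and "norm z \<le> 1"
  shows "norm (f z) \<le> B"
proof (rule maximum_modulus_frontier[of f "cball 0 1"])
  show "norm (f w) \<le> B" if "w \<in> frontier (cball 0 1)" for w
    using that assms(3)[of w] by simp
qed (use assms(1,2,4) in simp_all)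

lemma Re_poly_poisson:
  assumes "norm z < 1"
  shows "(\<integral>w. poisson z w * Re (poly p w) \<partial>circle_measure) = Re (poly p z)"
proof -
  have int: "integrable circle_measure (\<lambda>w. of_real (poisson z w) * poly p w)"
    by (intro continuous_on_sphere_integrable continuous_intros assms)
  have "Re (poly p z) = Re (\<integral>w. of_real (poisson z w) * poly p w \<partial>circle_measure)"
    by (subst poisson_formula) (auto intro!: continuous_intros holomorphic_intros assms)
  also have "\<dots> = (\<integral>w. Re (of_real (poisson z w) * poly p w) \<partial>circle_measure)"
    by (rule integral_Re[OF int, symmetric])
  finally show ?thesis by simp
qed

lemma poisson_integral_approx:
  assumes u: "continuous_on (sphere 0 1) u" and z: "norm z < 1"
    and p: "\<And>w. norm w = 1 \<Longrightarrow> \<bar>u w - Re (poly p w)\<bar> \<le> e"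
  shows "Re (poly p z) \<le> (\<integral>w. poisson z w * u w \<partial>circle_measure) + e"
proof -
  have "Re (poly p z) = (\<integral>w. poisson z w * Re (poly p w) \<partial>circle_measure)"
    by (simp add: Re_poly_poisson z)
  also have "\<dots> \<le> (\<integral>w. poisson z w * u w + poisson z w * e \<partial>circle_measure)"
  proof (rule integral_mono)
    fix w assume "w \<in> space circle_measure"
    then have "Re (poly p w) \<le> u w + e" using p[of w] by (simp add: abs_le_iff)
    then show "poisson z w * Re (poly p w) \<le> poisson z w * u w + poisson z w * e"
      using poisson_nonneg[OF z, of w] by (simp add: distrib_left[symmetric] mult_left_mono)
  qed (intro continuous_on_sphere_integrable continuous_intros z u)+
  also have "\<dots> = (\<integral>w. poisson z w * u w \<partial>circle_measure) + (\<integral>w. poisson z w * e \<partial>circle_measure)"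
    by (rule Bochner_Integration.integral_add)
       (intro continuous_on_sphere_integrable continuous_intros z u)+
  finally show ?thesis by (simp add: integral_poisson z)
qed

section \<open>Subharmonicity of the positive part of log |f|\<close>

lemma log_plus_nonneg: "0 \<le> log_plus x"
  by (simp add: log_plus_def)

lemma log_plus_altdef: "0 \<le> x \<Longrightarrow> log_plus x = ln (max 1 x)"
  by (cases "x = 0") (auto simp: log_plus_def max_def)

lemma le_exp_log_plus: "0 \<le> x \<Longrightarrow> x \<le> exp (log_plus x)"
  by (simp add: log_plus_altdef)

lemma log_plus_le: "0 \<le> x \<Longrightarrow> x \<le> exp y \<Longrightarrow> 0 \<le> y \<Longrightarrow> log_plus x \<le> y"
  using ln_le_cancel_iff[of "max 1 x" "exp y"] by (simp add: log_plus_altdef)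

lemma continuous_on_log_plus [continuous_intros]:
  fixes f :: "'a::topological_space \<Rightarrow> 'b::real_normed_vector"
  assumes "continuous_on S f"
  shows "continuous_on S (\<lambda>x. log_plus (norm (f x)))"
  unfolding log_plus_altdef[OF norm_ge_zero] by (intro continuous_intros assms) auto

lemma log_plus_measurable [measurable]: "log_plus \<in> borel_measurable borel"
  unfolding log_plus_def by measurable

text \<open>Re p approximates the boundary values of log^+ |f| within e, so both exp(-p) and f
  exp(-p) are bounded by exp e on the circle and, by the maximum principle, in the disk. The first
  bound gives 0 <= Re p + e, the second log |f| <= Re p + e; together they bound the positive
  part.\<close>

lemma log_plus_harmonic_majorant:
  assumes cont: "continuous_on (cball 0 1) f" and hol: "f holomorphic_on ball 0 1" and e: "0 < e"
  obtains p where "\<And>z. norm z \<le> 1 \<Longrightarrow> log_plus (norm (f z)) \<le> Re (poly p z) + e"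
    and "\<And>z. norm z < 1 \<Longrightarrow>
      Re (poly p z) \<le> (\<integral>w. poisson z w * log_plus (norm (f w)) \<partial>circle_measure) + e"
proof -
  have "continuous_on (sphere 0 1) f" by (rule continuous_on_subset[OF cont]) auto
  then have u: "continuous_on (sphere 0 1) (\<lambda>w. log_plus (norm (f w)))"
    by (intro continuous_intros)
  obtain p where p: "\<And>w. norm w = 1 \<Longrightarrow> \<bar>log_plus (norm (f w)) - Re (poly p w)\<bar> < e"
    using Re_poly_approx_on_circle[OF u e] by metis
  show ?thesis
  proof
    fix z :: complex assume z: "norm z \<le> 1"
    have "norm (exp (- poly p z)) \<le> exp e"
    proof (rule norm_le_on_disk[OF _ _ _ z])
      fix w :: complex assume "norm w = 1"
      then show "norm (exp (- poly p w)) \<le> exp e"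
        using p[of w] log_plus_nonneg[of "norm (f w)"] by (simp add: norm_exp_eq_Re)
    qed (intro continuous_intros holomorphic_intros)+
    then have 1: "0 \<le> Re (poly p z) + e" by (simp add: norm_exp_eq_Re)
    have "norm (f z * exp (- poly p z)) \<le> exp e"
    proof (rule norm_le_on_disk[OF _ _ _ z])
      fix w :: complex assume w: "norm w = 1"
      have "norm (f w * exp (- poly p w)) \<le> exp (log_plus (norm (f w))) * exp (- Re (poly p w))"
        unfolding norm_mult norm_exp_eq_Re by (intro mult_mono le_exp_log_plus) auto
      also have "\<dots> \<le> exp e"
        using p[OF w] by (simp add: exp_add[symmetric])
      finally show "norm (f w * exp (- poly p w)) \<le> exp e" .
    qed (intro continuous_intros holomorphic_intros cont hol)+
    then have "norm (f z) * exp (- Re (poly p z)) \<le> exp e"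
      by (simp only: norm_mult norm_exp_eq_Re uminus_complex.sel)
    then have "norm (f z) \<le> exp (Re (poly p z) + e)"
      by (simp add: exp_add exp_minus field_simps)
    then show "log_plus (norm (f z)) \<le> Re (poly p z) + e"
      using 1 by (intro log_plus_le) auto
  next
    fix z :: complex assume "norm z < 1"
    then show "Re (poly p z) \<le> (\<integral>w. poisson z w * log_plus (norm (f w)) \<partial>circle_measure) + e"
      by (intro poisson_integral_approx u) (use p in \<open>auto intro: less_imp_le\<close>)
  qed
qed

lemma log_plus_le_poisson_integral:
  assumes "continuous_on (cball 0 1) f" "f holomorphic_on ball 0 1" "norm z < 1"
  shows "log_plus (norm (f z)) \<le> (\<integral>w. poisson z w * log_plus (norm (f w)) \<partial>circle_measure)"
proof (rule field_le_epsilon)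
  fix e :: real assume "0 < e"
  then have "0 < e / 2" by simp
  then obtain p where p: "\<And>z. norm z \<le> 1 \<Longrightarrow> log_plus (norm (f z)) \<le> Re (poly p z) + e / 2"
    "\<And>z. norm z < 1 \<Longrightarrow>
      Re (poly p z) \<le> (\<integral>w. poisson z w * log_plus (norm (f w)) \<partial>circle_measure) + e / 2"
    by (rule log_plus_harmonic_majorant[OF assms(1,2)]) blast
  from p(1)[of z] p(2)[of z] assms(3) show "log_plus (norm (f z)) \<le> (\<integral>w. poisson z w * log_plus (norm (f w)) \<partial>circle_measure) + e"
    by linarith
qed

section \<open>A maximal inequality for Poisson integrals\<close>

text \<open>Inside the Stolz region both 1 - |z| and |w - x| are at most (1 + M) |w - z|. The kernel
  is thereby dominated by one that depends only on the height 1 - |z| and on the distance to the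
  vertex x.\<close>

lemma poisson_stolz_le:
  assumes z: "z \<in> stolz_region M x" and M: "0 < M" and w: "norm w = 1"
  shows "poisson z w \<le> 2 * (1 + M)\<^sup>2 * ((1 - norm z) / (max (1 - norm z) (norm (w - x)))\<^sup>2)"
proof -
  define \<delta> where "\<delta> = 1 - norm z"
  have z1: "norm z < 1" "norm (z - x) < M * \<delta>" using z by (auto simp: stolz_region_def \<delta>_def)
  then have \<delta>: "0 < \<delta>" by (simp add: \<delta>_def)
  have 1: "\<delta> \<le> norm (w - z)"
    using norm_triangle_ineq2[of w z] w by (simp add: \<delta>_def)
  have "norm (w - x) \<le> norm (w - z) + norm (z - x)"
    using norm_triangle_ineq[of "w - z" "z - x"] by simp
  also have "\<dots> \<le> norm (w - z) + M * norm (w - z)"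
    using z1 mult_left_mono[OF 1, of M] M by linarith
  finally have nx: "norm (w - x) \<le> norm (w - z) + M * norm (w - z)" .
  have "max \<delta> (norm (w - x)) \<le> (1 + M) * norm (w - z)"
  proof -
    have "0 \<le> M * norm (w - z)" using M by simp
    with 1 nx
    show ?thesis unfolding distrib_right mult_1_left max.bounded_iff by linarith
  qed
  then have "(max \<delta> (norm (w - x)))\<^sup>2 \<le> (1 + M)\<^sup>2 * (norm (w - z))\<^sup>2"
    using \<delta> power_mono[of "max \<delta> (norm (w - x))" "(1 + M) * norm (w - z)" 2] by (simp add: power_mult_distrib)
  moreover have "0 < (max \<delta> (norm (w - x)))\<^sup>2" using \<delta> by (intro zero_less_power) auto
  moreover have "0 < (norm (w - z))\<^sup>2" using \<delta> 1 by (intro zero_less_power) auto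
  ultimately have "1 / (norm (w - z))\<^sup>2 \<le> (1 + M)\<^sup>2 / (max \<delta> (norm (w - x)))\<^sup>2"
    by (subst pos_le_divide_eq) (simp_all add: pos_divide_le_eq)
  moreover have "1 - (norm z)\<^sup>2 \<le> 2 * \<delta>"
    using sum_power2_ge_zero[of "1 - norm z" 0] by (simp add: \<delta>_def power2_eq_square algebra_simps)
  moreover have "0 \<le> 1 - (norm z)\<^sup>2" using z1 by (simp add: power_le_one)
  ultimately have "(1 - (norm z)\<^sup>2) * (1 / (norm (w - z))\<^sup>2) \<le> 2 * \<delta> * ((1 + M)\<^sup>2 / (max \<delta> (norm (w - x)))\<^sup>2)"
    by (intro mult_mono) (use \<delta> in auto)
  then show ?thesis unfolding poisson_def \<delta>_def[symmetric] by (simp add: mult_ac)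
qed

text \<open>The witness is the least j with t < 2^j \<delta>; minimality gives 2^j \<delta> <= 2 max
  \<delta> t. The decay 4^-j outweighs the radius 2^j \<delta> of the j-th ball, so summation over
  balls will converge.\<close>

lemma dyadic_kernel_bound:
  fixes \<delta> t :: real
  assumes "0 < \<delta>" "0 \<le> t"
  obtains j where "t < 2 ^ j * \<delta>" "\<delta> / (max \<delta> t)\<^sup>2 \<le> 4 * (1 / 4) ^ j / \<delta>"
proof -
  obtain n where "t / \<delta> < 2 ^ n" using real_arch_pow[of 2 "t / \<delta>"] by auto
  then have ex: "\<exists>n. t < 2 ^ n * \<delta>" using assms by (auto simp: field_simps)
  define j where "j = (LEAST n. t < 2 ^ n * \<delta>)"
  have j: "t < 2 ^ j * \<delta>" unfolding j_def using ex by (rule LeastI_ex)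
  have "2 ^ j * \<delta> \<le> 2 * max \<delta> t"
  proof (cases j)
    case 0
    then have "2 ^ j * \<delta> = \<delta>" by simp
    then show ?thesis using assms max.cobounded1[of \<delta> t] by linarith
  next
    case (Suc i)
    then have "i < j" by simp
    then have "\<not> t < 2 ^ i * \<delta>"
      unfolding j_def by (rule not_less_Least)
    moreover have "2 ^ j * \<delta> = 2 * (2 ^ i * \<delta>)" using Suc by simp
    ultimately show ?thesis using max.cobounded2[of t \<delta>] by linarith
  qed
  then have "(2 ^ j * \<delta>)\<^sup>2 \<le> (2 * max \<delta> t)\<^sup>2"
    by (rule power_mono) (use assms(1) in simp)
  moreover have "(2 ^ j * \<delta>)\<^sup>2 = 4 ^ j * \<delta>\<^sup>2"
  proof -
    have "((2::real) ^ j)\<^sup>2 = (2\<^sup>2) ^ j" by (simp only: power_mult[symmetric] mult.commute)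
    then show ?thesis by (simp add: power_mult_distrib)
  qed
  ultimately have "4 ^ j * \<delta>\<^sup>2 \<le> (2 * max \<delta> t)\<^sup>2" by (simp only:)
  then have "4 ^ j * \<delta>\<^sup>2 \<le> 4 * (max \<delta> t)\<^sup>2" by (simp add: power_mult_distrib)
  moreover have "0 < (max \<delta> t)\<^sup>2" using assms by (intro zero_less_power) auto
  ultimately have "\<delta> / (max \<delta> t)\<^sup>2 \<le> 4 * (1 / 4) ^ j / \<delta>"
  proof -
    assume a: "4 ^ j * \<delta>\<^sup>2 \<le> 4 * (max \<delta> t)\<^sup>2" and b: "0 < (max \<delta> t)\<^sup>2"
    have "\<delta> * (4 ^ j * \<delta>) \<le> 4 * (max \<delta> t)\<^sup>2"
      using a by (simp add: power2_eq_square mult_ac)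
    then have "\<delta> \<le> 4 * (max \<delta> t)\<^sup>2 / (4 ^ j * \<delta>)"
      using assms by (subst pos_le_divide_eq) auto
    then show ?thesis
      using b by (subst pos_divide_le_eq) (auto simp: power_divide)
  qed
  then show ?thesis by (rule that[OF j])
qed

lemma ball_measurable_circle: "(\<lambda>w. indicator (ball x d) w :: ennreal) \<in> borel_measurable circle_measure"
proof -
  have "(\<lambda>w. indicator (ball x d) w :: ennreal) \<in> borel_measurable (restrict_space borel (sphere 0 1))"
    by (rule measurable_restrict_space1) (simp add: borel_measurable_indicator)
  then show ?thesis using measurable_cong_sets[OF sets_circle_measure refl] by blast
qed

text \<open>The kernel is at most the sum over j of c j times the indicator of the ball of radius
  2^j \<delta>, and c j \<kappa> 2^j \<delta> = 8 (1 + M)^2 \<kappa> 2^-j sums to the constant. In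
  effect the nontangential maximal function is controlled by the Hardy-Littlewood one.\<close>

lemma poisson_integral_stolz_le:
  fixes \<psi> :: "complex \<Rightarrow> ennreal"
  assumes [measurable]: "\<psi> \<in> borel_measurable circle_measure"
    and z: "z \<in> stolz_region M x" and M: "0 < M" and \<kappa>: "0 \<le> \<kappa>"
    and le: "\<And>d. 0 < d \<Longrightarrow> (\<integral>\<^sup>+ w\<in>ball x d. \<psi> w \<partial>circle_measure) \<le> ennreal (\<kappa> * d)"
  shows "(\<integral>\<^sup>+ w. ennreal (poisson z w) * \<psi> w \<partial>circle_measure) \<le> ennreal (16 * (1 + M)\<^sup>2 * \<kappa>)"
proof -
  define \<delta> where "\<delta> = 1 - norm z"
  have \<delta>: "0 < \<delta>" using z by (simp add: stolz_region_def \<delta>_def)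
  define c where "c j = 8 * (1 + M)\<^sup>2 * (1 / 4) ^ j / \<delta>" for j :: nat
  have c: "0 \<le> c j" for j using \<delta> by (simp add: c_def)
  note mi [measurable] = ball_measurable_circle
  have "(\<integral>\<^sup>+ w. ennreal (poisson z w) * \<psi> w \<partial>circle_measure)
      \<le> (\<integral>\<^sup>+ w. (\<Sum>j. ennreal (c j) * (\<psi> w * indicator (ball x (2 ^ j * \<delta>)) w)) \<partial>circle_measure)"
  proof (rule nn_integral_mono)
    fix w assume "w \<in> space circle_measure"
    then have w: "norm w = 1" by simp
    obtain j where j: "norm (w - x) < 2 ^ j * \<delta>" "\<delta> / (max \<delta> (norm (w - x)))\<^sup>2 \<le> 4 * (1 / 4) ^ j / \<delta>"
      using dyadic_kernel_bound[OF \<delta>, of "norm (w - x)"] by auto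
    have "poisson z w \<le> 2 * (1 + M)\<^sup>2 * (\<delta> / (max \<delta> (norm (w - x)))\<^sup>2)"
      using poisson_stolz_le[OF z M w] by (simp add: \<delta>_def)
    also have "\<dots> \<le> 2 * (1 + M)\<^sup>2 * (4 * (1 / 4) ^ j / \<delta>)"
      by (rule mult_left_mono[OF j(2)]) simp
    also have "\<dots> = c j" by (simp add: c_def)
    finally have "ennreal (poisson z w) * \<psi> w \<le> ennreal (c j) * (\<psi> w * indicator (ball x (2 ^ j * \<delta>)) w)"
      using j(1) by (auto simp: dist_norm norm_minus_commute intro!: mult_right_mono ennreal_leI)
    also have "\<dots> \<le> (\<Sum>j. ennreal (c j) * (\<psi> w * indicator (ball x (2 ^ j * \<delta>)) w))"
      using sum_le_suminf[of "\<lambda>j. ennreal (c j) * (\<psi> w * indicator (ball x (2 ^ j * \<delta>)) w)" "{j}"] by auto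
    finally show "ennreal (poisson z w) * \<psi> w \<le> (\<Sum>j. ennreal (c j) * (\<psi> w * indicator (ball x (2 ^ j * \<delta>)) w))" .
  qed
  also have "\<dots> = (\<Sum>j. \<integral>\<^sup>+ w. ennreal (c j) * (\<psi> w * indicator (ball x (2 ^ j * \<delta>)) w) \<partial>circle_measure)"
    by (intro nn_integral_suminf) measurable
  also have "\<dots> = (\<Sum>j. ennreal (c j) * (\<integral>\<^sup>+ w\<in>ball x (2 ^ j * \<delta>). \<psi> w \<partial>circle_measure))"
    by (intro suminf_cong nn_integral_cmult) measurable
  also have "\<dots> \<le> (\<Sum>j. ennreal (c j) * ennreal (\<kappa> * (2 ^ j * \<delta>)))"
    using \<delta> by (intro suminf_le mult_left_mono le) auto
  also have "\<dots> = (\<Sum>j. ennreal (8 * (1 + M)\<^sup>2 * \<kappa> * (1 / 2) ^ j))"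
  proof (rule suminf_cong)
    fix j :: nat
    have "c j * (\<kappa> * (2 ^ j * \<delta>)) = 8 * (1 + M)\<^sup>2 * \<kappa> * ((1 / 4) ^ j * 2 ^ j)"
      using \<delta> by (simp add: c_def)
    also have "(1 / 4) ^ j * 2 ^ j = (1 / 2 :: real) ^ j"
      by (simp add: power_mult_distrib[symmetric])
    finally show "ennreal (c j) * ennreal (\<kappa> * (2 ^ j * \<delta>)) = ennreal (8 * (1 + M)\<^sup>2 * \<kappa> * (1 / 2) ^ j)"
      using c[of j] \<kappa> \<delta> by (simp add: ennreal_mult[symmetric])
  qed
  also have "\<dots> = ennreal (16 * (1 + M)\<^sup>2 * \<kappa>)"
  proof (rule sums_unique[symmetric])
    have "(\<lambda>j. 8 * (1 + M)\<^sup>2 * \<kappa> * (1 / 2 :: real) ^ j) sums (8 * (1 + M)\<^sup>2 * \<kappa> * 2)"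
      using geometric_sums[of "1 / 2 :: real"] by (intro sums_mult) simp
    then show "(\<lambda>j. ennreal (8 * (1 + M)\<^sup>2 * \<kappa> * (1 / 2) ^ j)) sums ennreal (16 * (1 + M)\<^sup>2 * \<kappa>)"
      using \<kappa> by (subst sums_ennreal) (auto simp: mult_ac)
  qed
  finally show ?thesis .
qed

text \<open>With \<kappa> chosen so that the bound of \<open>poisson_integral_stolz_le\<close>
  equals \<eta>, every x in B has a ball whose \<psi>-mass exceeds \<kappa> times its radius.
  Vitali's lemma selects disjoint balls whose 5-fold enlargements cover B; an enlargement of a ball
  of radius d has measure at most 10 d, and 10 / \<kappa> is the constant of the statement.\<close>

theorem poisson_weak_type:
  fixes \<psi> :: "complex \<Rightarrow> ennreal"
  assumes \<psi> [measurable]: "\<psi> \<in> borel_measurable circle_measure" and M: "0 < M" and \<eta>: "0 < \<eta>"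
    and B: "B \<in> sets circle_measure"
    and large: "\<And>x. x \<in> B \<Longrightarrow> \<exists>z\<in>stolz_region M x. ennreal \<eta> < (\<integral>\<^sup>+ w. ennreal (poisson z w) * \<psi> w \<partial>circle_measure)"
  shows "emeasure circle_measure B \<le> ennreal (160 * (1 + M)\<^sup>2 / \<eta>) * (\<integral>\<^sup>+ w. \<psi> w \<partial>circle_measure)"
proof (cases "(\<integral>\<^sup>+ w. \<psi> w \<partial>circle_measure) = \<infinity>")
  case True
  then show ?thesis using \<eta> M by (simp add: ennreal_mult_top)
next
  case False
  define \<kappa> where "\<kappa> = \<eta> / (16 * (1 + M)\<^sup>2)"
  have \<kappa>: "0 < \<kappa>" using \<eta> M by (simp add: \<kappa>_def)
  obtain I where I: "0 \<le> I" "(\<integral>\<^sup>+ w. \<psi> w \<partial>circle_measure) = ennreal I"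
    using False by (metis ennreal_cases infinity_ennreal_def)
  have "\<exists>d>0. ennreal (\<kappa> * d) < (\<integral>\<^sup>+ w\<in>ball x d. \<psi> w \<partial>circle_measure)" if x: "x \<in> B" for x
  proof (rule ccontr)
    assume neg: "\<not> ?thesis"
    obtain z where z: "z \<in> stolz_region M x" "ennreal \<eta> < (\<integral>\<^sup>+ w. ennreal (poisson z w) * \<psi> w \<partial>circle_measure)"
      using large[OF x] by blast
    have "(\<integral>\<^sup>+ w. ennreal (poisson z w) * \<psi> w \<partial>circle_measure) \<le> ennreal (16 * (1 + M)\<^sup>2 * \<kappa>)"
      by (rule poisson_integral_stolz_le[OF \<psi> z(1) M]) (use \<kappa> neg in \<open>auto simp: not_less[symmetric]\<close>)
    also have "16 * (1 + M)\<^sup>2 * \<kappa> = \<eta>" using M by (simp add: \<kappa>_def)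
    finally show False using z(2) by simp
  qed
  then obtain d where d: "\<And>x. x \<in> B \<Longrightarrow> 0 < d x"
    "\<And>x. x \<in> B \<Longrightarrow> ennreal (\<kappa> * d x) < (\<integral>\<^sup>+ w\<in>ball x (d x). \<psi> w \<partial>circle_measure)"
    by metis
  \<comment> \<open>Vitali's lemma requires bounded radii; the bound comes from the finite total
    mass \<open>I\<close>.\<close>
  have d_le: "d x \<le> I / \<kappa>" if "x \<in> B" for x
  proof -
    have "ennreal (\<kappa> * d x) < (\<integral>\<^sup>+ w\<in>ball x (d x). \<psi> w \<partial>circle_measure)" by (rule d(2)[OF that])
    also have "\<dots> \<le> (\<integral>\<^sup>+ w. \<psi> w \<partial>circle_measure)"
      by (intro nn_integral_mono) (auto split: split_indicator)
    finally have "\<kappa> * d x < I" unfolding I(2) using I(1) \<kappa> d(1)[OF that] by (simp add: ennreal_less_iff)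
    then show ?thesis using \<kappa> by (simp add: field_simps)
  qed
  have Bsub: "B \<subseteq> (\<Union>x\<in>B. ball (id x) (d x))" using d(1) by force
  obtain C where C: "countable C" "C \<subseteq> B"
    "pairwise (\<lambda>i j. disjnt (ball (id i) (d i)) (ball (id j) (d j))) C"
    "B \<subseteq> (\<Union>i\<in>C. ball (id i) (5 * d i))"
  proof (rule Vitali_covering_lemma_balls[OF Bsub])
    show "0 < d i \<and> d i \<le> I / \<kappa>" if "i \<in> B" for i
      using d(1) d_le that by blast
  qed
  have Bsphere: "B \<subseteq> sphere 0 1" using sets.sets_into_space[OF B] by simp
  have "emeasure circle_measure B = (\<integral>\<^sup>+ w. indicator B w \<partial>circle_measure)" using B by simp
  \<comment> \<open>The sum over the countable family \<open>C\<close> is written as an integral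
    over \<open>count_space C\<close>, so that it can be interchanged with the integral over the
    circle.\<close>
  also have "\<dots> \<le> (\<integral>\<^sup>+ w. (\<integral>\<^sup>+ i. indicator (ball i (5 * d i)) w \<partial>count_space C) \<partial>circle_measure)"
  proof (rule nn_integral_mono)
    fix w
    show "indicator B w \<le> (\<integral>\<^sup>+ i. indicator (ball i (5 * d i)) w \<partial>count_space C)"
    proof (cases "w \<in> B")
      case True
      then obtain i where i: "i \<in> C" "w \<in> ball i (5 * d i)" using C(4) by auto
      have "(\<lambda>i. indicator (ball i (5 * d i)) w) i \<le> (\<integral>\<^sup>+ i. indicator (ball i (5 * d i)) w \<partial>count_space C)"
        by (rule nn_integral_ge_point[OF i(1)])
      then show ?thesis using i True by simp
    qed simp
  qed
  also have "\<dots> = (\<integral>\<^sup>+ i. (\<integral>\<^sup>+ w. indicator (ball i (5 * d i)) w \<partial>circle_measure) \<partial>count_space C)"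
    by (intro nn_integral_count_space_nn_integral C ball_measurable_circle)
  also have "\<dots> \<le> (\<integral>\<^sup>+ i. ennreal (10 / \<kappa>) * (\<integral>\<^sup>+ w\<in>ball i (d i). \<psi> w \<partial>circle_measure) \<partial>count_space C)"
  proof (rule nn_integral_mono)
    fix i assume "i \<in> space (count_space C)"
    then have i: "i \<in> B" using C by auto
    have "(\<integral>\<^sup>+ w. indicator (ball i (5 * d i)) w \<partial>circle_measure)
        = (\<integral>\<^sup>+ w. indicator (sphere 0 1 \<inter> ball i (5 * d i)) w \<partial>circle_measure)"
      by (rule nn_integral_cong) (auto split: split_indicator)
    also have "\<dots> = emeasure circle_measure (sphere 0 1 \<inter> ball i (5 * d i))"
      by (rule nn_integral_indicator) (auto simp: sets_circle_measure sets_restrict_space)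
    also have "\<dots> \<le> ennreal (2 * (5 * d i))"
      using i Bsphere d(1)[OF i] by (intro emeasure_circle_ball_le) auto
    also have "\<dots> = ennreal (10 / \<kappa>) * ennreal (\<kappa> * d i)"
      using \<kappa> d(1)[OF i] by (simp add: ennreal_mult[symmetric])
    also have "\<dots> \<le> ennreal (10 / \<kappa>) * (\<integral>\<^sup>+ w\<in>ball i (d i). \<psi> w \<partial>circle_measure)"
      using d(2)[OF i] by (intro mult_left_mono) auto
    finally show "(\<integral>\<^sup>+ w. indicator (ball i (5 * d i)) w \<partial>circle_measure)
      \<le> ennreal (10 / \<kappa>) * (\<integral>\<^sup>+ w\<in>ball i (d i). \<psi> w \<partial>circle_measure)" .
  qed
  also have "\<dots> = ennreal (10 / \<kappa>) * (\<integral>\<^sup>+ i. (\<integral>\<^sup>+ w\<in>ball i (d i). \<psi> w \<partial>circle_measure) \<partial>count_space C)"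
    by (rule nn_integral_cmult) simp
  also have "(\<integral>\<^sup>+ i. (\<integral>\<^sup>+ w\<in>ball i (d i). \<psi> w \<partial>circle_measure) \<partial>count_space C)
      = (\<integral>\<^sup>+ w. (\<integral>\<^sup>+ i. \<psi> w * indicator (ball i (d i)) w \<partial>count_space C) \<partial>circle_measure)"
    by (intro nn_integral_count_space_nn_integral[symmetric] C borel_measurable_times_ennreal \<psi> ball_measurable_circle)
  also have "\<dots> \<le> (\<integral>\<^sup>+ w. \<psi> w \<partial>circle_measure)"
  proof (rule nn_integral_mono)
    fix w
    have "(\<integral>\<^sup>+ i. \<psi> w * indicator (ball i (d i)) w \<partial>count_space C)
        = \<psi> w * (\<integral>\<^sup>+ i. indicator (ball i (d i)) w \<partial>count_space C)"
      by (rule nn_integral_cmult) simp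
    also have "(\<integral>\<^sup>+ i. indicator (ball i (d i)) w \<partial>count_space C) \<le> 1"
    proof (cases "\<exists>i\<in>C. w \<in> ball i (d i)")
      case True
      then obtain i where i: "i \<in> C" "w \<in> ball i (d i)" by blast
      have uniq: "j = i" if "j \<in> C" "w \<in> ball j (d j)" for j
      proof (rule ccontr)
        assume "j \<noteq> i"
        then have "disjnt (ball j (d j)) (ball i (d i))"
          using pairwiseD[OF C(3) that(1) i(1)] by simp
        then show False using i(2) that(2) unfolding disjnt_iff by blast
      qed
      have "(\<integral>\<^sup>+ i. indicator (ball i (d i)) w \<partial>count_space C) \<le> (\<integral>\<^sup>+ j. indicator {i} j \<partial>count_space C)"
      proof (rule nn_integral_mono)
        fix j assume "j \<in> space (count_space C)"
        then show "indicator (ball j (d j)) w \<le> (indicator {i} j :: ennreal)"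
          using uniq[of j] by (cases "w \<in> ball j (d j)") simp_all
      qed
      also have "\<dots> = 1" using i by (simp add: emeasure_count_space)
      finally show ?thesis .
    next
      case False
      then have "(\<integral>\<^sup>+ i. indicator (ball i (d i)) w \<partial>count_space C) = (\<integral>\<^sup>+ i. 0 \<partial>count_space C)"
        by (intro nn_integral_cong) (auto split: split_indicator)
      then show ?thesis by simp
    qed
    finally show "(\<integral>\<^sup>+ i. \<psi> w * indicator (ball i (d i)) w \<partial>count_space C) \<le> \<psi> w"
      by (simp add: mult_left_mono)
  qed
  finally have "emeasure circle_measure B \<le> ennreal (10 / \<kappa>) * (\<integral>\<^sup>+ w. \<psi> w \<partial>circle_measure)"
    by (simp add: mult_left_mono)
  also have "10 / \<kappa> = 160 * (1 + M)\<^sup>2 / \<eta>" by (simp add: \<kappa>_def)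
  finally show ?thesis .
qed

section \<open>Nontangential limits of bounded functions\<close>

text \<open>\<open>A\<close> is contained in the lower limit of the \<open>B j\<close>, and
  continuity from below applies to the increasing tail intersections. This carries uniform estimates
  for dilates over to the function itself.\<close>

lemma emeasure_le_of_eventually:
  fixes c :: ennreal
  assumes ev: "\<And>x. x \<in> A \<Longrightarrow> eventually (\<lambda>j. x \<in> B j) sequentially"
    and B: "\<And>j. B j \<in> sets M" and le: "\<And>j. emeasure M (B j) \<le> c"
  shows "emeasure M A \<le> c"
proof -
  define C where "C N = (\<Inter>j\<in>{N..}. B j)" for N :: nat
  have C: "C N \<in> sets M" for N
    unfolding C_def by (rule sets.countable_INT') (use B in auto)
  have "A \<subseteq> (\<Union>N. C N)"
  proof
    fix x assume "x \<in> A"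
    then obtain N where "\<forall>j\<ge>N. x \<in> B j" using ev[of x] by (auto simp: eventually_sequentially)
    then show "x \<in> (\<Union>N. C N)" by (auto simp: C_def)
  qed
  then have "emeasure M A \<le> emeasure M (\<Union>N. C N)"
    by (rule emeasure_mono) (use C in auto)
  also have "\<dots> = (SUP N. emeasure M (C N))"
    by (rule SUP_emeasure_incseq[symmetric]) (use C in \<open>auto simp: incseq_def C_def\<close>)
  also have "\<dots> \<le> c"
  proof (rule SUP_least)
    fix N
    have "emeasure M (C N) \<le> emeasure M (B N)"
      by (rule emeasure_mono) (use B in \<open>auto simp: C_def\<close>)
    then show "emeasure M (C N) \<le> c" using le[of N] by (rule order_trans)
  qed
  finally show ?thesis .
qed

section \<open>Orthogonality of powers and Parseval's identity\<close>

lemma circle_orthogonal: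
  "(\<integral>w. w ^ i * cnj (w ^ j) \<partial>circle_measure) = (if i = j then 1 else 0)"
proof -
  have le: "(\<integral>w. w ^ i * cnj (w ^ j) \<partial>circle_measure) = (if i = j then 1 else 0)" if "j \<le> i" for i j
  proof -
    have "(\<integral>w. w ^ i * cnj (w ^ j) \<partial>circle_measure) = (\<integral>w. w ^ (i - j) \<partial>circle_measure)"
    proof (rule Bochner_Integration.integral_cong[OF refl])
      fix w assume "w \<in> space circle_measure"
      then have "w * cnj w = 1" by (simp add: complex_norm_square[symmetric])
      moreover have "w ^ i * cnj (w ^ j) = w ^ (i - j) * (w * cnj w) ^ j"
        using that by (simp add: power_mult_distrib power_add[symmetric] mult.assoc[symmetric])
      ultimately show "w ^ i * cnj (w ^ j) = w ^ (i - j)" by simp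
    qed
    also have "\<dots> = 0 ^ (i - j)"
      by (rule circle_mean_value) (intro continuous_intros holomorphic_intros)+
    finally show ?thesis using that by (simp add: power_0_left)
  qed
  show ?thesis
  proof (cases "j \<le> i")
    case False
    have "(\<integral>w. w ^ i * cnj (w ^ j) \<partial>circle_measure) = (\<integral>w. cnj (w ^ j * cnj (w ^ i)) \<partial>circle_measure)"
      by (simp add: mult.commute)
    also have "\<dots> = cnj (\<integral>w. w ^ j * cnj (w ^ i) \<partial>circle_measure)"
      by (rule Bochner_Integration.integral_cnj)
    also have "\<dots> = 0" using le[of i j] False by simp
    finally show ?thesis using False by simp
  qed (rule le)
qed

lemma parseval_finite:
  "(\<integral>w. (norm (\<Sum>n<N. c n * w ^ n))\<^sup>2 \<partial>circle_measure) = (\<Sum>n<N. (norm (c n))\<^sup>2)"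
proof -
  have int: "integrable circle_measure (\<lambda>w. c i * cnj (c j) * (w ^ i * cnj (w ^ j)))" for i j
    by (intro continuous_on_sphere_integrable continuous_intros)
  have "complex_of_real (\<integral>w. (norm (\<Sum>n<N. c n * w ^ n))\<^sup>2 \<partial>circle_measure)
      = (\<integral>w. complex_of_real ((norm (\<Sum>n<N. c n * w ^ n))\<^sup>2) \<partial>circle_measure)"
    by (rule integral_complex_of_real[symmetric])
  also have "\<dots> = (\<integral>w. (\<Sum>i<N. \<Sum>j<N. c i * cnj (c j) * (w ^ i * cnj (w ^ j))) \<partial>circle_measure)"
    by (intro Bochner_Integration.integral_cong refl)
       (simp only: complex_norm_square cnj_sum sum_product complex_cnj_mult complex_cnj_power mult_ac)
  also have "\<dots> = (\<Sum>i<N. \<Sum>j<N. (\<integral>w. c i * cnj (c j) * (w ^ i * cnj (w ^ j)) \<partial>circle_measure))"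
    using int by (simp only: Bochner_Integration.integral_sum Bochner_Integration.integrable_sum)
  also have "\<dots> = (\<Sum>i<N. \<Sum>j<N. c i * cnj (c j) * (if i = j then 1 else 0))"
    by (simp only: integral_mult_right_zero circle_orthogonal)
  also have "\<dots> = (\<Sum>i<N. c i * cnj (c i))"
    by (intro sum.cong refl) (simp add: if_distrib sum.delta cong: if_cong)
  also have "\<dots> = complex_of_real (\<Sum>n<N. (norm (c n))\<^sup>2)"
    by (simp only: of_real_sum complex_norm_square)
  finally show ?thesis by (simp only: of_real_eq_iff)
qed

theorem parseval:
  assumes "summable (\<lambda>n. norm (c n))"
  shows "(\<lambda>n. (norm (c n))\<^sup>2) sums (\<integral>w. (norm (\<Sum>n. c n * w ^ n))\<^sup>2 \<partial>circle_measure)"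
proof -
  define S where "S N w = (\<Sum>n<N. c n * w ^ n)" for N and w :: complex
  define B where "B = (\<Sum>n. norm (c n))"
  have meas: "S N \<in> borel_measurable circle_measure" for N
    unfolding S_def by (intro continuous_on_sphere_measurable continuous_intros)
  have lim: "(\<lambda>N. S N w) \<longlonglongrightarrow> (\<Sum>n. c n * w ^ n)" if "norm w = 1" for w
  proof -
    have "summable (\<lambda>n. c n * w ^ n)"
      by (rule summable_norm_cancel) (use assms that in \<open>simp add: norm_mult norm_power\<close>)
    then show ?thesis unfolding S_def by (rule summable_LIMSEQ)
  qed
  have bound: "norm (S N w) \<le> B" if "norm w = 1" for N w
  proof -
    have "norm (S N w) \<le> (\<Sum>n<N. norm (c n))"
      unfolding S_def by (rule order_trans[OF norm_sum]) (simp add: norm_mult norm_power that)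
    also have "\<dots> \<le> B" unfolding B_def by (rule sum_le_suminf[OF assms]) auto
    finally show ?thesis .
  qed
  have "(\<lambda>N. \<integral>w. (norm (S N w))\<^sup>2 \<partial>circle_measure)
      \<longlonglongrightarrow> (\<integral>w. (norm (\<Sum>n. c n * w ^ n))\<^sup>2 \<partial>circle_measure)"
  proof (rule integral_dominated_convergence[where w = "\<lambda>_. B\<^sup>2"])
    have "(\<lambda>w. \<Sum>n. c n * w ^ n) \<in> borel_measurable circle_measure"
      by (rule borel_measurable_LIMSEQ_metric[OF meas]) (use lim in auto)
    then show "(\<lambda>w. (norm (\<Sum>n. c n * w ^ n))\<^sup>2) \<in> borel_measurable circle_measure" by measurable
    show "(\<lambda>w. (norm (S N w))\<^sup>2) \<in> borel_measurable circle_measure" for N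
      using meas[of N] by measurable
    show "AE w in circle_measure. (\<lambda>N. (norm (S N w))\<^sup>2) \<longlonglongrightarrow> (norm (\<Sum>n. c n * w ^ n))\<^sup>2"
      by (rule AE_I2) (auto intro!: tendsto_intros lim)
    show "AE w in circle_measure. norm ((norm (S N w))\<^sup>2) \<le> B\<^sup>2" for N
      by (rule AE_I2) (auto intro!: power_mono bound)
  qed simp
  then show ?thesis unfolding S_def parseval_finite sums_def .
qed

section \<open>Stolz regions and nontangential limits\<close>

lemma radial_in_stolz_region:
  assumes "norm x = 1" "1 < M" "0 \<le> r" "r < 1"
  shows "of_real r * x \<in> stolz_region M x"
proof -
  have "of_real r * x - x = of_real (r - 1) * x" by (simp add: algebra_simps)
  then have "norm (of_real r * x - x) = 1 - r" using assms by (simp add: norm_mult del: of_real_diff)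
  then show ?thesis using assms by (simp add: stolz_region_def norm_mult)
qed

lemma stolz_region_mono: "M \<le> M' \<Longrightarrow> stolz_region M x \<subseteq> stolz_region M' x"
proof
  fix z assume "M \<le> M'" "z \<in> stolz_region M x"
  moreover from this have "M * (1 - norm z) \<le> M' * (1 - norm z)"
    by (intro mult_right_mono) (auto simp: stolz_region_def)
  ultimately show "z \<in> stolz_region M' x" unfolding stolz_region_def mem_Collect_eq by linarith
qed

lemma has_nontangential_limit_radial:
  assumes "has_nontangential_limit f x l" and x: "norm x = 1"
  shows "((\<lambda>r. f (of_real r * x)) \<longlongrightarrow> l) (at_left 1)"
proof -
  have "(f \<longlongrightarrow> l) (at x within stolz_region 2 x)"
    using assms by (simp add: has_nontangential_limit_def)
  moreover have "((\<lambda>r. of_real r * x) \<longlongrightarrow> of_real 1 * x) (at_left (1::real))"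
    by (intro tendsto_intros)
  moreover have "\<forall>\<^sub>F r in at_left (1::real). of_real r * x \<in> stolz_region 2 x \<and> of_real r * x \<noteq> x"
  proof (rule eventually_at_leftI[of 0])
    fix r :: real assume "r \<in> {0<..<1}"
    then have "of_real r * x \<in> stolz_region 2 x" using x by (intro radial_in_stolz_region) auto
    then show "of_real r * x \<in> stolz_region 2 x \<and> of_real r * x \<noteq> x"
      using x by (auto simp: stolz_region_def)
  qed simp
  ultimately show ?thesis
    by (auto intro: filterlim_compose simp: filterlim_at)
qed

lemma has_nontangential_limit_unique:
  assumes "has_nontangential_limit f x l" "has_nontangential_limit f x l'" "norm x = 1"
  shows "l = l'"
  by (rule tendsto_unique[OF _ has_nontangential_limit_radial[OF assms(1,3)]
        has_nontangential_limit_radial[OF assms(2,3)]]) simp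

lemma boundary_fun_eq:
  assumes "has_nontangential_limit f x l" "norm x = 1"
  shows "boundary_fun f x = l"
proof -
  have "(THE l. has_nontangential_limit f x l) = l"
    by (rule the_equality) (rule assms(1), rule has_nontangential_limit_unique[OF _ assms])
  then show ?thesis using assms(1) by (auto simp: boundary_fun_def)
qed

text \<open>Cauchy's criterion with all quantifiers over natural numbers; the apertures m + 2
  exhaust all M > 1. In this form the existence of a limit is a countable condition, which gives
  measurability and lets null sets be collected separately for each aperture and tolerance.\<close>

lemma nontangential_limit_iff:
  assumes x: "norm x = 1"
  shows "(\<exists>l. has_nontangential_limit f x l) \<longleftrightarrow>
    (\<forall>m k. \<exists>j. \<forall>z\<in>stolz_region (real m + 2) x. \<forall>w\<in>stolz_region (real m + 2) x.
       dist z x < 1 / real (Suc j) \<longrightarrow> dist w x < 1 / real (Suc j) \<longrightarrow> dist (f z) (f w) \<le> 1 / real (Suc k))"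
    (is "?L \<longleftrightarrow> ?R")
proof
  assume ?L
  then obtain l where l: "has_nontangential_limit f x l" ..
  show ?R
  proof (intro allI)
    fix m k :: nat
    let ?S = "stolz_region (real m + 2) x"
    have "(f \<longlongrightarrow> l) (at x within ?S)" using l by (simp add: has_nontangential_limit_def)
    moreover have "0 < 1 / real (Suc k) / 2" by simp
    ultimately obtain d where d: "d > 0" "\<And>z. z \<in> ?S \<Longrightarrow> 0 < dist z x \<and> dist z x < d \<Longrightarrow> dist (f z) l < 1 / real (Suc k) / 2"
      unfolding Lim_within by blast
    obtain j where j: "1 / real (Suc j) < d"
      using nat_approx_posE[OF d(1)] by auto
    have "dist (f z) l < 1 / real (Suc k) / 2" if "z \<in> ?S" "dist z x < 1 / real (Suc j)" for z
    proof (rule d(2)[OF that(1)])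
      have "z \<noteq> x" using that(1) x by (auto simp: stolz_region_def)
      then show "0 < dist z x \<and> dist z x < d" using that(2) j by simp
    qed
    then have "dist (f z) (f w) \<le> 1 / real (Suc k)"
      if "z \<in> ?S" "w \<in> ?S" "dist z x < 1 / real (Suc j)" "dist w x < 1 / real (Suc j)" for z w
      using that dist_triangle_half_r[of l "f z" "1 / real (Suc k)" "f w"] by (simp add: dist_commute less_imp_le)
    then show "\<exists>j. \<forall>z\<in>?S. \<forall>w\<in>?S. dist z x < 1 / real (Suc j) \<longrightarrow> dist w x < 1 / real (Suc j)
        \<longrightarrow> dist (f z) (f w) \<le> 1 / real (Suc k)"
      by blast
  qed
next
  assume R: ?R
  \<comment> \<open>A radial sequence lies in every Stolz region of aperture above 1, so one
    candidate limit serves all apertures.\<close>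
  define zs where "zs n = of_real (1 - 1 / real (Suc n)) * x" for n
  have zs: "zs n \<in> stolz_region M x" if "1 < M" for n M
    unfolding zs_def using that x by (intro radial_in_stolz_region) auto
  have "(\<lambda>n. complex_of_real (1 - 1 / real (Suc n)) * x) \<longlonglongrightarrow> of_real (1 - 0) * x"
    by (intro tendsto_intros LIMSEQ_Suc lim_1_over_n)
  then have zlim: "zs \<longlonglongrightarrow> x" unfolding zs_def by simp
  have ev_close: "\<forall>\<^sub>F n in sequentially. dist (zs n) x < 1 / real (Suc j)" for j
    by (rule tendstoD[OF zlim]) simp
  have "Cauchy (\<lambda>n. f (zs n))"
  proof (rule metric_CauchyI)
    fix e :: real assume "0 < e"
    then obtain k where k: "1 / real (Suc k) < e" using nat_approx_posE by blast
    obtain j where j: "\<And>z w. z \<in> stolz_region (real 0 + 2) x \<Longrightarrow> w \<in> stolz_region (real 0 + 2) x \<Longrightarrow>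
       dist z x < 1 / real (Suc j) \<Longrightarrow> dist w x < 1 / real (Suc j) \<Longrightarrow> dist (f z) (f w) \<le> 1 / real (Suc k)"
      using R by blast
    obtain N where N: "\<And>n. n \<ge> N \<Longrightarrow> dist (zs n) x < 1 / real (Suc j)"
      using ev_close[of j] by (auto simp: eventually_sequentially)
    have "dist (f (zs n)) (f (zs n')) < e" if "n \<ge> N" "n' \<ge> N" for n n'
      by (rule le_less_trans[OF j k]) (use zs N that in auto)
    then show "\<exists>N. \<forall>n\<ge>N. \<forall>n'\<ge>N. dist (f (zs n)) (f (zs n')) < e" by blast
  qed
  then obtain l where l: "(\<lambda>n. f (zs n)) \<longlonglongrightarrow> l"
    using Cauchy_convergent convergent_def by blast
  have "has_nontangential_limit f x l"
    unfolding has_nontangential_limit_def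
  proof (intro allI impI)
    fix M :: real assume "1 < M"
    obtain m :: nat where m: "M \<le> real m" using real_arch_simple by blast
    let ?S = "stolz_region (real m + 2) x"
    have sub: "stolz_region M x \<subseteq> ?S" by (rule stolz_region_mono) (use m in simp)
    show "(f \<longlongrightarrow> l) (at x within stolz_region M x)"
      unfolding Lim_within
    proof (intro allI impI)
      fix e :: real assume "0 < e"
      then obtain k where k: "1 / real (Suc k) < e" using nat_approx_posE by blast
      obtain j where j: "\<And>z w. z \<in> ?S \<Longrightarrow> w \<in> ?S \<Longrightarrow>
         dist z x < 1 / real (Suc j) \<Longrightarrow> dist w x < 1 / real (Suc j) \<Longrightarrow> dist (f z) (f w) \<le> 1 / real (Suc k)"
        using R by blast
      have "dist (f z) l < e" if z: "z \<in> stolz_region M x" "dist z x < 1 / real (Suc j)" for z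
      proof -
        have "(\<lambda>n. dist (f z) (f (zs n))) \<longlonglongrightarrow> dist (f z) l" by (intro tendsto_intros l)
        moreover have "\<forall>\<^sub>F n in sequentially. dist (f z) (f (zs n)) \<le> 1 / real (Suc k)"
          using ev_close[of j]
        proof eventually_elim
          case (elim n)
          show ?case by (rule j) (use z sub zs[of "real m + 2" n] elim in auto)
        qed
        ultimately have "dist (f z) l \<le> 1 / real (Suc k)"
          by (rule tendsto_upperbound) simp
        then show ?thesis using k by simp
      qed
      then show "\<exists>d>0. \<forall>z\<in>stolz_region M x. 0 < dist z x \<and> dist z x < d \<longrightarrow> dist (f z) l < e"
        by (intro exI[of _ "1 / real (Suc j)"]) auto
    qed
  qed
  then show ?L ..
qed

section \<open>Power series, dilations and Poisson majorants of squares\<close>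

lemma power_series_on_disk:
  assumes "f holomorphic_on ball 0 1"
  obtains a where "\<And>z. norm z < 1 \<Longrightarrow> (\<lambda>n. a n * z ^ n) sums f z"
proof
  fix z :: complex assume "norm z < 1"
  then show "(\<lambda>n. (deriv ^^ n) f 0 / fact n * z ^ n) sums f z"
    using holomorphic_power_series[OF assms, of z] by simp
qed

lemma power_series_abs_summable:
  fixes a :: "nat \<Rightarrow> complex"
  assumes "\<And>z. norm z < 1 \<Longrightarrow> (\<lambda>n. a n * z ^ n) sums f z" "0 \<le> r" "r < 1"
  shows "summable (\<lambda>n. norm (a n * of_real r ^ n))"
proof -
  have "summable (\<lambda>n. a n * of_real ((1 + r) / 2) ^ n)"
    using assms(1)[of "of_real ((1 + r) / 2)"] assms(2,3) by (intro sums_summable) (simp del: of_real_divide)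
  then show ?thesis
    by (rule powser_insidea) (use assms(2,3) in \<open>simp del: of_real_divide\<close>)
qed

lemma parseval_power_series:
  fixes a :: "nat \<Rightarrow> complex"
  assumes f: "\<And>z. norm z < 1 \<Longrightarrow> (\<lambda>n. a n * z ^ n) sums f z" and r: "0 \<le> r" "r < 1"
  shows "(\<lambda>n. (norm (a n))\<^sup>2 * (r ^ n)\<^sup>2) sums (\<integral>w. (norm (f (of_real r * w)))\<^sup>2 \<partial>circle_measure)"
proof -
  have "(\<lambda>n. (norm (a n * of_real r ^ n))\<^sup>2) sums (\<integral>w. (norm (\<Sum>n. a n * of_real r ^ n * w ^ n))\<^sup>2 \<partial>circle_measure)"
    by (rule parseval[OF power_series_abs_summable[OF f r]])
  also have "(\<integral>w. (norm (\<Sum>n. a n * of_real r ^ n * w ^ n))\<^sup>2 \<partial>circle_measure)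
      = (\<integral>w. (norm (f (of_real r * w)))\<^sup>2 \<partial>circle_measure)"
  proof (rule Bochner_Integration.integral_cong[OF refl])
    fix w assume "w \<in> space circle_measure"
    then have "norm (of_real r * w) < 1" using r by (simp add: norm_mult)
    from sums_unique[OF f[OF this]]
    show "(norm (\<Sum>n. a n * of_real r ^ n * w ^ n))\<^sup>2 = (norm (f (of_real r * w)))\<^sup>2"
      by (simp add: power_mult_distrib mult.assoc)
  qed
  finally show ?thesis using r by (simp add: norm_mult norm_power power_mult_distrib)
qed

lemma dilate_holomorphic:
  assumes f: "f holomorphic_on ball 0 1" and r: "0 \<le> r" "r < 1"
  shows "continuous_on (cball 0 1) (\<lambda>w. f (of_real r * w))"
    and "(\<lambda>w. f (of_real r * w)) holomorphic_on ball 0 1"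
    and "continuous_on (sphere 0 1) (\<lambda>w. f (of_real r * w))"
proof -
  have "r * norm w < 1" if "norm w \<le> 1" for w :: complex
    using r mult_left_le[OF that r(1)] by simp
  then have sub: "(\<lambda>w. of_real r * w) ` cball 0 1 \<subseteq> (ball 0 1 :: complex set)"
    using r by (auto simp: norm_mult)
  show 1: "continuous_on (cball 0 1) (\<lambda>w. f (of_real r * w))"
    by (rule continuous_on_compose2[OF holomorphic_on_imp_continuous_on[OF f] _ sub]) (intro continuous_intros)
  show "(\<lambda>w. f (of_real r * w)) holomorphic_on ball 0 1"
  proof -
    have "f \<circ> (\<lambda>w. of_real r * w) holomorphic_on ball 0 1"
      using sub by (intro holomorphic_on_compose_gen[OF _ f] holomorphic_intros) (auto simp: image_subset_iff)
    then show ?thesis by (simp add: o_def)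
  qed
  show "continuous_on (sphere 0 1) (\<lambda>w. f (of_real r * w))"
    by (rule continuous_on_subset[OF 1]) auto
qed

text \<open>Poisson's formula for g^2 rather than g: the square leads to an integral that Parseval's
  identity evaluates.\<close>

lemma norm_square_le_poisson_integral:
  assumes g: "continuous_on (cball 0 1) g" "g holomorphic_on ball 0 1" and z: "norm z < 1"
  shows "ennreal ((norm (g z))\<^sup>2) \<le> (\<integral>\<^sup>+ w. ennreal (poisson z w) * ennreal ((norm (g w))\<^sup>2) \<partial>circle_measure)"
proof -
  have gs: "continuous_on (sphere 0 1) g" by (rule continuous_on_subset[OF g(1)]) auto
  have "(\<integral>w. of_real (poisson z w) * (g w)\<^sup>2 \<partial>circle_measure) = (g z)\<^sup>2"
    by (rule poisson_formula) (intro continuous_intros holomorphic_intros g z)+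
  then have "(norm (g z))\<^sup>2 = norm (\<integral>w. of_real (poisson z w) * (g w)\<^sup>2 \<partial>circle_measure)"
    by (simp add: norm_power)
  also have "\<dots> \<le> (\<integral>w. norm (of_real (poisson z w) * (g w)\<^sup>2) \<partial>circle_measure)"
    by (rule integral_norm_bound)
  also have "\<dots> = (\<integral>w. poisson z w * (norm (g w))\<^sup>2 \<partial>circle_measure)"
    using poisson_nonneg[OF z] by (simp add: norm_mult norm_power)
  finally have "ennreal ((norm (g z))\<^sup>2) \<le> ennreal (\<integral>w. poisson z w * (norm (g w))\<^sup>2 \<partial>circle_measure)"
    by (rule ennreal_leI)
  also have "\<dots> = (\<integral>\<^sup>+ w. ennreal (poisson z w * (norm (g w))\<^sup>2) \<partial>circle_measure)"
    by (rule nn_integral_eq_integral[symmetric])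
       (use poisson_nonneg[OF z] in \<open>auto intro!: continuous_on_sphere_integrable continuous_intros gs z\<close>)
  also have "\<dots> = (\<integral>\<^sup>+ w. ennreal (poisson z w) * ennreal ((norm (g w))\<^sup>2) \<partial>circle_measure)"
    using poisson_nonneg[OF z] by (simp add: ennreal_mult)
  finally show ?thesis .
qed

section \<open>Fatou's theorem for bounded functions\<close>

text \<open>For a fixed z, lying in the Stolz region at x is an open condition on x, so the set is a
  union of relatively open sets.\<close>

lemma stolz_exceedance_sets:
  "{x \<in> sphere 0 1. \<exists>z\<in>stolz_region M x. P z} \<in> sets circle_measure"
proof -
  have "open (\<Union>z\<in>{z\<in>ball 0 1. P z}. {x. norm (z - x) < M * (1 - norm z)})"
    by (intro open_UN ballI open_Collect_less continuous_intros)
  moreover have "{x \<in> sphere 0 1. \<exists>z\<in>stolz_region M x. P z}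
      = sphere 0 1 \<inter> (\<Union>z\<in>{z\<in>ball 0 1. P z}. {x. norm (z - x) < M * (1 - norm z)})"
    by (auto simp: stolz_region_def)
  ultimately show ?thesis
    by (auto simp: sets_circle_measure sets_restrict_space)
qed

definition radius_seq :: "nat \<Rightarrow> real" where
  "radius_seq k = 1 - 1 / real (k + 2)"

lemma radius_seq: "0 \<le> radius_seq k" "0 < radius_seq k" "radius_seq k < 1"
  by (auto simp: radius_seq_def field_simps)

lemma tendsto_radius_seq: "radius_seq \<longlonglongrightarrow> 1"
proof -
  have "(\<lambda>k. 1 - 1 / real (k + 2)) \<longlonglongrightarrow> 1 - 0"
    by (intro tendsto_intros LIMSEQ_ignore_initial_segment lim_1_over_n)
  then show ?thesis by (simp add: radius_seq_def[abs_def])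
qed

lemma filterlim_radius_seq: "filterlim radius_seq (at_left 1) sequentially"
  by (rule tendsto_imp_filterlim_at_left[OF tendsto_radius_seq])
     (use radius_seq(3) in auto)

text \<open>The exceptional set is controlled by the Poisson integral of $|F_r - F_{r\rho}|^2$, whose
  mass is small uniformly in $r$ when $\rho$ is close to $1$.\<close>

lemma stolz_exceedance_measure:
  fixes a :: "nat \<Rightarrow> complex"
  assumes f: "\<And>z. norm z < 1 \<Longrightarrow> (\<lambda>n. a n * z ^ n) sums f z" and hol: "f holomorphic_on ball 0 1"
    and sq: "summable (\<lambda>n. (norm (a n))\<^sup>2)" and M: "0 < M" and \<eta>: "0 < \<eta>" and \<rho>: "0 \<le> \<rho>" "\<rho> < 1"
  shows "emeasure circle_measure {x \<in> sphere 0 1. \<exists>z\<in>stolz_region M x. \<eta> < norm (f z - f (of_real \<rho> * z))}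
    \<le> ennreal (160 * (1 + M)\<^sup>2 / \<eta>\<^sup>2 * (\<Sum>n. (norm (a n) * (1 - \<rho> ^ n))\<^sup>2))"
proof (rule emeasure_le_of_eventually)
  define g where "g z = f z - f (of_real \<rho> * z)" for z
  \<comment> \<open>The dilates of g are continuous up to the circle, so |g|^2 on a smaller circle
    can serve as \<psi> in the weak type inequality. By continuity of g, an exceedance at z persists
    for all large j.\<close>
  define A where "A j = {x \<in> sphere 0 1. \<exists>z\<in>stolz_region M x. \<eta> < norm (g (of_real (radius_seq j) * z))}" for j
  have \<rho>1: "\<rho> ^ n \<le> 1" for n using \<rho> by (simp add: power_le_one)
  have dil: "norm (of_real \<rho> * z) < 1" if "norm z < 1" for z :: complex
    using \<rho> that mult_left_le[of "norm z" \<rho>] by (simp add: norm_mult)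
  have g: "(\<lambda>n. a n * (1 - of_real \<rho> ^ n) * z ^ n) sums g z" if "norm z < 1" for z
    using sums_diff[OF f[OF that] f[OF dil[OF that]]] by (simp add: g_def algebra_simps power_mult_distrib)
  have ghol: "g holomorphic_on ball 0 1"
    unfolding g_def[abs_def] by (intro holomorphic_intros hol dilate_holomorphic \<rho>)
  have nrm: "norm (a n * (1 - of_real \<rho> ^ n)) = norm (a n) * (1 - \<rho> ^ n)" for n
  proof -
    have "1 - (of_real \<rho> :: complex) ^ n = of_real (1 - \<rho> ^ n)" by simp
    then have "norm (1 - (of_real \<rho> :: complex) ^ n) = 1 - \<rho> ^ n" using \<rho>1[of n] by (simp only: norm_of_real)
    then show ?thesis by (simp add: norm_mult)
  qed
  have sum1: "summable (\<lambda>n. (norm (a n) * (1 - \<rho> ^ n))\<^sup>2)"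
  proof (rule summable_comparison_test'[OF sq])
    fix n
    show "norm ((norm (a n) * (1 - \<rho> ^ n))\<^sup>2) \<le> (norm (a n))\<^sup>2"
      using \<rho>1[of n] \<rho> by (auto intro!: power_mono mult_left_le)
  qed
  show "A j \<in> sets circle_measure" for j unfolding A_def by (rule stolz_exceedance_sets)
  show "eventually (\<lambda>j. x \<in> A j) sequentially"
    if x: "x \<in> {x \<in> sphere 0 1. \<exists>z\<in>stolz_region M x. \<eta> < norm (f z - f (of_real \<rho> * z))}" for x
  proof -
    obtain z where z: "norm x = 1" "z \<in> stolz_region M x" "\<eta> < norm (g z)" using x by (auto simp: g_def)
    then have zb: "z \<in> ball 0 1" by (simp add: stolz_region_def)
    have "isCont g z"
      using holomorphic_on_imp_continuous_on[OF ghol] zb by (simp add: continuous_on_eq_continuous_at)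
    moreover have "(\<lambda>j. complex_of_real (radius_seq j) * z) \<longlonglongrightarrow> of_real 1 * z"
      by (intro tendsto_intros tendsto_radius_seq)
    ultimately have "(\<lambda>j. norm (g (of_real (radius_seq j) * z))) \<longlonglongrightarrow> norm (g z)"
      by (intro tendsto_norm isCont_tendsto_compose[of z g]) auto
    then have "\<forall>\<^sub>F j in sequentially. \<eta> < norm (g (of_real (radius_seq j) * z))"
      using z(3) by (rule order_tendstoD)
    then show ?thesis
      by eventually_elim (use z in \<open>auto simp: A_def\<close>)
  qed
  show "emeasure circle_measure (A j)
      \<le> ennreal (160 * (1 + M)\<^sup>2 / \<eta>\<^sup>2 * (\<Sum>n. (norm (a n) * (1 - \<rho> ^ n))\<^sup>2))" for j
  proof -
    let ?r = "radius_seq j"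
    note r = radius_seq(1)[of j] radius_seq(3)[of j]
    note gr = dilate_holomorphic[OF ghol r]
    have "emeasure circle_measure (A j)
        \<le> ennreal (160 * (1 + M)\<^sup>2 / \<eta>\<^sup>2) * (\<integral>\<^sup>+ w. ennreal ((norm (g (of_real ?r * w)))\<^sup>2) \<partial>circle_measure)"
    proof (rule poisson_weak_type)
      show "(\<lambda>w. ennreal ((norm (g (of_real ?r * w)))\<^sup>2)) \<in> borel_measurable circle_measure"
        by (intro measurable_compose[OF _ measurable_ennreal] continuous_on_sphere_measurable continuous_intros gr)
      show "A j \<in> sets circle_measure" unfolding A_def by (rule stolz_exceedance_sets)
      show "\<exists>z\<in>stolz_region M x. ennreal (\<eta>\<^sup>2)
          < (\<integral>\<^sup>+ w. ennreal (poisson z w) * ennreal ((norm (g (of_real ?r * w)))\<^sup>2) \<partial>circle_measure)"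
        if xA: "x \<in> A j" for x
      proof -
        obtain z where z: "z \<in> stolz_region M x" "\<eta> < norm (g (of_real ?r * z))" using xA by (auto simp: A_def)
        have "ennreal (\<eta>\<^sup>2) < ennreal ((norm (g (of_real ?r * z)))\<^sup>2)"
          using z(2) \<eta> by (intro ennreal_lessI power_strict_mono) auto
        also have "\<dots> \<le> (\<integral>\<^sup>+ w. ennreal (poisson z w) * ennreal ((norm (g (of_real ?r * w)))\<^sup>2) \<partial>circle_measure)"
          by (rule norm_square_le_poisson_integral[OF gr(1,2)]) (use z(1) in \<open>simp add: stolz_region_def\<close>)
        finally show ?thesis using z(1) by blast
      qed
    qed (use M \<eta> in auto)
    also have "(\<integral>\<^sup>+ w. ennreal ((norm (g (of_real ?r * w)))\<^sup>2) \<partial>circle_measure)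
        = ennreal (\<integral>w. (norm (g (of_real ?r * w)))\<^sup>2 \<partial>circle_measure)"
      by (rule nn_integral_eq_integral) (auto intro!: continuous_on_sphere_integrable continuous_intros gr)
    also have "\<dots> \<le> ennreal (\<Sum>n. (norm (a n) * (1 - \<rho> ^ n))\<^sup>2)"
    proof (rule ennreal_leI)
      have s: "(\<lambda>n. (norm (a n * (1 - of_real \<rho> ^ n)))\<^sup>2 * (?r ^ n)\<^sup>2) sums (\<integral>w. (norm (g (of_real ?r * w)))\<^sup>2 \<partial>circle_measure)"
        by (rule parseval_power_series[OF g r])
      have "(\<Sum>n. (norm (a n * (1 - of_real \<rho> ^ n)))\<^sup>2 * (?r ^ n)\<^sup>2) \<le> (\<Sum>n. (norm (a n) * (1 - \<rho> ^ n))\<^sup>2)"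
      proof (rule suminf_le[OF _ sums_summable[OF s] sum1])
        fix n
        have "(?r ^ n)\<^sup>2 \<le> 1" using r by (simp add: power_le_one)
        then show "(norm (a n * (1 - of_real \<rho> ^ n)))\<^sup>2 * (?r ^ n)\<^sup>2 \<le> (norm (a n) * (1 - \<rho> ^ n))\<^sup>2"
          unfolding nrm by (rule mult_left_le) simp
      qed
      then show "(\<integral>w. (norm (g (of_real ?r * w)))\<^sup>2 \<partial>circle_measure) \<le> (\<Sum>n. (norm (a n) * (1 - \<rho> ^ n))\<^sup>2)"
        using sums_unique[OF s] by simp
    qed
    finally show ?thesis
      using M by (simp add: ennreal_mult[symmetric] suminf_nonneg[OF sum1] mult_left_mono)
  qed
qed

lemma bounded_square_summable:
  fixes a :: "nat \<Rightarrow> complex"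
  assumes f: "\<And>z. norm z < 1 \<Longrightarrow> (\<lambda>n. a n * z ^ n) sums f z"
    and bd: "\<And>z. norm z < 1 \<Longrightarrow> norm (f z) \<le> B"
  shows "summable (\<lambda>n. (norm (a n))\<^sup>2)"
proof (rule summableI_nonneg_bounded)
  fix N
  have "(\<Sum>n<N. (norm (a n))\<^sup>2 * (radius_seq k ^ n)\<^sup>2) \<le> B\<^sup>2" for k
  proof -
    let ?r = "radius_seq k"
    note r = radius_seq(1)[of k] radius_seq(3)[of k]
    note s = parseval_power_series[OF f r]
    have "(\<Sum>n<N. (norm (a n))\<^sup>2 * (?r ^ n)\<^sup>2) \<le> (\<Sum>n. (norm (a n))\<^sup>2 * (?r ^ n)\<^sup>2)"
      by (rule sum_le_suminf[OF sums_summable[OF s]]) auto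
    also have "\<dots> = (\<integral>w. (norm (f (of_real ?r * w)))\<^sup>2 \<partial>circle_measure)"
      by (rule sums_unique[OF s, symmetric])
    also have "\<dots> \<le> (\<integral>w. B\<^sup>2 \<partial>circle_measure)"
    proof (rule integral_mono')
      fix w assume "w \<in> space circle_measure"
      then show "(norm (f (of_real ?r * w)))\<^sup>2 \<le> B\<^sup>2"
        using r bd[of "of_real ?r * w"] by (intro power_mono) (auto simp: norm_mult)
    qed auto
    finally show ?thesis using circle.prob_space by simp
  qed
  moreover have "(\<lambda>k. \<Sum>n<N. (norm (a n))\<^sup>2 * (radius_seq k ^ n)\<^sup>2) \<longlonglongrightarrow> (\<Sum>n<N. (norm (a n))\<^sup>2 * (1 ^ n)\<^sup>2)"
    by (intro tendsto_intros tendsto_radius_seq)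
  ultimately show "(\<Sum>n<N. (norm (a n))\<^sup>2) \<le> B\<^sup>2"
    by (intro LIMSEQ_le_const2[where X = "\<lambda>k. \<Sum>n<N. (norm (a n))\<^sup>2 * (radius_seq k ^ n)\<^sup>2"]) auto
qed simp

text \<open>Off a null set some dilate of f stays within 1 / (i+1) of f throughout the Stolz region,
  because the exceptional sets shrink as the radius tends to 1. The dilate is continuous at x, so f
  oscillates little near x.\<close>

theorem fatou_bounded:
  assumes hol: "f holomorphic_on ball 0 1" and bd: "\<And>z. norm z < 1 \<Longrightarrow> norm (f z) \<le> B"
  shows "AE x in circle_measure. \<exists>l. has_nontangential_limit f x l"
proof -
  obtain a where f: "\<And>z. norm z < 1 \<Longrightarrow> (\<lambda>n. a n * z ^ n) sums f z"
    using power_series_on_disk[OF hol] by blast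
  have sq: "summable (\<lambda>n. (norm (a n))\<^sup>2)" by (rule bounded_square_summable[OF f bd])
  \<comment> \<open>The squared l^2 distance between the coefficients of f and those of its dilate;
    it tends to 0 by dominated convergence of series.\<close>
  define E where "E k = (\<Sum>n. (norm (a n) * (1 - radius_seq k ^ n))\<^sup>2)" for k
  have "(\<lambda>k. E k) \<longlonglongrightarrow> (\<Sum>n. (norm (a n) * (1 - 1 ^ n))\<^sup>2)"
    unfolding E_def
  proof (rule tannerys_theorem[THEN conjunct2, THEN conjunct2])
    show "(\<lambda>k. (norm (a n) * (1 - radius_seq k ^ n))\<^sup>2) \<longlonglongrightarrow> (norm (a n) * (1 - 1 ^ n))\<^sup>2" for n
      by (intro tendsto_intros tendsto_radius_seq)
    show "\<forall>\<^sub>F (n, k) in at_top \<times>\<^sub>F sequentially. norm ((norm (a n) * (1 - radius_seq k ^ n))\<^sup>2) \<le> (norm (a n))\<^sup>2"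
    proof (rule always_eventually, clarify)
      fix n k
      have "radius_seq k ^ n \<le> 1" "0 \<le> radius_seq k ^ n"
        using radius_seq[of k] by (auto simp: power_le_one)
      then show "norm ((norm (a n) * (1 - radius_seq k ^ n))\<^sup>2) \<le> (norm (a n))\<^sup>2"
        by (auto intro!: power_mono mult_left_le)
    qed
  qed (use sq in auto)
  then have E0: "E \<longlonglongrightarrow> 0" by simp
  define A where "A m i k = {x \<in> sphere 0 1. \<exists>z\<in>stolz_region (real m + 2) x.
      1 / real (Suc i) < norm (f z - f (of_real (radius_seq k) * z))}" for m i k :: nat
  define N where "N m i = (\<Inter>k. A m i k)" for m i
  have A: "A m i k \<in> sets circle_measure" for m i k
    unfolding A_def by (rule stolz_exceedance_sets)
  have null: "N m i \<in> null_sets circle_measure" for m i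
  proof -
    let ?c = "160 * (1 + (real m + 2))\<^sup>2 / (1 / real (Suc i))\<^sup>2"
    have "emeasure circle_measure (N m i) \<le> ennreal (?c * E k)" for k
    proof -
      have "emeasure circle_measure (N m i) \<le> emeasure circle_measure (A m i k)"
        by (rule emeasure_mono) (auto simp: N_def A)
      also have "\<dots> \<le> ennreal (?c * E k)"
        unfolding A_def E_def using radius_seq[of k]
        by (intro stolz_exceedance_measure[OF f hol sq]) auto
      finally show ?thesis .
    qed
    moreover have "(\<lambda>k. ennreal (?c * E k)) \<longlonglongrightarrow> ennreal (?c * 0)"
      by (intro tendsto_ennrealI tendsto_intros E0)
    ultimately have "emeasure circle_measure (N m i) \<le> ennreal (?c * 0)"
      by (intro LIMSEQ_le_const) auto
    then have "emeasure circle_measure (N m i) = 0" by simp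
    moreover have "N m i \<in> sets circle_measure"
      unfolding N_def by (rule sets.countable_INT') (use A in auto)
    ultimately show ?thesis by (simp add: null_sets_def)
  qed
  have "(\<Union>m. \<Union>i. N m i) \<in> null_sets circle_measure"
    by (intro null_sets_UN null)
  then have "AE x in circle_measure. x \<notin> (\<Union>m. \<Union>i. N m i)" by (rule AE_not_in)
  then show ?thesis
  proof (rule AE_mp, intro AE_I2 impI)
    fix x assume xs: "x \<in> space circle_measure" and xN: "x \<notin> (\<Union>m. \<Union>i. N m i)"
    have x: "norm x = 1" using xs by simp
    show "\<exists>l. has_nontangential_limit f x l"
      unfolding nontangential_limit_iff[OF x]
    proof (intro allI)
      fix m k :: nat
      \<comment> \<open>Three errors of size 1 / (i+1) add up to 1 / (k+1): two for replacing f by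
        its dilate, one for the oscillation of the dilate.\<close>
      define i where "i = 3 * k + 2"
      have i3: "3 / real (Suc i) = 1 / real (Suc k)" by (simp add: i_def field_simps)
      let ?S = "stolz_region (real m + 2) x"
      obtain k' where k': "x \<notin> A m i k'" using xN by (auto simp: N_def)
      let ?\<rho> = "radius_seq k'"
      have close: "dist (f z) (f (of_real ?\<rho> * z)) \<le> 1 / real (Suc i)" if "z \<in> ?S" for z
        using k' that xs by (auto simp: A_def dist_norm not_less)
      have "isCont f (of_real ?\<rho> * x)"
        using holomorphic_on_imp_continuous_on[OF hol] x radius_seq[of k']
        by (simp add: continuous_on_eq_continuous_at norm_mult)
      moreover have "isCont (\<lambda>z. of_real ?\<rho> * z) x" by (intro continuous_intros)
      ultimately have "isCont (\<lambda>z. f (of_real ?\<rho> * z)) x"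
        by (rule isCont_o2[rotated])
      moreover have "0 < 1 / real (Suc i) / 2" by simp
      ultimately obtain d where d: "d > 0" "\<And>z. dist z x < d \<Longrightarrow> dist (f (of_real ?\<rho> * z)) (f (of_real ?\<rho> * x)) < 1 / real (Suc i) / 2"
        unfolding continuous_at_eps_delta by blast
      obtain j where j: "1 / real (Suc j) < d" using nat_approx_posE[OF d(1)] by auto
      have "dist (f z) (f w) \<le> 1 / real (Suc k)"
        if "z \<in> ?S" "w \<in> ?S" "dist z x < 1 / real (Suc j)" "dist w x < 1 / real (Suc j)" for z w
      proof -
        have "dist (f (of_real ?\<rho> * z)) (f (of_real ?\<rho> * w)) < 1 / real (Suc i)"
          by (rule dist_triangle_half_l[OF d(2) d(2)]) (rule less_trans[OF that(3) j], rule less_trans[OF that(4) j])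
        moreover have "dist (f (of_real ?\<rho> * w)) (f w) \<le> 1 / real (Suc i)"
          using close[OF that(2)] by (simp only: dist_commute)
        moreover have "dist (f z) (f w) \<le> dist (f z) (f (of_real ?\<rho> * z)) + dist (f (of_real ?\<rho> * z)) (f w)"
          by (rule dist_triangle)
        moreover have "dist (f (of_real ?\<rho> * z)) (f w)
            \<le> dist (f (of_real ?\<rho> * z)) (f (of_real ?\<rho> * w)) + dist (f (of_real ?\<rho> * w)) (f w)"
          by (rule dist_triangle)
        ultimately have "dist (f z) (f w) \<le> 1 / real (Suc i) + 1 / real (Suc i) + 1 / real (Suc i)"
          using close[OF that(1)] by linarith
        also have "\<dots> = 3 / real (Suc i)" by simp
        finally show ?thesis unfolding i3 .
      qed
      then show "\<exists>j. \<forall>z\<in>?S. \<forall>w\<in>?S. dist z x < 1 / real (Suc j) \<longrightarrow> dist w x < 1 / real (Suc j)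
          \<longrightarrow> dist (f z) (f w) \<le> 1 / real (Suc k)"
        by blast
    qed
  qed
qed

section \<open>Boundary functions in the Nevanlinna and Smirnov classes\<close>

lemma nevanlinna_class_bound:
  assumes "f \<in> nevanlinna_class"
  obtains C where "0 \<le> C"
    "\<And>r. 0 \<le> r \<Longrightarrow> r < 1 \<Longrightarrow> log_plus_integral (\<lambda>z. f (of_real r * z)) \<le> ennreal C"
proof -
  have "(SUP r\<in>{0..<1::real}. log_plus_integral (\<lambda>z. f (complex_of_real r * z))) < \<infinity>"
    using assms by (simp add: nevanlinna_class_def)
  then obtain C where C: "0 \<le> C" "(SUP r\<in>{0..<1::real}. log_plus_integral (\<lambda>z. f (complex_of_real r * z))) = ennreal C"
    by (cases "SUP r\<in>{0..<1::real}. log_plus_integral (\<lambda>z. f (complex_of_real r * z))") auto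
  have "log_plus_integral (\<lambda>z. f (of_real r * z)) \<le> ennreal C" if "0 \<le> r" "r < 1" for r
    unfolding C(2)[symmetric] by (rule SUP_upper) (use that in auto)
  then show ?thesis using C(1) that by blast
qed

lemma log_plus_integral_eq:
  assumes "continuous_on (sphere 0 1) g"
  shows "log_plus_integral g = ennreal (\<integral>w. log_plus (norm (g w)) \<partial>circle_measure)"
  unfolding log_plus_integral_def
  by (rule nn_integral_eq_integral)
     (auto intro!: continuous_on_sphere_integrable continuous_intros assms simp: log_plus_nonneg)

lemma circle_markov:
  assumes u: "continuous_on (sphere 0 1) u" and nonneg: "\<And>w. norm w = 1 \<Longrightarrow> 0 \<le> u w"
    and le: "(\<integral>w. u w \<partial>circle_measure) \<le> C" and t: "0 < t"
  shows "emeasure circle_measure {w \<in> space circle_measure. t < u w} \<le> ennreal (C / t)"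
proof -
  have m: "u \<in> borel_measurable circle_measure" by (rule continuous_on_sphere_measurable[OF u])
  have "{w \<in> space circle_measure. t < u w} \<in> sets circle_measure"
    using m by measurable
  then have "emeasure circle_measure {w \<in> space circle_measure. t < u w}
      = (\<integral>\<^sup>+ w. indicator {w \<in> space circle_measure. t < u w} w \<partial>circle_measure)"
    by (rule nn_integral_indicator[symmetric])
  also have "\<dots> \<le> (\<integral>\<^sup>+ w. ennreal (u w / t) \<partial>circle_measure)"
  proof (rule nn_integral_mono)
    fix w assume "w \<in> space circle_measure"
    then show "indicator {w \<in> space circle_measure. t < u w} w \<le> ennreal (u w / t)"
      using t by (auto simp: indicator_def)
  qed
  also have "\<dots> = ennreal (\<integral>w. u w / t \<partial>circle_measure)"
    by (rule nn_integral_eq_integral)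
       (use t nonneg in \<open>auto intro!: continuous_on_sphere_integrable continuous_intros u\<close>)
  also have "\<dots> \<le> ennreal (C / t)"
    using le t by (intro ennreal_leI) (simp add: divide_right_mono)
  finally show ?thesis .
qed

text \<open>-log |H k| = Re p_k + 1 is nonnegative and harmonic, with value at most C + 2 at the
  origin. Markov's inequality therefore bounds, uniformly in k and in the radius, the part of the
  circle where |H k| is small. The bound survives the limit and later excludes vanishing boundary
  values of h.\<close>

lemma nevanlinna_quotient:
  assumes f: "f \<in> nevanlinna_class"
  obtains h C where "h holomorphic_on ball 0 1" "\<And>z. norm z < 1 \<Longrightarrow> norm (h z) \<le> 1"
    "\<And>z. norm z < 1 \<Longrightarrow> norm (f z * h z) \<le> 1"
    "\<And>r t. 0 \<le> r \<Longrightarrow> r < 1 \<Longrightarrow> 0 < t \<Longrightarrow>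
      emeasure circle_measure {w \<in> space circle_measure. norm (h (of_real r * w)) < exp (- t)} \<le> ennreal (C / t)"
proof -
  have hol: "f holomorphic_on ball 0 1" using f by (simp add: nevanlinna_class_def)
  obtain C where C: "0 \<le> C"
    "\<And>r. 0 \<le> r \<Longrightarrow> r < 1 \<Longrightarrow> log_plus_integral (\<lambda>z. f (of_real r * z)) \<le> ennreal C"
    by (rule nevanlinna_class_bound[OF f]) blast
  define F where "F k z = f (of_real (radius_seq k) * z)" for k z
  note Fk = dilate_holomorphic[OF hol radius_seq(1) radius_seq(3), folded F_def]
  have "\<exists>p. (\<forall>z. norm z \<le> 1 \<longrightarrow> log_plus (norm (F k z)) \<le> Re (poly p z) + 1) \<and> Re (poly p 0) \<le> C + 1" for k
  proof -
    have "ennreal (\<integral>w. log_plus (norm (F k w)) \<partial>circle_measure) \<le> ennreal C"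
      using C(2)[of "radius_seq k"] radius_seq[of k] log_plus_integral_eq[OF Fk(3)]
      by (simp add: F_def)
    then have le: "(\<integral>w. log_plus (norm (F k w)) \<partial>circle_measure) \<le> C" using C(1) by simp
    have p0: "(\<integral>w. poisson 0 w * log_plus (norm (F k w)) \<partial>circle_measure)
        = (\<integral>w. log_plus (norm (F k w)) \<partial>circle_measure)"
      by (rule Bochner_Integration.integral_cong) (auto simp: poisson_def)
    obtain p where p: "\<And>z. norm z \<le> 1 \<Longrightarrow> log_plus (norm (F k z)) \<le> Re (poly p z) + 1"
      "\<And>z. norm z < 1 \<Longrightarrow> Re (poly p z) \<le> (\<integral>w. poisson z w * log_plus (norm (F k w)) \<partial>circle_measure) + 1"
      by (rule log_plus_harmonic_majorant[OF Fk(1,2) zero_less_one]) blast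
    have "Re (poly p 0) \<le> C + 1" using p(2)[of 0] p0 le by simp
    with p(1) show ?thesis by blast
  qed
  then obtain p where p: "\<And>k z. norm z \<le> 1 \<Longrightarrow> log_plus (norm (F k z)) \<le> Re (poly (p k) z) + 1"
    "\<And>k. Re (poly (p k) 0) \<le> C + 1" by metis
  \<comment> \<open>The extra -1 absorbs the error 1 of the harmonic approximation, so that
    \<open>H k\<close> and its product with \<open>F k\<close> are both bounded by 1 on the closed
    disk.\<close>
  define H where "H k z = exp (- poly (p k) z - 1)" for k z
  have nH: "norm (H k z) = exp (- (Re (poly (p k) z) + 1))" for k z
    by (simp add: H_def norm_exp_eq_Re)
  have H1: "norm (H k z) \<le> 1" if "norm z \<le> 1" for k z
    using p(1)[OF that, of k] log_plus_nonneg[of "norm (F k z)"] by (simp add: nH)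
  have H2: "norm (F k z * H k z) \<le> 1" if "norm z \<le> 1" for k z
  proof -
    have "norm (F k z) \<le> exp (log_plus (norm (F k z)))" by (rule le_exp_log_plus) simp
    also have "\<dots> \<le> exp (Re (poly (p k) z) + 1)" using p(1)[OF that, of k] by simp
    finally have "norm (F k z) * exp (- (Re (poly (p k) z) + 1)) \<le> exp (Re (poly (p k) z) + 1) * exp (- (Re (poly (p k) z) + 1))"
      by (rule mult_right_mono) simp
    then show ?thesis by (simp only: norm_mult nH exp_minus_inverse)
  qed
  have Hhol: "H k holomorphic_on ball 0 1" for k
    unfolding H_def by (intro holomorphic_intros)
  define \<H> where "\<H> = {h. h holomorphic_on ball 0 1 \<and> (\<forall>z\<in>ball 0 1. norm (h z :: complex) \<le> 1)}"
  obtain h \<sigma> where h: "h holomorphic_on ball 0 1" and \<sigma>: "strict_mono (\<sigma> :: nat \<Rightarrow> nat)"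
    and lim: "\<And>z. z \<in> ball 0 1 \<Longrightarrow> (\<lambda>n. H (\<sigma> n) z) \<longlonglongrightarrow> h z"
  proof (rule Montel[of "ball 0 1" \<H> H])
    show "range H \<subseteq> \<H>"
      using H1 Hhol by (auto simp: \<H>_def)
    show "\<exists>B. \<forall>h\<in>\<H>. \<forall>z\<in>K. norm (h z) \<le> B" if "compact K" "K \<subseteq> ball 0 1" for K
      using that(2) by (intro exI[of _ 1]) (auto simp: \<H>_def)
  qed (auto simp: \<H>_def)
  show ?thesis
  proof (rule that[of h "C + 2"])
    show "h holomorphic_on ball 0 1" by fact
  next
    fix z :: complex assume z: "norm z < 1"
    have "(\<lambda>n. norm (H (\<sigma> n) z)) \<longlonglongrightarrow> norm (h z)" using z by (intro tendsto_intros lim) simp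
    then show "norm (h z) \<le> 1" by (rule LIMSEQ_le_const2) (use H1 z in auto)
    have "isCont f z"
      using holomorphic_on_imp_continuous_on[OF hol] z by (simp add: continuous_on_eq_continuous_at)
    moreover have "(\<lambda>n. complex_of_real (radius_seq (\<sigma> n)) * z) \<longlonglongrightarrow> of_real 1 * z"
      by (intro tendsto_intros LIMSEQ_subseq_LIMSEQ[OF tendsto_radius_seq \<sigma>, unfolded o_def])
    ultimately have "(\<lambda>n. F (\<sigma> n) z) \<longlonglongrightarrow> f z"
      unfolding F_def by (intro isCont_tendsto_compose[of z f]) auto
    then have "(\<lambda>n. norm (F (\<sigma> n) z * H (\<sigma> n) z)) \<longlonglongrightarrow> norm (f z * h z)"
      using z by (intro tendsto_intros lim) auto
    then show "norm (f z * h z) \<le> 1" by (rule LIMSEQ_le_const2) (use H2 z in auto)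
  next
    fix r t :: real assume r: "0 \<le> r" "r < 1" and t: "0 < t"
    let ?B = "\<lambda>k. {w \<in> space circle_measure. norm (H k (of_real r * w)) < exp (- t)}"
    have rw: "norm (of_real r * w) < 1" if "norm w = 1" for w :: complex
      using r that by (simp add: norm_mult)
    have B: "?B k = {w \<in> space circle_measure. t < Re (poly (p k) (of_real r * w)) + 1}" for k
      by (auto simp: nH)
    show "emeasure circle_measure {w \<in> space circle_measure. norm (h (of_real r * w)) < exp (- t)} \<le> ennreal ((C + 2) / t)"
    proof (rule emeasure_le_of_eventually)
      fix w assume w: "w \<in> {w \<in> space circle_measure. norm (h (of_real r * w)) < exp (- t)}"
      then have "(\<lambda>n. norm (H (\<sigma> n) (of_real r * w))) \<longlonglongrightarrow> norm (h (of_real r * w))"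
        using rw[of w] by (intro tendsto_intros lim) simp
      then have "\<forall>\<^sub>F n in sequentially. norm (H (\<sigma> n) (of_real r * w)) < exp (- t)"
        by (rule order_tendstoD) (use w in simp)
      then show "\<forall>\<^sub>F n in sequentially. w \<in> ?B (\<sigma> n)"
        by eventually_elim (use w in auto)
    next
      fix n
      have c: "continuous_on S (\<lambda>w. Re (poly (p (\<sigma> n)) (of_real r * w)) + 1)" for S
        by (intro continuous_intros)
      show "?B (\<sigma> n) \<in> sets circle_measure"
        unfolding B using continuous_on_sphere_measurable[OF c] by measurable
      show "emeasure circle_measure (?B (\<sigma> n)) \<le> ennreal ((C + 2) / t)"
        unfolding B
      proof (rule circle_markov[OF c _ _ t])
        show "0 \<le> Re (poly (p (\<sigma> n)) (of_real r * w)) + 1" if "norm w = 1" for w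
          using p(1)[of "of_real r * w" "\<sigma> n"] rw[OF that] log_plus_nonneg[of "norm (F (\<sigma> n) (of_real r * w))"] by simp
        have i: "integrable circle_measure (\<lambda>w. poly (p (\<sigma> n)) (of_real r * w))"
          by (intro continuous_on_sphere_integrable continuous_intros)
        have "(\<integral>w. Re (poly (p (\<sigma> n)) (of_real r * w)) + 1 \<partial>circle_measure)
            = Re (\<integral>w. poly (p (\<sigma> n)) (of_real r * w) \<partial>circle_measure) + 1"
          using i circle.prob_space by (subst Bochner_Integration.integral_add) auto
        also have "(\<integral>w. poly (p (\<sigma> n)) (of_real r * w) \<partial>circle_measure) = poly (p (\<sigma> n)) 0"
          by (subst circle_mean_value) (auto intro!: continuous_intros holomorphic_intros)
        finally show "(\<integral>w. Re (poly (p (\<sigma> n)) (of_real r * w)) + 1 \<partial>circle_measure) \<le> C + 2"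
          using p(2)[of "\<sigma> n"] by simp
      qed
    qed
  qed
qed

theorem fatou_nevanlinna:
  assumes f: "f \<in> nevanlinna_class"
  shows "AE x in circle_measure. \<exists>l. has_nontangential_limit f x l"
proof -
  have hol: "f holomorphic_on ball 0 1" using f by (simp add: nevanlinna_class_def)
  obtain h C where h: "h holomorphic_on ball 0 1" "\<And>z. norm z < 1 \<Longrightarrow> norm (h z) \<le> 1"
    "\<And>z. norm z < 1 \<Longrightarrow> norm (f z * h z) \<le> 1"
    and C: "\<And>r t. 0 \<le> r \<Longrightarrow> r < 1 \<Longrightarrow> 0 < t \<Longrightarrow>
      emeasure circle_measure {w \<in> space circle_measure. norm (h (of_real r * w)) < exp (- t)} \<le> ennreal (C / t)"
    by (rule nevanlinna_quotient[OF f]) blast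
  have hm: "(\<lambda>w. h (of_real (radius_seq j) * w)) \<in> borel_measurable circle_measure" for j
    by (intro continuous_on_sphere_measurable dilate_holomorphic(3)[OF h(1)] radius_seq)
  \<comment> \<open>The points where h tends to 0 along the radii \<open>radius_seq\<close>, encoded
    by countably many thresholds. The bounds C / (t+1) make this set null; off it a limit of h is
    nonzero, and dividing f h by h is legitimate.\<close>
  define Z where "Z = {w \<in> space circle_measure. \<forall>t::nat. \<exists>N. \<forall>j\<ge>N. norm (h (of_real (radius_seq j) * w)) < exp (- real (Suc t))}"
  have Z: "Z \<in> sets circle_measure" unfolding Z_def using hm by measurable
  have "emeasure circle_measure Z \<le> ennreal (C / real (Suc t))" for t :: nat
  proof (rule emeasure_le_of_eventually)
    fix x assume "x \<in> Z"
    then obtain N where "\<forall>j\<ge>N. norm (h (of_real (radius_seq j) * x)) < exp (- real (Suc t))" "x \<in> space circle_measure"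
      unfolding Z_def by blast
    then show "\<forall>\<^sub>F j in sequentially. x \<in> {w \<in> space circle_measure. norm (h (of_real (radius_seq j) * w)) < exp (- real (Suc t))}"
      by (auto simp: eventually_sequentially)
  next
    fix j
    show "{w \<in> space circle_measure. norm (h (of_real (radius_seq j) * w)) < exp (- real (Suc t))} \<in> sets circle_measure"
      using hm[of j] by measurable
    show "emeasure circle_measure {w \<in> space circle_measure. norm (h (of_real (radius_seq j) * w)) < exp (- real (Suc t))}
        \<le> ennreal (C / real (Suc t))"
      by (rule C) (use radius_seq[of j] in auto)
  qed
  moreover have "(\<lambda>t. ennreal (C / real (Suc t))) \<longlonglongrightarrow> ennreal 0"
  proof (rule tendsto_ennrealI)
    have "(\<lambda>t. C * (1 / real (Suc t))) \<longlonglongrightarrow> C * 0"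
      by (intro tendsto_intros LIMSEQ_Suc lim_1_over_n)
    then show "(\<lambda>t. C / real (Suc t)) \<longlonglongrightarrow> 0" by simp
  qed
  ultimately have "emeasure circle_measure Z \<le> ennreal 0"
    by (intro LIMSEQ_le_const) auto
  then have "Z \<in> null_sets circle_measure" using Z by (simp add: null_sets_def)
  then have 1: "AE x in circle_measure. x \<notin> Z" by (rule AE_not_in)
  have 2: "AE x in circle_measure. \<exists>l. has_nontangential_limit h x l"
    by (rule fatou_bounded[OF h(1,2)])
  have 3: "AE x in circle_measure. \<exists>l. has_nontangential_limit (\<lambda>z. f z * h z) x l"
    by (rule fatou_bounded[OF _ h(3)]) (intro holomorphic_intros hol h(1))
  show ?thesis
    using 1 2 3 AE_space
  proof eventually_elim
    case (elim x)
    then obtain l l' where l: "has_nontangential_limit h x l" "has_nontangential_limit (\<lambda>z. f z * h z) x l'" by blast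
    have x: "norm x = 1" using elim by simp
    have "l \<noteq> 0"
    proof
      assume "l = 0"
      have "(\<lambda>j. h (of_real (radius_seq j) * x)) \<longlonglongrightarrow> 0"
        using filterlim_compose[OF has_nontangential_limit_radial[OF l(1) x] filterlim_radius_seq] \<open>l = 0\<close> by simp
      then have lim0: "(\<lambda>j. norm (h (of_real (radius_seq j) * x))) \<longlonglongrightarrow> 0" by (rule tendsto_norm_zero)
      have "\<exists>N. \<forall>j\<ge>N. norm (h (of_real (radius_seq j) * x)) < exp (- real (Suc t))" for t
        using order_tendstoD(2)[OF lim0, of "exp (- real (Suc t))"] by (simp add: eventually_sequentially)
      then have "x \<in> Z" using x by (simp add: Z_def)
      then show False using elim by simp
    qed
    have "has_nontangential_limit f x (l' / l)"
      unfolding has_nontangential_limit_def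
    proof (intro allI impI)
      fix M :: real assume M: "1 < M"
      have lh: "(h \<longlongrightarrow> l) (at x within stolz_region M x)" using l(1) M by (simp add: has_nontangential_limit_def)
      have lfh: "((\<lambda>z. f z * h z) \<longlongrightarrow> l') (at x within stolz_region M x)" using l(2) M by (simp add: has_nontangential_limit_def)
      have "\<forall>\<^sub>F z in at x within stolz_region M x. h z \<noteq> 0"
        using tendsto_imp_eventually_ne[OF lh \<open>l \<noteq> 0\<close>] .
      then have "\<forall>\<^sub>F z in at x within stolz_region M x. f z * h z / h z = f z"
        by eventually_elim simp
      moreover have "((\<lambda>z. f z * h z / h z) \<longlongrightarrow> l' / l) (at x within stolz_region M x)"
        by (intro tendsto_intros lfh lh) fact
      ultimately show "(f \<longlongrightarrow> l' / l) (at x within stolz_region M x)"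
        by (rule Lim_transform_eventually[rotated])
    qed
    then show ?case ..
  qed
qed

section \<open>Measurability of boundary functions\<close>

text \<open>For given m, k, j the criterion of \<open>nontangential_limit_iff\<close> fails at x
  through some pair z, w, and for a fixed pair the conditions on x are open. The set is thus a
  countable combination of relatively closed sets.\<close>

lemma nontangential_set_measurable:
  "{x \<in> sphere 0 1. \<exists>l. has_nontangential_limit f x l} \<in> sets circle_measure"
proof -
  define U where "U m k j = (\<Union>z\<in>ball 0 1. \<Union>w\<in>{w\<in>ball 0 1. 1 / real (Suc k) < dist (f z) (f w)}.
      {x. norm (z - x) < (real m + 2) * (1 - norm z)} \<inter> {x. norm (w - x) < (real m + 2) * (1 - norm w)}
       \<inter> {x. dist z x < 1 / real (Suc j)} \<inter> {x. dist w x < 1 / real (Suc j)})" for m k j :: nat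
  have "open (U m k j)" for m k j
    unfolding U_def by (intro open_UN ballI open_Int open_Collect_less continuous_intros)
  then have U: "sphere 0 1 - U m k j \<in> sets circle_measure" for m k j
    by (auto simp: sets_circle_measure sets_restrict_space image_iff intro!: bexI[of _ "- U m k j"])
  have "{x \<in> sphere 0 1. \<exists>l. has_nontangential_limit f x l} = (\<Inter>m. \<Inter>k. \<Union>j. sphere 0 1 - U m k j)"
  proof (rule set_eqI)
    fix x
    show "x \<in> {x \<in> sphere 0 1. \<exists>l. has_nontangential_limit f x l} \<longleftrightarrow> x \<in> (\<Inter>m. \<Inter>k. \<Union>j. sphere 0 1 - U m k j)"
    proof (cases "norm x = 1")
      case True
      have "(\<forall>z\<in>stolz_region (real m + 2) x. \<forall>w\<in>stolz_region (real m + 2) x.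
         dist z x < 1 / real (Suc j) \<longrightarrow> dist w x < 1 / real (Suc j) \<longrightarrow> dist (f z) (f w) \<le> 1 / real (Suc k))
        \<longleftrightarrow> x \<notin> U m k j" for m k j
        unfolding U_def stolz_region_def by (auto simp: not_le[symmetric])
      then show ?thesis using True nontangential_limit_iff[OF True, of f] by simp
    qed auto
  qed
  moreover have "(\<Inter>m. \<Inter>k. \<Union>j. sphere 0 1 - U m k j) \<in> sets circle_measure"
    using U by (intro sets.countable_INT sets.countable_UN image_subsetI) auto
  ultimately show ?thesis by simp
qed

lemma boundary_fun_measurable:
  assumes hol: "f holomorphic_on ball 0 1"
  shows "boundary_fun f \<in> borel_measurable circle_measure"
proof -
  define G where "G = {x \<in> sphere 0 1. \<exists>l. has_nontangential_limit f x l}"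
  have G: "G \<in> sets circle_measure" unfolding G_def by (rule nontangential_set_measurable)
  have m: "(\<lambda>x. f (of_real (radius_seq n) * x)) \<in> borel_measurable circle_measure" for n
    by (intro continuous_on_sphere_measurable dilate_holomorphic(3)[OF hol] radius_seq)
  show ?thesis
  proof (rule borel_measurable_LIMSEQ_metric)
    \<comment> \<open>Off \<open>G\<close> the boundary function has its default value 0, and the
      approximants must converge to it there as well.\<close>
    show "(\<lambda>x. if x \<in> G then f (of_real (radius_seq n) * x) else 0) \<in> borel_measurable circle_measure" for n
      using m[of n] G by measurable
    show "(\<lambda>n. if x \<in> G then f (of_real (radius_seq n) * x) else 0) \<longlonglongrightarrow> boundary_fun f x"
      if "x \<in> space circle_measure" for x
    proof (cases "x \<in> G")
      case True
      then obtain l where l: "has_nontangential_limit f x l" "norm x = 1" by (auto simp: G_def)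
      have "(\<lambda>n. f (of_real (radius_seq n) * x)) \<longlonglongrightarrow> l"
        by (rule filterlim_compose[OF has_nontangential_limit_radial[OF l] filterlim_radius_seq])
      then show ?thesis using True boundary_fun_eq[OF l] by simp
    next
      case False
      then have "boundary_fun f x = 0" using that by (auto simp: G_def boundary_fun_def)
      then show ?thesis using False by simp
    qed
  qed
qed

lemma AE_boundary_fun_radial:
  assumes f: "f \<in> nevanlinna_class"
  shows "AE x in circle_measure. (\<lambda>n. f (of_real (radius_seq n) * x)) \<longlonglongrightarrow> boundary_fun f x"
  using fatou_nevanlinna[OF f] AE_space
proof eventually_elim
  case (elim x)
  then obtain l where l: "has_nontangential_limit f x l" "norm x = 1" by auto
  then show ?case
    using filterlim_compose[OF has_nontangential_limit_radial[OF l] filterlim_radius_seq] boundary_fun_eq[OF l] by simp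
qed

section \<open>The Poisson majorant in the Smirnov class\<close>

lemma tendsto_log_plus:
  fixes f :: "'a \<Rightarrow> 'b::real_normed_vector"
  assumes "(f \<longlongrightarrow> l) F"
  shows "((\<lambda>x. log_plus (norm (f x))) \<longlongrightarrow> log_plus (norm l)) F"
  unfolding log_plus_altdef[OF norm_ge_zero] by (intro tendsto_intros assms) auto

text \<open>Fatou's lemma is applied to $(K - P_z)\log^+|f_r|$, which is nonnegative for a constant $K$.\<close>

theorem smirnov_log_plus_le:
  assumes f: "f \<in> smirnov_class" and z: "norm z < 1"
  shows "integrable circle_measure (\<lambda>w. log_plus (norm (boundary_fun f w)))"
    and "log_plus (norm (f z)) \<le> (\<integral>w. poisson z w * log_plus (norm (boundary_fun f w)) \<partial>circle_measure)"
proof -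
  have fN: "f \<in> nevanlinna_class" and lim: "((\<lambda>r. log_plus_integral (\<lambda>z. f (complex_of_real r * z)))
           \<longlongrightarrow> log_plus_integral (boundary_fun f)) (at_left (1::real))"
    using f by (auto simp: smirnov_class_def)
  have hol: "f holomorphic_on ball 0 1" using fN by (simp add: nevanlinna_class_def)
  obtain C where C: "0 \<le> C"
    "\<And>r. 0 \<le> r \<Longrightarrow> r < 1 \<Longrightarrow> log_plus_integral (\<lambda>z. f (of_real r * z)) \<le> ennreal C"
    by (rule nevanlinna_class_bound[OF fN]) blast
  define r where "r = radius_seq"
  have r: "0 \<le> r n" "r n < 1" for n using radius_seq[of n] by (auto simp: r_def)
  define \<psi> where "\<psi> n w = log_plus (norm (f (of_real (r n) * w)))" for n w
  define \<phi> where "\<phi> w = log_plus (norm (boundary_fun f w))" for w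
  note fr = dilate_holomorphic[OF hol r]
  have \<psi>c: "continuous_on (sphere 0 1) (\<psi> n)" for n
    unfolding \<psi>_def by (intro continuous_intros fr)
  have [measurable]: "boundary_fun f \<in> borel_measurable circle_measure" by (rule boundary_fun_measurable[OF hol])
  have \<phi>m [measurable]: "\<phi> \<in> borel_measurable circle_measure" unfolding \<phi>_def by measurable
  have \<psi>m [measurable]: "\<psi> n \<in> borel_measurable circle_measure" for n by (rule continuous_on_sphere_measurable[OF \<psi>c])
  have pos: "0 \<le> \<phi> w" "0 \<le> \<psi> n w" for n w by (auto simp: \<phi>_def \<psi>_def log_plus_nonneg)
  have limI: "(\<lambda>n. log_plus_integral (\<lambda>z. f (of_real (r n) * z))) \<longlonglongrightarrow> log_plus_integral (boundary_fun f)"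
    unfolding r_def by (rule filterlim_compose[OF lim filterlim_radius_seq])
  then have "log_plus_integral (boundary_fun f) \<le> ennreal C"
    by (rule LIMSEQ_le_const2) (use C r in auto)
  then have fin: "(\<integral>\<^sup>+ w. ennreal (\<phi> w) \<partial>circle_measure) < \<infinity>"
    unfolding log_plus_integral_def \<phi>_def by (metis ennreal_less_top infinity_ennreal_def le_less_trans)
  have \<phi>i: "integrable circle_measure \<phi>"
    by (rule integrableI_nonneg) (use fin pos in auto)
  then show "integrable circle_measure (\<lambda>w. log_plus (norm (boundary_fun f w)))" by (simp add: \<phi>_def[abs_def])
  have "log_plus_integral (boundary_fun f) = ennreal (\<integral>w. \<phi> w \<partial>circle_measure)"
    unfolding log_plus_integral_def \<phi>_def[symmetric] by (rule nn_integral_eq_integral[OF \<phi>i]) (simp add: pos)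
  moreover have "log_plus_integral (\<lambda>z. f (of_real (r n) * z)) = ennreal (\<integral>w. \<psi> n w \<partial>circle_measure)" for n
    unfolding \<psi>_def by (rule log_plus_integral_eq[OF fr(3)])
  ultimately have "(\<lambda>n. ennreal (\<integral>w. \<psi> n w \<partial>circle_measure)) \<longlonglongrightarrow> ennreal (\<integral>w. \<phi> w \<partial>circle_measure)"
    using limI by simp
  \<comment> \<open>The Smirnov condition in usable form: no mass is lost in the limit. This turns
    Fatou's inequality for K - P_z, a lower estimate, into the upper estimate needed for the kernel
    P_z itself.\<close>
  then have J: "(\<lambda>n. \<integral>w. \<psi> n w \<partial>circle_measure) \<longlonglongrightarrow> (\<integral>w. \<phi> w \<partial>circle_measure)"
    by (rule tendsto_ennrealD) (auto intro!: always_eventually Bochner_Integration.integral_nonneg pos)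
  define K where "K = 2 / (1 - norm z)"
  have K: "poisson z w \<le> K" "0 \<le> poisson z w" if "norm w = 1" for w
    using poisson_le[OF z that] poisson_nonneg[OF z] by (auto simp: K_def)
  have P\<psi>i: "integrable circle_measure (\<lambda>w. poisson z w * \<psi> n w)" for n
    by (intro continuous_on_sphere_integrable continuous_intros z \<psi>c)
  have \<psi>i: "integrable circle_measure (\<psi> n)" for n by (rule continuous_on_sphere_integrable[OF \<psi>c])
  have P\<phi>i: "integrable circle_measure (\<lambda>w. poisson z w * \<phi> w)"
  proof (rule Bochner_Integration.integrable_bound[of _ "\<lambda>w. K * \<phi> w"])
    show "AE w in circle_measure. norm (poisson z w * \<phi> w) \<le> norm (K * \<phi> w)"
    proof (rule AE_I2)
      fix w assume "w \<in> space circle_measure"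
      then have "poisson z w \<le> K" "0 \<le> poisson z w" using K by auto
      then show "norm (poisson z w * \<phi> w) \<le> norm (K * \<phi> w)"
        using pos(1)[of w] by (simp add: abs_mult mult_right_mono)
    qed
  qed (use \<phi>i z in auto)
  have eq: "(\<integral>\<^sup>+ w. ennreal ((K - poisson z w) * u w) \<partial>circle_measure)
      = ennreal (K * (\<integral>w. u w \<partial>circle_measure) - (\<integral>w. poisson z w * u w \<partial>circle_measure))"
    and nn: "0 \<le> K * (\<integral>w. u w \<partial>circle_measure) - (\<integral>w. poisson z w * u w \<partial>circle_measure)"
    if u: "integrable circle_measure u" "integrable circle_measure (\<lambda>w. poisson z w * u w)" "\<And>w. 0 \<le> u w" for u
  proof -
    have i: "integrable circle_measure (\<lambda>w. (K - poisson z w) * u w)"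
      using u by (simp add: left_diff_distrib)
    have p: "0 \<le> (K - poisson z w) * u w" if "norm w = 1" for w
      using K[OF that] u(3)[of w] by simp
    have v: "(\<integral>w. (K - poisson z w) * u w \<partial>circle_measure)
        = K * (\<integral>w. u w \<partial>circle_measure) - (\<integral>w. poisson z w * u w \<partial>circle_measure)"
      using u(1,2) by (simp add: left_diff_distrib)
    show "(\<integral>\<^sup>+ w. ennreal ((K - poisson z w) * u w) \<partial>circle_measure)
      = ennreal (K * (\<integral>w. u w \<partial>circle_measure) - (\<integral>w. poisson z w * u w \<partial>circle_measure))"
      unfolding v[symmetric] by (rule nn_integral_eq_integral[OF i]) (use p in \<open>auto intro!: AE_I2\<close>)
    show "0 \<le> K * (\<integral>w. u w \<partial>circle_measure) - (\<integral>w. poisson z w * u w \<partial>circle_measure)"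
      unfolding v[symmetric] by (rule Bochner_Integration.integral_nonneg) (use p in auto)
  qed
  let ?J = "\<integral>w. \<phi> w \<partial>circle_measure" and ?Jn = "\<lambda>n. \<integral>w. \<psi> n w \<partial>circle_measure"
  let ?L = "\<lambda>n. log_plus (norm (f (of_real (r n) * z)))"
  have Lle: "?L n \<le> (\<integral>w. poisson z w * \<psi> n w \<partial>circle_measure)" for n
    unfolding \<psi>_def by (rule log_plus_le_poisson_integral[OF fr(1,2) z])
  have AElim: "AE w in circle_measure. (\<lambda>n. \<psi> n w) \<longlonglongrightarrow> \<phi> w"
    using AE_boundary_fun_radial[OF fN] unfolding \<psi>_def \<phi>_def r_def
    by eventually_elim (rule tendsto_log_plus)
  have "isCont f z"
    using holomorphic_on_imp_continuous_on[OF hol] z by (simp add: continuous_on_eq_continuous_at)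
  moreover have "(\<lambda>n. complex_of_real (r n) * z) \<longlonglongrightarrow> of_real 1 * z"
    unfolding r_def by (intro tendsto_intros tendsto_radius_seq)
  ultimately have "(\<lambda>n. f (of_real (r n) * z)) \<longlonglongrightarrow> f z"
    by (intro isCont_tendsto_compose[of z f]) auto
  then have L: "?L \<longlonglongrightarrow> log_plus (norm (f z))" by (rule tendsto_log_plus)
  have lim2: "(\<lambda>n. K * ?Jn n - ?L n) \<longlonglongrightarrow> K * ?J - log_plus (norm (f z))"
    by (intro tendsto_intros J L)
  have "ennreal (K * ?J - (\<integral>w. poisson z w * \<phi> w \<partial>circle_measure))
      = (\<integral>\<^sup>+ w. ennreal ((K - poisson z w) * \<phi> w) \<partial>circle_measure)"
    by (rule eq[symmetric, OF \<phi>i P\<phi>i pos(1)])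
  also have "\<dots> = (\<integral>\<^sup>+ w. liminf (\<lambda>n. ennreal ((K - poisson z w) * \<psi> n w)) \<partial>circle_measure)"
  proof (rule nn_integral_cong_AE)
    show "AE w in circle_measure. ennreal ((K - poisson z w) * \<phi> w) = liminf (\<lambda>n. ennreal ((K - poisson z w) * \<psi> n w))"
      using AElim
    proof eventually_elim
      case (elim w)
      have "(\<lambda>n. ennreal ((K - poisson z w) * \<psi> n w)) \<longlonglongrightarrow> ennreal ((K - poisson z w) * \<phi> w)"
        by (intro tendsto_ennrealI tendsto_intros elim)
      then show ?case by (intro lim_imp_Liminf[symmetric]) auto
    qed
  qed
  also have "\<dots> \<le> liminf (\<lambda>n. \<integral>\<^sup>+ w. ennreal ((K - poisson z w) * \<psi> n w) \<partial>circle_measure)"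
    by (rule nn_integral_liminf) (use z in measurable)
  also have "\<dots> \<le> liminf (\<lambda>n. ennreal (K * ?Jn n - ?L n))"
  proof (rule Liminf_mono, rule always_eventually, rule allI)
    fix n
    show "(\<integral>\<^sup>+ w. ennreal ((K - poisson z w) * \<psi> n w) \<partial>circle_measure) \<le> ennreal (K * ?Jn n - ?L n)"
      unfolding eq[OF \<psi>i P\<psi>i pos(2)] using Lle[of n] by (intro ennreal_leI) simp
  qed
  also have "\<dots> = ennreal (K * ?J - log_plus (norm (f z)))"
    by (rule lim_imp_Liminf) (auto intro: tendsto_ennrealI lim2)
  finally have *: "ennreal (K * ?J - (\<integral>w. poisson z w * \<phi> w \<partial>circle_measure)) \<le> ennreal (K * ?J - log_plus (norm (f z)))" .
  have "0 \<le> K * ?J - log_plus (norm (f z))"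
  proof (rule LIMSEQ_le_const[OF lim2], rule exI[of _ 0], intro allI impI)
    fix n
    show "0 \<le> K * ?Jn n - ?L n" using nn[OF \<psi>i[of n] P\<psi>i[of n] pos(2)] Lle[of n] by linarith
  qed
  with * have "K * ?J - (\<integral>w. poisson z w * \<phi> w \<partial>circle_measure) \<le> K * ?J - log_plus (norm (f z))" by simp
  then show "log_plus (norm (f z)) \<le> (\<integral>w. poisson z w * log_plus (norm (boundary_fun f w)) \<partial>circle_measure)"
    by (simp add: \<phi>_def)
qed

section \<open>Geometric convolutions\<close>

definition nat_dist :: "nat \<Rightarrow> nat \<Rightarrow> nat" where
  "nat_dist n j = (if j \<le> n then n - j else j - n)"

text \<open>The symmetric kernel dominates both one-sided discrete Hardy sums, so a single l^q bound
  serves the tails, the initial segments and the test functions.\<close>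

definition geom_conv :: "real \<Rightarrow> (nat \<Rightarrow> real) \<Rightarrow> nat \<Rightarrow> real" where
  "geom_conv \<rho> b n = (\<Sum>j. \<rho> ^ nat_dist n j * b j)"

lemma nat_dist_commute: "nat_dist n j = nat_dist j n"
  by (auto simp: nat_dist_def)

lemma geometric_nat_dist:
  fixes x :: real
  assumes x: "0 \<le> x" "x < 1"
  shows "summable (\<lambda>j. x ^ nat_dist n j)" "(\<Sum>j. x ^ nat_dist n j) \<le> 2 / (1 - x)"
proof -
  have geo: "(\<lambda>j. x ^ j) sums (1 / (1 - x))" using geometric_sums[of x] x by simp
  have shift: "(\<lambda>j. x ^ nat_dist n (j + n)) = (\<lambda>j. x ^ j)" by (auto simp: nat_dist_def fun_eq_iff)
  show s: "summable (\<lambda>j. x ^ nat_dist n j)"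
    using summable_iff_shift[of "\<lambda>j. x ^ nat_dist n j" n] sums_summable[OF geo] by (simp only: shift)
  have "(\<Sum>j<n. x ^ nat_dist n j) \<le> (\<Sum>j<n. x ^ (n - Suc j))"
    using x by (intro sum_mono power_decreasing) (auto simp: nat_dist_def)
  also have "\<dots> = (\<Sum>j<n. x ^ j)" by (rule sum.nat_diff_reindex)
  also have "\<dots> \<le> (\<Sum>j. x ^ j)" using x by (intro sum_le_suminf sums_summable[OF geo]) auto
  also have "\<dots> = 1 / (1 - x)" by (rule sums_unique[OF geo, symmetric])
  finally have "(\<Sum>j<n. x ^ nat_dist n j) \<le> 1 / (1 - x)" .
  moreover have "(\<Sum>j. x ^ nat_dist n (j + n)) = 1 / (1 - x)"
    unfolding shift by (rule sums_unique[OF geo, symmetric])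
  ultimately show "(\<Sum>j. x ^ nat_dist n j) \<le> 2 / (1 - x)"
    using suminf_split_initial_segment[OF s, of n] by simp
qed

lemma summable_powr_bounded:
  fixes b :: "nat \<Rightarrow> real"
  assumes "\<And>j. 0 \<le> b j" "summable (\<lambda>j. b j powr q)" "0 < q"
  obtains B where "\<And>j. b j \<le> B"
proof
  fix j
  have "b j powr q \<le> (\<Sum>j. b j powr q)"
    using sum_le_suminf[OF assms(2), of "{j}"] by simp
  then have "(b j powr q) powr (1 / q) \<le> (\<Sum>j. b j powr q) powr (1 / q)"
    using assms(3) by (intro powr_mono2) auto
  then show "b j \<le> (\<Sum>j. b j powr q) powr (1 / q)"
    using assms(1)[of j] assms(3) by (simp add: powr_powr)
qed

text \<open>Bounding half of each geometric weight by a supremum, and the supremum of the $q$-th powers by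
  their sum, covers all $q > 0$ at once.\<close>

lemma geom_conv:
  fixes b :: "nat \<Rightarrow> real"
  assumes b: "\<And>j. 0 \<le> b j" and sum: "summable (\<lambda>j. b j powr q)" and q: "0 < q" and \<rho>: "0 < \<rho>" "\<rho> < 1"
  shows "summable (\<lambda>j. \<rho> ^ nat_dist n j * b j)" "0 \<le> geom_conv \<rho> b n"
    "summable (\<lambda>n. geom_conv \<rho> b n powr q)"
proof -
  obtain B where B: "\<And>j. b j \<le> B" by (rule summable_powr_bounded[OF b sum q]) blast
  show s: "summable (\<lambda>j. \<rho> ^ nat_dist n j * b j)" for n
  proof (rule summable_comparison_test'[OF summable_mult2[OF geometric_nat_dist(1)[of \<rho> n], of B]])
    fix j
    show "norm (\<rho> ^ nat_dist n j * b j) \<le> \<rho> ^ nat_dist n j * B"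
      using B[of j] b[of j] \<rho> by (simp add: abs_mult)
  qed (use \<rho> in auto)
  show nonneg: "0 \<le> geom_conv \<rho> b n" for n
    unfolding geom_conv_def using \<rho> b by (intro suminf_nonneg s) auto
  define r where "r = sqrt \<rho>"
  have r: "0 < r" "r < 1" "r * r = \<rho>" using \<rho> by (auto simp: r_def)
  define x where "x = r powr q"
  have x: "0 < x" "x < 1" using r q powr_less_mono2[of q r 1] by (auto simp: x_def)
  have xr: "(r ^ k * b j) powr q = x ^ k * b j powr q" for k j
  proof -
    have "(r ^ k) powr q = x ^ k"
      using r by (simp add: x_def powr_realpow[symmetric] powr_powr mult.commute)
    then show ?thesis using r b[of j] by (simp add: powr_mult)
  qed
  define W where "W n = (\<Sum>j. x ^ nat_dist n j * b j powr q)" for n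
  have sW: "summable (\<lambda>j. x ^ nat_dist n j * b j powr q)" for n
    by (rule summable_comparison_test'[OF sum]) (use x in \<open>auto intro!: mult_left_le_one_le power_le_one\<close>)
  have W0: "0 \<le> W n" for n unfolding W_def using x by (intro suminf_nonneg sW) auto
  define D where "D = 2 / (1 - r)"
  have D: "0 \<le> D" using r by (simp add: D_def)
  have le: "geom_conv \<rho> b n powr q \<le> D powr q * W n" for n
  proof -
    have tm: "r ^ nat_dist n j * b j \<le> W n powr (1 / q)" for j
    proof -
      have "(r ^ nat_dist n j * b j) powr q \<le> W n"
        unfolding xr W_def using sum_le_suminf[OF sW[of n], of "{j}"] x by simp
      then have "((r ^ nat_dist n j * b j) powr q) powr (1 / q) \<le> W n powr (1 / q)"
        using q by (intro powr_mono2) auto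
      then show ?thesis using b[of j] r q by (simp add: powr_powr)
    qed
    have "geom_conv \<rho> b n \<le> (\<Sum>j. r ^ nat_dist n j * W n powr (1 / q))"
      unfolding geom_conv_def
    proof (rule suminf_le[OF _ s])
      fix j
      have "\<rho> ^ nat_dist n j * b j = r ^ nat_dist n j * (r ^ nat_dist n j * b j)"
        by (simp add: r(3)[symmetric] power_mult_distrib)
      also have "\<dots> \<le> r ^ nat_dist n j * W n powr (1 / q)"
        using r by (intro mult_left_mono tm) auto
      finally show "\<rho> ^ nat_dist n j * b j \<le> r ^ nat_dist n j * W n powr (1 / q)" .
    qed (use r in \<open>auto intro!: summable_mult2 geometric_nat_dist\<close>)
    also have "\<dots> = (\<Sum>j. r ^ nat_dist n j) * W n powr (1 / q)"
      using r by (intro suminf_mult2[symmetric] geometric_nat_dist) auto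
    also have "\<dots> \<le> D * W n powr (1 / q)"
      unfolding D_def using r by (intro mult_right_mono geometric_nat_dist) auto
    finally have "geom_conv \<rho> b n powr q \<le> (D * W n powr (1 / q)) powr q"
      using nonneg q by (intro powr_mono2) auto
    also have "\<dots> = D powr q * W n" using D W0[of n] q by (simp add: powr_mult powr_powr)
    finally show ?thesis .
  qed
  have "summable W"
  proof (rule summableI_nonneg_bounded)
    fix N
    have "(\<Sum>n<N. W n) = (\<Sum>j. \<Sum>n<N. x ^ nat_dist n j * b j powr q)"
      unfolding W_def by (rule suminf_sum[symmetric]) (rule sW)
    also have "\<dots> \<le> (\<Sum>j. 2 / (1 - x) * b j powr q)"
    proof (rule suminf_le)
      fix j
      have "(\<Sum>n<N. x ^ nat_dist n j) \<le> (\<Sum>n. x ^ nat_dist j n)"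
        unfolding nat_dist_commute[of _ j] using x by (intro sum_le_suminf geometric_nat_dist) auto
      also have "\<dots> \<le> 2 / (1 - x)" using x by (intro geometric_nat_dist) auto
      finally have "(\<Sum>n<N. x ^ nat_dist n j) * b j powr q \<le> 2 / (1 - x) * b j powr q"
        by (rule mult_right_mono) simp
      then show "(\<Sum>n<N. x ^ nat_dist n j * b j powr q) \<le> 2 / (1 - x) * b j powr q"
        by (simp add: sum_distrib_right)
    qed (auto intro!: summable_sum sW summable_mult sum)
    also have "\<dots> = 2 / (1 - x) * (\<Sum>j. b j powr q)" by (rule suminf_mult[OF sum])
    finally show "(\<Sum>n<N. W n) \<le> 2 / (1 - x) * (\<Sum>j. b j powr q)" .
  qed (rule W0)
  then have "summable (\<lambda>n. D powr q * W n)" by (rule summable_mult)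
  then show "summable (\<lambda>n. geom_conv \<rho> b n powr q)"
    by (rule summable_comparison_test') (use le in auto)
qed

section \<open>Closure properties of q-summable sequences\<close>

lemma powr_add_le:
  fixes x y :: real
  assumes "0 \<le> x" "0 \<le> y" "0 < q"
  shows "(x + y) powr q \<le> 2 powr q * (x powr q + y powr q)"
proof -
  have "(x + y) powr q \<le> (2 * max x y) powr q" using assms by (intro powr_mono2) auto
  also have "\<dots> = 2 powr q * (max x y) powr q" using assms by (simp add: powr_mult)
  also have "(max x y) powr q \<le> x powr q + y powr q" by (auto simp: max_def)
  finally show ?thesis by simp
qed

lemma summable_powr_add:
  fixes x y :: "nat \<Rightarrow> real"
  assumes "\<And>n. 0 \<le> x n" "\<And>n. 0 \<le> y n" "0 < q"
    and "summable (\<lambda>n. x n powr q)" "summable (\<lambda>n. y n powr q)"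
  shows "summable (\<lambda>n. (x n + y n) powr q)"
  by (rule summable_comparison_test'[OF summable_mult[OF summable_add[OF assms(4,5)], of "2 powr q"]])
     (use powr_add_le[OF assms(1,2,3)] in auto)

lemma summable_powr_cmult:
  fixes x :: "nat \<Rightarrow> real"
  assumes "\<And>n. 0 \<le> x n" "0 \<le> c" "summable (\<lambda>n. x n powr q)"
  shows "summable (\<lambda>n. (c * x n) powr q)"
  using summable_mult[OF assms(3), of "c powr q"] assms(1,2) by (simp add: powr_mult)

lemma summable_powr_mono:
  fixes x y :: "nat \<Rightarrow> real"
  assumes "\<And>n. 0 \<le> x n" "\<And>n. x n \<le> y n" "0 < q" "summable (\<lambda>n. y n powr q)"
  shows "summable (\<lambda>n. x n powr q)"
  by (rule summable_comparison_test'[OF assms(4)]) (use assms(1-3) in \<open>auto intro!: powr_mono2\<close>)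

section \<open>Integral means of Smirnov functions\<close>

text \<open>Integration of the tangent line of exp at the mean of X. With a nonnegative integral on
  the right the case of a non-integrable exponential is included, the right side being infinite
  there.\<close>

lemma (in prob_space) exp_expectation_le:
  fixes X :: "'a \<Rightarrow> real"
  assumes X: "integrable M X"
  shows "ennreal (exp (expectation X)) \<le> (\<integral>\<^sup>+ x. ennreal (exp (X x)) \<partial>M)"
proof (cases "integrable M (\<lambda>x. exp (X x))")
  case True
  define A where "A = expectation X"
  have "exp A = (\<integral>x. exp A * (1 + (X x - A)) \<partial>M)"
    using X by (simp add: prob_space A_def)
  also have "\<dots> \<le> (\<integral>x. exp (X x) \<partial>M)"
  proof (rule integral_mono[OF _ True])
    fix x
    have "exp A * (1 + (X x - A)) \<le> exp A * exp (X x - A)"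
      by (intro mult_left_mono exp_ge_add_one_self) auto
    then show "exp A * (1 + (X x - A)) \<le> exp (X x)" by (simp add: exp_add[symmetric])
  qed (use X in auto)
  finally have "ennreal (exp A) \<le> ennreal (\<integral>x. exp (X x) \<partial>M)" by (rule ennreal_leI)
  also have "\<dots> = (\<integral>\<^sup>+ x. ennreal (exp (X x)) \<partial>M)"
    by (rule nn_integral_eq_integral[OF True, symmetric]) auto
  finally show ?thesis by (simp add: A_def)
next
  case False
  have "(\<integral>\<^sup>+ x. ennreal (exp (X x)) \<partial>M) = \<infinity>"
  proof (rule ccontr)
    assume "(\<integral>\<^sup>+ x. ennreal (exp (X x)) \<partial>M) \<noteq> \<infinity>"
    then have "integrable M (\<lambda>x. exp (X x))"
      by (intro integrableI_nonneg) (use X in \<open>auto simp: top.not_eq_extremum\<close>)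
    with False show False ..
  qed
  then show ?thesis by simp
qed

text \<open>Adding the nonnegative term (n+1) a^n (x - a)^2 to the tangent line of the power n + 2
  produces x times the tangent line of the power n + 1, which is the induction step.\<close>

lemma power_tangent_le:
  fixes x a :: real
  assumes "0 \<le> x" "0 \<le> a"
  shows "a ^ Suc n + real (Suc n) * a ^ n * (x - a) \<le> x ^ Suc n"
proof (induction n)
  case (Suc n)
  have "a ^ Suc (Suc n) + real (Suc (Suc n)) * a ^ Suc n * (x - a)
      \<le> a ^ Suc (Suc n) + real (Suc (Suc n)) * a ^ Suc n * (x - a) + real (Suc n) * a ^ n * (x - a)\<^sup>2"
    using assms by simp
  also have "\<dots> = x * (a ^ Suc n + real (Suc n) * a ^ n * (x - a))"
    by (simp add: power2_eq_square algebra_simps)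
  also have "\<dots> \<le> x * x ^ Suc n" using Suc assms(1) by (rule mult_left_mono)
  finally show ?case by simp
qed simp

lemma (in prob_space) power_expectation_le:
  fixes X :: "'a \<Rightarrow> real"
  assumes X [measurable]: "X \<in> borel_measurable M" and b: "\<And>x. x \<in> space M \<Longrightarrow> 0 \<le> X x \<and> X x \<le> B"
  shows "(\<integral>\<^sup>+ x. ennreal (X x) \<partial>M) ^ Suc n \<le> (\<integral>\<^sup>+ x. ennreal (X x ^ Suc n) \<partial>M)"
proof -
  have iX: "integrable M X"
    by (rule integrable_const_bound[where B = B]) (use b in \<open>auto intro!: AE_I2\<close>)
  have iXn: "integrable M (\<lambda>x. X x ^ Suc n)"
  proof (rule integrable_const_bound[where B = "B ^ Suc n"])
    show "AE x in M. norm (X x ^ Suc n) \<le> B ^ Suc n"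
    proof (rule AE_I2)
      fix x assume "x \<in> space M"
      then have "\<bar>X x\<bar> ^ Suc n \<le> B ^ Suc n" using b[of x] by (intro power_mono) auto
      then show "norm (X x ^ Suc n) \<le> B ^ Suc n" by (simp add: power_abs abs_mult)
    qed
  qed measurable
  define A where "A = expectation X"
  have A: "0 \<le> A" unfolding A_def by (rule Bochner_Integration.integral_nonneg) (use b in auto)
  have "A ^ Suc n = (\<integral>x. A ^ Suc n + real (Suc n) * A ^ n * (X x - A) \<partial>M)"
    using iX by (simp add: prob_space A_def)
  also have "\<dots> \<le> (\<integral>x. X x ^ Suc n \<partial>M)"
    by (rule integral_mono[OF _ iXn]) (use iX power_tangent_le[OF _ A] b in auto)
  finally have le: "A ^ Suc n \<le> (\<integral>x. X x ^ Suc n \<partial>M)" .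
  have "(\<integral>\<^sup>+ x. ennreal (X x) \<partial>M) = ennreal A"
    unfolding A_def by (rule nn_integral_eq_integral[OF iX]) (use b in \<open>auto intro!: AE_I2\<close>)
  then have "(\<integral>\<^sup>+ x. ennreal (X x) \<partial>M) ^ Suc n = ennreal (A ^ Suc n)"
    using A by (simp only: ennreal_power)
  also have "\<dots> \<le> ennreal (\<integral>x. X x ^ Suc n \<partial>M)" by (rule ennreal_leI[OF le])
  also have "\<dots> = (\<integral>\<^sup>+ x. ennreal (X x ^ Suc n) \<partial>M)"
    by (rule nn_integral_eq_integral[OF iXn, symmetric]) (use b in \<open>auto intro!: AE_I2\<close>)
  finally show ?thesis .
qed

section \<open>Averages over circles of Poisson integrals\<close>

lemma circle_id_measurable [measurable]: "(\<lambda>w. w) \<in> borel_measurable circle_measure"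
  by (intro continuous_on_sphere_measurable continuous_intros)

lemma poisson_pair_measurable:
  "(\<lambda>(v, w). ennreal (poisson (of_real r * v) w)) \<in> borel_measurable (circle_measure \<Otimes>\<^sub>M circle_measure)"
proof -
  have [measurable]: "fst \<in> borel_measurable (circle_measure \<Otimes>\<^sub>M circle_measure)"
    "snd \<in> borel_measurable (circle_measure \<Otimes>\<^sub>M circle_measure)"
    using measurable_compose[OF measurable_fst circle_id_measurable]
      measurable_compose[OF measurable_snd circle_id_measurable] by auto
  have "(\<lambda>x. ennreal (poisson (of_real r * fst x) (snd x))) \<in> borel_measurable (circle_measure \<Otimes>\<^sub>M circle_measure)"
    unfolding poisson_def by measurable
  then show ?thesis by (simp add: case_prod_beta')
qed

text \<open>After Tonelli, \<open>poisson_symmetric\<close> turns the inner integral into that of a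
  Poisson kernel, which has mass 1. The average of a Poisson integral over the circle of radius r
  thus does not depend on r.\<close>

lemma nn_integral_poisson_pair:
  fixes g :: "complex \<Rightarrow> ennreal"
  assumes g [measurable]: "g \<in> borel_measurable circle_measure" and r: "0 \<le> r" "r < 1"
  shows "(\<lambda>v. \<integral>\<^sup>+ w. ennreal (poisson (of_real r * v) w) * g w \<partial>circle_measure) \<in> borel_measurable circle_measure"
    and "(\<integral>\<^sup>+ v. \<integral>\<^sup>+ w. ennreal (poisson (of_real r * v) w) * g w \<partial>circle_measure \<partial>circle_measure)
      = (\<integral>\<^sup>+ w. g w \<partial>circle_measure)"
proof -
  interpret P: pair_sigma_finite circle_measure circle_measure ..
  have m: "(\<lambda>(v, w). ennreal (poisson (of_real r * v) w) * g w) \<in> borel_measurable (circle_measure \<Otimes>\<^sub>M circle_measure)"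
  proof -
    have "(\<lambda>x. (case x of (v, w) \<Rightarrow> ennreal (poisson (of_real r * v) w)) * g (snd x))
        \<in> borel_measurable (circle_measure \<Otimes>\<^sub>M circle_measure)"
      by (intro borel_measurable_times_ennreal poisson_pair_measurable measurable_compose[OF measurable_snd g])
    then show ?thesis by (simp add: case_prod_beta')
  qed
  show "(\<lambda>v. \<integral>\<^sup>+ w. ennreal (poisson (of_real r * v) w) * g w \<partial>circle_measure) \<in> borel_measurable circle_measure"
    using circle.borel_measurable_nn_integral_fst[OF m] by simp
  have "(\<integral>\<^sup>+ v. \<integral>\<^sup>+ w. ennreal (poisson (of_real r * v) w) * g w \<partial>circle_measure \<partial>circle_measure)
      = (\<integral>\<^sup>+ w. \<integral>\<^sup>+ v. ennreal (poisson (of_real r * v) w) * g w \<partial>circle_measure \<partial>circle_measure)"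
    using P.Fubini[OF m] by simp
  also have "\<dots> = (\<integral>\<^sup>+ w. g w \<partial>circle_measure)"
  proof (rule nn_integral_cong)
    fix w assume w: "w \<in> space circle_measure"
    then have rw: "norm (of_real r * w) < 1" using r by (simp add: norm_mult)
    have "(\<integral>\<^sup>+ v. ennreal (poisson (of_real r * v) w) * g w \<partial>circle_measure)
        = (\<integral>\<^sup>+ v. ennreal (poisson (of_real r * w) v) * g w \<partial>circle_measure)"
      by (rule nn_integral_cong) (use w poisson_symmetric in auto)
    also have "\<dots> = g w"
      using rw by (subst nn_integral_multc) (auto simp: nn_integral_poisson)
    finally show "(\<integral>\<^sup>+ v. ennreal (poisson (of_real r * v) w) * g w \<partial>circle_measure) = g w" .
  qed
  finally show "(\<integral>\<^sup>+ v. \<integral>\<^sup>+ w. ennreal (poisson (of_real r * v) w) * g w \<partial>circle_measure \<partial>circle_measure)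
      = (\<integral>\<^sup>+ w. g w \<partial>circle_measure)" .
qed

lemma ennreal_add_power_le:
  fixes x y :: ennreal
  shows "(x + y) ^ n \<le> 2 ^ n * (x ^ n + y ^ n)"
proof -
  have "(x + y) ^ n \<le> (2 * max x y) ^ n"
    by (intro power_mono) (auto simp: mult_2 add_mono)
  also have "\<dots> = 2 ^ n * (max x y) ^ n" by (rule power_mult_distrib)
  also have "\<dots> \<le> 2 ^ n * (x ^ n + y ^ n)"
    by (intro mult_left_mono) (auto simp: max_def)
  finally show ?thesis .
qed

text \<open>The large part of $G^{1/N}$ is estimated by the supremum of the Poisson kernel, the small part
  by Jensen's inequality.\<close>

lemma integral_mean_le:
  fixes G :: "complex \<Rightarrow> real"
  assumes G [measurable]: "G \<in> borel_measurable circle_measure" and G1: "\<And>w. 1 \<le> G w"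
    and int: "integrable circle_measure (\<lambda>w. ln (G w))"
    and le: "\<And>z. norm z < 1 \<Longrightarrow> norm (f z) \<le> exp (\<integral>w. poisson z w * ln (G w) \<partial>circle_measure)"
    and r: "0 \<le> r" "r < 1"
  shows "(\<integral>\<^sup>+ v. ennreal (norm (f (of_real r * v) :: complex)) \<partial>circle_measure)
    \<le> 2 ^ Suc N * (ennreal (2 / (1 - r)) ^ N * (\<integral>\<^sup>+ w. ennreal (G w powr (1 / real (Suc N))) * indicator {w. \<tau> < G w} w \<partial>circle_measure) ^ Suc N
        + (\<integral>\<^sup>+ w. ennreal (G w) * indicator {w. G w \<le> \<tau>} w \<partial>circle_measure))"
proof -
  define \<theta> where "\<theta> = 1 / real (Suc N)"
  have \<theta>: "0 < \<theta>" "\<theta> * real (Suc N) = 1" by (auto simp: \<theta>_def)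
  define g0 where "g0 w = ennreal (G w powr \<theta>) * indicator {w. \<tau> < G w} w" for w
  define g1 where "g1 w = G w powr \<theta> * indicator {w. G w \<le> \<tau>} w" for w
  have ind [measurable]: "(\<lambda>w. indicator {w. \<tau> < G w} w :: ennreal) \<in> borel_measurable circle_measure"
    "(\<lambda>w. indicator {w. G w \<le> \<tau>} w :: real) \<in> borel_measurable circle_measure"
    unfolding indicator_def by measurable
  have g0 [measurable]: "g0 \<in> borel_measurable circle_measure" unfolding g0_def by measurable
  have g1 [measurable]: "g1 \<in> borel_measurable circle_measure" unfolding g1_def by measurable
  have g1b: "0 \<le> g1 w \<and> g1 w \<le> \<bar>\<tau>\<bar> powr \<theta>" for w
  proof (cases "G w \<le> \<tau>")
    case True
    then have "G w powr \<theta> \<le> \<bar>\<tau>\<bar> powr \<theta>" using G1[of w] \<theta> by (intro powr_mono2) auto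
    then show ?thesis by (simp add: g1_def indicator_def)
  qed (simp add: g1_def)
  have g1N: "g1 w ^ Suc N = G w * indicator {w. G w \<le> \<tau>} w" for w
  proof -
    have "(G w powr \<theta>) ^ Suc N = G w powr (\<theta> * real (Suc N))"
      using G1[of w] by (subst powr_realpow[symmetric]) (auto simp: powr_powr)
    then have "(G w powr \<theta>) ^ Suc N = G w" unfolding \<theta>(2) using G1[of w] by simp
    then show ?thesis by (cases "G w \<le> \<tau>") (auto simp: g1_def)
  qed
  define A0 where "A0 v = (\<integral>\<^sup>+ w. ennreal (poisson (of_real r * v) w) * g0 w \<partial>circle_measure)" for v
  define A1 where "A1 v = (\<integral>\<^sup>+ w. ennreal (poisson (of_real r * v) w) * ennreal (g1 w) \<partial>circle_measure)" for v
  define I0 where "I0 = (\<integral>\<^sup>+ w. g0 w \<partial>circle_measure)"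
  define K where "K = ennreal (2 / (1 - r))"
  have A0m [measurable]: "A0 \<in> borel_measurable circle_measure"
    unfolding A0_def by (rule nn_integral_poisson_pair[OF g0 r])
  have A1m [measurable]: "A1 \<in> borel_measurable circle_measure"
    unfolding A1_def by (rule nn_integral_poisson_pair[OF _ r]) measurable
  have pt: "ennreal (norm (f (of_real r * v))) \<le> 2 ^ Suc N * ((K * I0) ^ N * A0 v
      + (\<integral>\<^sup>+ w. ennreal (poisson (of_real r * v) w) * ennreal (g1 w ^ Suc N) \<partial>circle_measure))"
    if v: "norm v = 1" for v
  proof -
    let ?z = "of_real r * v"
    have nz: "norm ?z = r" using v r by (simp add: norm_mult)
    then have z: "norm ?z < 1" using r by simp
    interpret Pz: prob_space "poisson_measure ?z" by (rule prob_space_poisson_measure[OF z])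
    have lnm: "(\<lambda>w. \<theta> * ln (G w)) \<in> borel_measurable circle_measure" by measurable
    have i: "integrable (poisson_measure ?z) (\<lambda>w. \<theta> * ln (G w))"
      unfolding poisson_measure_def
    proof (subst integrable_density)
      show "integrable circle_measure (\<lambda>w. poisson ?z w *\<^sub>R (\<theta> * ln (G w)))"
      proof (rule Bochner_Integration.integrable_bound[of _ "\<lambda>w. 2 / (1 - norm ?z) * \<theta> * ln (G w)"])
        show "AE w in circle_measure. norm (poisson ?z w *\<^sub>R (\<theta> * ln (G w))) \<le> norm (2 / (1 - norm ?z) * \<theta> * ln (G w))"
        proof (rule AE_I2)
          fix w assume "w \<in> space circle_measure"
          then have "poisson ?z w \<le> 2 / (1 - norm ?z)" "0 \<le> poisson ?z w"
            using poisson_le[OF z] poisson_nonneg[OF z] by auto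
          then have "poisson ?z w * (\<theta> * ln (G w)) \<le> 2 / (1 - norm ?z) * (\<theta> * ln (G w))"
            using G1[of w] \<theta> by (intro mult_right_mono) auto
          then show "norm (poisson ?z w *\<^sub>R (\<theta> * ln (G w))) \<le> norm (2 / (1 - norm ?z) * \<theta> * ln (G w))"
            using \<open>0 \<le> poisson ?z w\<close> G1[of w] \<theta> z by (simp add: abs_mult mult.assoc)
        qed
      qed (use int z in auto)
    qed (use z lnm in \<open>auto simp: poisson_nonneg\<close>)
    have E: "Pz.expectation (\<lambda>w. \<theta> * ln (G w)) = \<theta> * (\<integral>w. poisson ?z w * ln (G w) \<partial>circle_measure)"
    proof -
      have "Pz.expectation (\<lambda>w. \<theta> * ln (G w)) = (\<integral>w. \<theta> * (poisson ?z w * ln (G w)) \<partial>circle_measure)"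
        by (subst integral_poisson_measure[OF z lnm]) (simp add: mult_ac)
      then show ?thesis by simp
    qed
    have "ennreal (norm (f ?z)) \<le> ennreal (exp (\<integral>w. poisson ?z w * ln (G w) \<partial>circle_measure))"
      by (rule ennreal_leI[OF le[OF z]])
    also have "\<dots> = ennreal (exp (Pz.expectation (\<lambda>w. \<theta> * ln (G w)))) ^ Suc N"
    proof -
      have "exp (\<integral>w. poisson ?z w * ln (G w) \<partial>circle_measure) = exp (Pz.expectation (\<lambda>w. \<theta> * ln (G w))) ^ Suc N"
        unfolding E exp_of_nat_mult[symmetric] using \<theta>(2) by (simp add: mult.assoc[symmetric] mult.commute)
      then show ?thesis by (simp only: ennreal_power exp_ge_zero)
    qed
    also have "\<dots> \<le> (\<integral>\<^sup>+ w. ennreal (exp (\<theta> * ln (G w))) \<partial>poisson_measure ?z) ^ Suc N"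
      by (intro power_mono Pz.exp_expectation_le i) auto
    also have "(\<integral>\<^sup>+ w. ennreal (exp (\<theta> * ln (G w))) \<partial>poisson_measure ?z)
        = (\<integral>\<^sup>+ w. ennreal (poisson ?z w) * ennreal (exp (\<theta> * ln (G w))) \<partial>circle_measure)"
      by (rule nn_integral_poisson_measure[OF z]) measurable
    also have "\<dots> = (\<integral>\<^sup>+ w. ennreal (poisson ?z w) * g0 w + ennreal (poisson ?z w) * ennreal (g1 w) \<partial>circle_measure)"
    proof (rule nn_integral_cong)
      fix w
      have "exp (\<theta> * ln (G w)) = G w powr \<theta>" using G1[of w] by (simp add: powr_def)
      then have "ennreal (exp (\<theta> * ln (G w))) = g0 w + ennreal (g1 w)"
        by (cases "G w \<le> \<tau>") (auto simp: g0_def g1_def)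
      then show "ennreal (poisson ?z w) * ennreal (exp (\<theta> * ln (G w)))
          = ennreal (poisson ?z w) * g0 w + ennreal (poisson ?z w) * ennreal (g1 w)"
        by (simp add: distrib_left)
    qed
    also have "\<dots> = A0 v + A1 v"
      unfolding A0_def A1_def using z by (intro nn_integral_add) measurable
    also have "(A0 v + A1 v) ^ Suc N \<le> 2 ^ Suc N * (A0 v ^ Suc N + A1 v ^ Suc N)"
      by (rule ennreal_add_power_le)
    also have "\<dots> \<le> 2 ^ Suc N * ((K * I0) ^ N * A0 v
      + (\<integral>\<^sup>+ w. ennreal (poisson ?z w) * ennreal (g1 w ^ Suc N) \<partial>circle_measure))"
    proof (intro mult_left_mono add_mono)
      \<comment> \<open>Only N of the N + 1 factors are bounded through the supremum of the kernel.
        The last one is kept, because its average over v is \<open>I0\<close> without the factor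
        \<open>K\<close>.\<close>
      have "A0 v \<le> (\<integral>\<^sup>+ w. K * g0 w \<partial>circle_measure)"
        unfolding A0_def K_def
      proof (intro nn_integral_mono mult_right_mono ennreal_leI)
        fix w assume "w \<in> space circle_measure"
        then show "poisson ?z w \<le> 2 / (1 - r)" using poisson_le[OF z, of w] nz by simp
      qed simp
      also have "\<dots> = K * I0" unfolding I0_def by (rule nn_integral_cmult) measurable
      finally have "A0 v ^ N \<le> (K * I0) ^ N" by (intro power_mono) auto
      then show "A0 v ^ Suc N \<le> (K * I0) ^ N * A0 v"
        unfolding power_Suc2 by (rule mult_right_mono) simp
      have A1e: "A1 v = (\<integral>\<^sup>+ w. ennreal (g1 w) \<partial>poisson_measure ?z)"
        unfolding A1_def by (rule nn_integral_poisson_measure[OF z, symmetric]) measurable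
      have "A1 v ^ Suc N \<le> (\<integral>\<^sup>+ w. ennreal (g1 w ^ Suc N) \<partial>poisson_measure ?z)"
        unfolding A1e
      proof (rule Pz.power_expectation_le)
        show "g1 \<in> borel_measurable (poisson_measure ?z)"
          using g1 measurable_cong_sets[OF sets_poisson_measure refl] by blast
        show "0 \<le> g1 w \<and> g1 w \<le> \<bar>\<tau>\<bar> powr \<theta>" for w by (rule g1b)
      qed
      also have "\<dots> = (\<integral>\<^sup>+ w. ennreal (poisson ?z w) * ennreal (g1 w ^ Suc N) \<partial>circle_measure)"
        by (rule nn_integral_poisson_measure[OF z]) measurable
      finally show "A1 v ^ Suc N \<le> (\<integral>\<^sup>+ w. ennreal (poisson ?z w) * ennreal (g1 w ^ Suc N) \<partial>circle_measure)" .
    qed auto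
    finally show ?thesis .
  qed
  have g1Nm: "(\<lambda>w. ennreal (g1 w ^ Suc N)) \<in> borel_measurable circle_measure" by measurable
  have "(\<integral>\<^sup>+ v. ennreal (norm (f (of_real r * v))) \<partial>circle_measure)
      \<le> (\<integral>\<^sup>+ v. 2 ^ Suc N * ((K * I0) ^ N * A0 v
      + (\<integral>\<^sup>+ w. ennreal (poisson (of_real r * v) w) * ennreal (g1 w ^ Suc N) \<partial>circle_measure)) \<partial>circle_measure)"
    by (rule nn_integral_mono) (use pt in auto)
  also have "\<dots> = 2 ^ Suc N * (\<integral>\<^sup>+ v. (K * I0) ^ N * A0 v
      + (\<integral>\<^sup>+ w. ennreal (poisson (of_real r * v) w) * ennreal (g1 w ^ Suc N) \<partial>circle_measure) \<partial>circle_measure)"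
    by (rule nn_integral_cmult)
       (intro borel_measurable_add borel_measurable_times_ennreal borel_measurable_const A0m
          nn_integral_poisson_pair(1)[OF g1Nm r])
  also have "(\<integral>\<^sup>+ v. (K * I0) ^ N * A0 v
      + (\<integral>\<^sup>+ w. ennreal (poisson (of_real r * v) w) * ennreal (g1 w ^ Suc N) \<partial>circle_measure) \<partial>circle_measure)
      = (\<integral>\<^sup>+ v. (K * I0) ^ N * A0 v \<partial>circle_measure)
      + (\<integral>\<^sup>+ v. (\<integral>\<^sup>+ w. ennreal (poisson (of_real r * v) w) * ennreal (g1 w ^ Suc N) \<partial>circle_measure) \<partial>circle_measure)"
    by (rule nn_integral_add)
       (intro borel_measurable_times_ennreal borel_measurable_const A0m nn_integral_poisson_pair(1)[OF g1Nm r])+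
  also have "(\<integral>\<^sup>+ v. (K * I0) ^ N * A0 v \<partial>circle_measure) = (K * I0) ^ N * I0"
    unfolding nn_integral_cmult[OF A0m] unfolding A0_def nn_integral_poisson_pair(2)[OF g0 r] I0_def[symmetric] ..
  also have "(K * I0) ^ N * I0 = K ^ N * I0 ^ Suc N" by (simp add: power_mult_distrib mult_ac)
  also have "(\<integral>\<^sup>+ v. (\<integral>\<^sup>+ w. ennreal (poisson (of_real r * v) w) * ennreal (g1 w ^ Suc N) \<partial>circle_measure) \<partial>circle_measure)
      = (\<integral>\<^sup>+ w. ennreal (g1 w ^ Suc N) \<partial>circle_measure)"
    by (rule nn_integral_poisson_pair(2)[OF g1Nm r])
  also have "\<dots> = (\<integral>\<^sup>+ w. ennreal (G w) * indicator {w. G w \<le> \<tau>} w \<partial>circle_measure)"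
    unfolding g1N by (rule nn_integral_cong) (auto simp: indicator_def)
  finally show ?thesis by (simp add: K_def I0_def g0_def \<theta>_def)
qed

section \<open>Coefficients of Hardy--Lorentz functions\<close>

lemma ennreal_le_suminf: "f i \<le> (\<Sum>i. f i)" for f :: "nat \<Rightarrow> ennreal"
  using sum_le_suminf[of f "{i}"] by simp

text \<open>The points where G exceeds all levels form a null set. Elsewhere above \<tau> n, the
  first index at which the level reaches G w exceeds by one the index i of a layer
  \<open>A i\<close> containing w; there G is at most the next level, and \<open>A i\<close> has
  measure at most 2^-(n+i).\<close>

lemma upper_layers:
  fixes G :: "complex \<Rightarrow> real"
  assumes G [measurable]: "G \<in> borel_measurable circle_measure" and G1: "\<And>w. 1 \<le> G w"
    and \<tau>: "\<And>j. emeasure circle_measure {w \<in> space circle_measure. \<tau> j < G w} \<le> ennreal ((1 / 2) ^ j)"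
    and \<theta>: "0 < \<theta>"
  shows "(\<integral>\<^sup>+ w. ennreal (G w powr \<theta>) * indicator {w. \<tau> n < G w} w \<partial>circle_measure)
    \<le> (\<Sum>i. ennreal (\<tau> (Suc (n + i)) powr \<theta>) * ennreal ((1 / 2) ^ (n + i)))"
proof -
  define A where "A i = {w \<in> space circle_measure. \<tau> (n + i) < G w}" for i
  have A [measurable]: "A i \<in> sets circle_measure" for i unfolding A_def by measurable
  have "emeasure circle_measure (\<Inter>i. A i) \<le> ennreal ((1 / 2) ^ (n + i))" for i
    by (rule order_trans[OF emeasure_mono \<tau>[of "n + i"]]) (use A in \<open>auto simp: A_def\<close>)
  moreover have "(\<lambda>i. ennreal ((1 / 2) ^ (n + i))) \<longlonglongrightarrow> ennreal 0"
  proof (rule tendsto_ennrealI)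
    have "(\<lambda>i. (1 / 2 :: real) ^ n * (1 / 2) ^ i) \<longlonglongrightarrow> (1 / 2) ^ n * 0"
      by (intro tendsto_intros LIMSEQ_power_zero) simp
    then show "(\<lambda>i. (1 / 2 :: real) ^ (n + i)) \<longlonglongrightarrow> 0" by (simp add: power_add)
  qed
  ultimately have "emeasure circle_measure (\<Inter>i. A i) \<le> ennreal 0"
    by (intro LIMSEQ_le_const) auto
  then have "(\<Inter>i. A i) \<in> null_sets circle_measure" by (auto simp: null_sets_def)
  then have ae: "AE w in circle_measure. w \<notin> (\<Inter>i. A i)" by (rule AE_not_in)
  have "(\<integral>\<^sup>+ w. ennreal (G w powr \<theta>) * indicator {w. \<tau> n < G w} w \<partial>circle_measure)
      \<le> (\<integral>\<^sup>+ w. (\<Sum>i. ennreal (\<tau> (Suc (n + i)) powr \<theta>) * indicator (A i) w) \<partial>circle_measure)"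
  proof (rule nn_integral_mono_AE)
    show "AE w in circle_measure. ennreal (G w powr \<theta>) * indicator {w. \<tau> n < G w} w
        \<le> (\<Sum>i. ennreal (\<tau> (Suc (n + i)) powr \<theta>) * indicator (A i) w)"
      using ae AE_space
    proof eventually_elim
      case (elim w)
      show ?case
      proof (cases "\<tau> n < G w")
        case True
        have ex: "\<exists>i. G w \<le> \<tau> (n + i)" using elim by (auto simp: A_def not_less)
        define k where "k = (LEAST i. G w \<le> \<tau> (n + i))"
        have k: "G w \<le> \<tau> (n + k)" unfolding k_def using ex by (rule LeastI_ex)
        then have "k \<noteq> 0" using True by (intro notI) simp
        then obtain i where i: "k = Suc i" by (cases k) auto
        then have "i < k" by simp
        then have "\<not> G w \<le> \<tau> (n + i)" unfolding k_def by (rule not_less_Least)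
        then have wA: "w \<in> A i" using elim by (simp add: A_def)
        have "G w powr \<theta> \<le> \<tau> (Suc (n + i)) powr \<theta>"
          using k i G1[of w] \<theta> by (intro powr_mono2) auto
        then have "ennreal (G w powr \<theta>) * indicator {w. \<tau> n < G w} w \<le> ennreal (\<tau> (Suc (n + i)) powr \<theta>) * indicator (A i) w"
          using True wA by (simp add: ennreal_leI)
        also have "\<dots> \<le> (\<Sum>i. ennreal (\<tau> (Suc (n + i)) powr \<theta>) * indicator (A i) w)"
          by (rule ennreal_le_suminf)
        finally show ?thesis .
      qed simp
    qed
  qed
  also have "\<dots> = (\<Sum>i. \<integral>\<^sup>+ w. ennreal (\<tau> (Suc (n + i)) powr \<theta>) * indicator (A i) w \<partial>circle_measure)"
    by (rule nn_integral_suminf) (use A in measurable)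
  also have "\<dots> = (\<Sum>i. ennreal (\<tau> (Suc (n + i)) powr \<theta>) * emeasure circle_measure (A i))"
    by (intro suminf_cong nn_integral_cmult_indicator A)
  also have "\<dots> \<le> (\<Sum>i. ennreal (\<tau> (Suc (n + i)) powr \<theta>) * ennreal ((1 / 2) ^ (n + i)))"
    by (intro suminf_le mult_left_mono) (use \<tau> in \<open>auto simp: A_def\<close>)
  finally show ?thesis .
qed

text \<open>The same layering for finitely many levels. Points where G is at most the first level
  are covered by the constant \<tau> 0, the circle having measure 1.\<close>

lemma lower_layers:
  fixes G :: "complex \<Rightarrow> real"
  assumes G [measurable]: "G \<in> borel_measurable circle_measure" and \<tau>0: "0 \<le> \<tau> 0"
    and \<tau>: "\<And>j. emeasure circle_measure {w \<in> space circle_measure. \<tau> j < G w} \<le> ennreal ((1 / 2) ^ j)"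
  shows "(\<integral>\<^sup>+ w. ennreal (G w) * indicator {w. G w \<le> \<tau> n} w \<partial>circle_measure)
    \<le> ennreal (\<tau> 0) + (\<Sum>j<n. ennreal (\<tau> (Suc j)) * ennreal ((1 / 2) ^ j))"
proof -
  define A where "A i = {w \<in> space circle_measure. \<tau> i < G w}" for i
  have A [measurable]: "A i \<in> sets circle_measure" for i unfolding A_def by measurable
  have "(\<integral>\<^sup>+ w. ennreal (G w) * indicator {w. G w \<le> \<tau> n} w \<partial>circle_measure)
      \<le> (\<integral>\<^sup>+ w. ennreal (\<tau> 0) + (\<Sum>j<n. ennreal (\<tau> (Suc j)) * indicator (A j) w) \<partial>circle_measure)"
  proof (rule nn_integral_mono)
    fix w assume w: "w \<in> space circle_measure"
    show "ennreal (G w) * indicator {w. G w \<le> \<tau> n} w \<le> ennreal (\<tau> 0) + (\<Sum>j<n. ennreal (\<tau> (Suc j)) * indicator (A j) w)"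
    proof (cases "G w \<le> \<tau> n")
      case True
      define k where "k = (LEAST i. G w \<le> \<tau> i)"
      have k: "G w \<le> \<tau> k" unfolding k_def using True by (rule LeastI)
      have kn: "k \<le> n" unfolding k_def using True by (rule Least_le)
      show ?thesis
      proof (cases k)
        case 0
        then have "ennreal (G w) \<le> ennreal (\<tau> 0)" using k by (simp add: ennreal_leI)
        then show ?thesis using True by (simp add: add_increasing2)
      next
        case (Suc i)
        then have "i < k" by simp
        then have "\<not> G w \<le> \<tau> i" unfolding k_def by (rule not_less_Least)
        then have wA: "w \<in> A i" using w by (simp add: A_def)
        have "ennreal (G w) \<le> ennreal (\<tau> (Suc i)) * indicator (A i) w"
          using k Suc wA by (simp add: ennreal_leI)
        also have "\<dots> \<le> (\<Sum>j<n. ennreal (\<tau> (Suc j)) * indicator (A j) w)"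
          using kn Suc by (intro member_le_sum) auto
        finally show ?thesis using True by (simp add: add_increasing)
      qed
    qed simp
  qed
  also have "\<dots> = ennreal (\<tau> 0) + (\<integral>\<^sup>+ w. (\<Sum>j<n. ennreal (\<tau> (Suc j)) * indicator (A j) w) \<partial>circle_measure)"
  proof (subst nn_integral_add)
    show "(\<lambda>w. \<Sum>j<n. ennreal (\<tau> (Suc j)) * indicator (A j) w) \<in> borel_measurable circle_measure"
      by (intro borel_measurable_sum borel_measurable_times_ennreal borel_measurable_const borel_measurable_indicator A)
  qed (use circle.emeasure_space_1 in simp_all)
  also have "(\<integral>\<^sup>+ w. (\<Sum>j<n. ennreal (\<tau> (Suc j)) * indicator (A j) w) \<partial>circle_measure)
      = (\<Sum>j<n. \<integral>\<^sup>+ w. ennreal (\<tau> (Suc j)) * indicator (A j) w \<partial>circle_measure)"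
    by (rule nn_integral_sum) (use A in measurable)
  also have "\<dots> = (\<Sum>j<n. ennreal (\<tau> (Suc j)) * emeasure circle_measure (A j))"
    by (intro sum.cong refl nn_integral_cmult_indicator A)
  also have "ennreal (\<tau> 0) + \<dots> \<le> ennreal (\<tau> 0) + (\<Sum>j<n. ennreal (\<tau> (Suc j)) * ennreal ((1 / 2) ^ j))"
    by (intro add_left_mono sum_mono mult_left_mono) (use \<tau> in \<open>auto simp: A_def\<close>)
  finally show ?thesis .
qed

section \<open>Decreasing rearrangement and the discretized Lorentz integral\<close>

context
  fixes g :: "complex \<Rightarrow> complex"
  assumes g [measurable]: "g \<in> borel_measurable circle_measure"
begin

lemma distribution_fun_antimono: "t \<le> t' \<Longrightarrow> distribution_fun g t' \<le> distribution_fun g t"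
  unfolding distribution_fun_def
proof (rule circle.finite_measure_mono)
  show "{z \<in> space circle_measure. t < norm (g z)} \<in> sets circle_measure" by measurable
qed (auto intro: le_less_trans)

lemma distribution_fun_level_exists:
  assumes "0 < s"
  shows "\<exists>t\<ge>0. distribution_fun g t \<le> s"
proof -
  have "(\<lambda>n. measure circle_measure {z \<in> space circle_measure. real n < norm (g z)})
      \<longlonglongrightarrow> measure circle_measure (\<Inter>n. {z \<in> space circle_measure. real n < norm (g z)})"
  proof (rule circle.finite_Lim_measure_decseq)
    have "{z \<in> space circle_measure. real n < norm (g z)} \<in> sets circle_measure" for n by measurable
    then show "range (\<lambda>n. {z \<in> space circle_measure. real n < norm (g z)}) \<subseteq> sets circle_measure" by blast
  qed (auto simp: decseq_def)
  also have "(\<Inter>n. {z \<in> space circle_measure. real n < norm (g z)}) = {}"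
  proof (rule equals0I)
    fix z assume z: "z \<in> (\<Inter>n. {z \<in> space circle_measure. real n < norm (g z)})"
    obtain n where "norm (g z) < real n" using reals_Archimedean2 by blast
    moreover have "real n < norm (g z)" using z by blast
    ultimately show False by simp
  qed
  finally have "(\<lambda>n. distribution_fun g (real n)) \<longlonglongrightarrow> 0" by (simp add: distribution_fun_def)
  then have "\<forall>\<^sub>F n in sequentially. distribution_fun g (real n) < s"
    using assms by (rule order_tendstoD)
  then obtain n where "distribution_fun g (real n) < s" by (auto simp: eventually_sequentially)
  then show ?thesis by (intro exI[of _ "real n"]) auto
qed

lemma decreasing_rearrangement_nonneg: "0 < s \<Longrightarrow> 0 \<le> decreasing_rearrangement g s"
  unfolding decreasing_rearrangement_def
  by (rule cInf_greatest) (use distribution_fun_level_exists in auto)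

lemma decreasing_rearrangement_antimono:
  assumes "0 < s" "s \<le> s'"
  shows "decreasing_rearrangement g s' \<le> decreasing_rearrangement g s"
  unfolding decreasing_rearrangement_def
proof (rule cInf_superset_mono)
  show "{t. 0 \<le> t \<and> distribution_fun g t \<le> s} \<noteq> {}" using distribution_fun_level_exists[OF assms(1)] by auto
  show "bdd_below {t. 0 \<le> t \<and> distribution_fun g t \<le> s'}" by (rule bdd_belowI[of _ 0]) auto
qed (use assms in auto)

text \<open>The added 1 puts the threshold strictly above the infimum, so an admissible t lies below
  it and monotonicity of the distribution function finishes. In the l^q sums it costs only a
  geometric sequence, and it keeps the levels at least 1, in accordance with G = max(1,
  |f|).\<close>

lemma emeasure_rearrangement_le:
  assumes s: "0 < s"
  shows "emeasure circle_measure {z \<in> space circle_measure. decreasing_rearrangement g s + 1 < norm (g z)} \<le> ennreal s"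
proof -
  have "Inf {t. 0 \<le> t \<and> distribution_fun g t \<le> s} < decreasing_rearrangement g s + 1"
    by (simp add: decreasing_rearrangement_def)
  moreover have "{t. 0 \<le> t \<and> distribution_fun g t \<le> s} \<noteq> {}" using distribution_fun_level_exists[OF s] by auto
  ultimately obtain t where t: "0 \<le> t" "distribution_fun g t \<le> s" "t < decreasing_rearrangement g s + 1"
    using cInf_lessD by (metis (no_types, lifting) mem_Collect_eq)
  have "distribution_fun g (decreasing_rearrangement g s + 1) \<le> s"
    using distribution_fun_antimono[of t "decreasing_rearrangement g s + 1"] t by simp
  then show ?thesis
    by (simp add: distribution_fun_def circle.emeasure_eq_measure ennreal_leI)
qed

text \<open>On a dyadic interval the rearrangement is at least its value at the right end, s^(1/p)
  is at least its value at the left end, and 1/s is at least the reciprocal of the right end. Each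
  summand is thus a constant multiple of a lower bound for one piece of the integral.\<close>

lemma summable_rearrangement:
  assumes p: "0 < p" and q: "0 < q" and fin: "lorentz_integral p q g < \<infinity>"
  shows "summable (\<lambda>j. (decreasing_rearrangement g ((1 / 2) ^ j) * ((1 / 2) ^ j) powr (1 / p)) powr q)"
proof -
  define R where "R = decreasing_rearrangement g"
  define I where "I j = {(1 / 2) ^ Suc j <..< (1 / 2 :: real) ^ j}" for j :: nat
  define c where "c j = (R ((1 / 2) ^ j) * ((1 / 2) ^ Suc j) powr (1 / p)) powr q / (1 / 2) ^ j" for j :: nat
  have c0: "0 \<le> c j" for j by (simp add: c_def)
  have disj: "disjoint_family I"
    unfolding disjoint_family_on_def
  proof (intro ballI impI)
    have less: "I i \<inter> I j = {}" if "i < j" for i j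
    proof -
      have "(1 / 2 :: real) ^ j \<le> (1 / 2) ^ Suc i" by (rule power_decreasing) (use that in auto)
      then show ?thesis unfolding I_def by force
    qed
    fix i j :: nat assume "i \<noteq> j"
    then show "I i \<inter> I j = {}" using less[of i j] less[of j i] by (cases "i < j") auto
  qed
  have "(\<Sum>j. ennreal (c j * (1 / 2) ^ Suc j)) = (\<Sum>j. ennreal (c j) * emeasure lborel (I j))"
  proof (rule suminf_cong)
    fix j :: nat
    have "emeasure lborel (I j) = ennreal ((1 / 2) ^ Suc j)" unfolding I_def by simp
    then show "ennreal (c j * (1 / 2) ^ Suc j) = ennreal (c j) * emeasure lborel (I j)"
      using c0[of j] by (simp only: ennreal_mult zero_le_power zero_le_divide_1_iff zero_le_numeral)
  qed
  also have "\<dots> = (\<Sum>j. \<integral>\<^sup>+ s. ennreal (c j) * indicator (I j) s \<partial>lborel)"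
    by (intro suminf_cong nn_integral_cmult_indicator[symmetric]) (simp add: I_def)
  also have "\<dots> = (\<integral>\<^sup>+ s. (\<Sum>j. ennreal (c j) * indicator (I j) s) \<partial>lborel)"
    by (rule nn_integral_suminf[symmetric]) (simp add: I_def)
  also have "\<dots> \<le> lorentz_integral p q g"
    unfolding lorentz_integral_def
  proof (rule nn_integral_mono)
    fix s :: real
    show "(\<Sum>j. ennreal (c j) * indicator (I j) s)
        \<le> ennreal ((decreasing_rearrangement g s * s powr (1 / p)) powr q / s) * indicator {0<..<1} s"
    proof (cases "\<exists>j. s \<in> I j")
      case True
      then obtain j where j: "s \<in> I j" by blast
      have s: "(1 / 2) ^ Suc j < s" "s < (1 / 2) ^ j" using j by (auto simp: I_def)
      have "0 < (1 / 2 :: real) ^ Suc j" by simp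
      then have s0: "0 < s" using s by linarith
      have "(1 / 2 :: real) ^ j \<le> 1" by (simp add: power_le_one)
      then have s1: "s < 1" using s by linarith
      have "R ((1 / 2) ^ j) \<le> R s" unfolding R_def using s0 s by (intro decreasing_rearrangement_antimono) auto
      moreover have "((1 / 2) ^ Suc j) powr (1 / p) \<le> s powr (1 / p)" using s p by (intro powr_mono2) auto
      ultimately have "R ((1 / 2) ^ j) * ((1 / 2) ^ Suc j) powr (1 / p) \<le> R s * s powr (1 / p)"
        using decreasing_rearrangement_nonneg[OF s0] by (intro mult_mono) (auto simp: R_def)
      then have "(R ((1 / 2) ^ j) * ((1 / 2) ^ Suc j) powr (1 / p)) powr q \<le> (R s * s powr (1 / p)) powr q"
        using q decreasing_rearrangement_nonneg[of "(1 / 2) ^ j"] by (intro powr_mono2) (auto simp: R_def)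
      then have "c j \<le> (R s * s powr (1 / p)) powr q / s"
        unfolding c_def using s s0 by (intro frac_le) auto
      moreover have "(\<Sum>j. ennreal (c j) * indicator (I j) s) = ennreal (c j)"
        by (rule suminf_cmult_indicator[OF disj j])
      ultimately show ?thesis using s0 s1 by (simp add: R_def ennreal_leI)
    next
      case False
      then have "(\<lambda>j. ennreal (c j) * indicator (I j) s) = (\<lambda>_. 0)" by auto
      then show ?thesis by (simp only: suminf_zero zero_le)
    qed
  qed
  finally have "(\<Sum>j. ennreal (c j * (1 / 2) ^ Suc j)) \<noteq> top" using fin by (auto simp: top_unique)
  then have "summable (\<lambda>j. c j * (1 / 2) ^ Suc j)"
    by (rule summable_suminf_not_top[rotated]) (use c0 in auto)
  \<comment> \<open>The factor 2 restores the length of the interval relative to its right end, and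
    2^(q/p) the loss from evaluating s^(1/p) at the left end.\<close>
  then have "summable (\<lambda>j. 2 * 2 powr (q / p) * (c j * (1 / 2) ^ Suc j))" by (rule summable_mult)
  also have "(\<lambda>j. 2 * 2 powr (q / p) * (c j * (1 / 2) ^ Suc j))
      = (\<lambda>j. (R ((1 / 2) ^ j) * ((1 / 2) ^ j) powr (1 / p)) powr q)"
  proof
    fix j :: nat
    have R0: "0 \<le> R ((1 / 2) ^ j)" unfolding R_def by (rule decreasing_rearrangement_nonneg) simp
    have "((1 / 2) ^ Suc j) powr (1 / p) = (1 / 2) powr (1 / p) * ((1 / 2 :: real) ^ j) powr (1 / p)"
      by (simp add: powr_mult[symmetric])
    then have "(R ((1 / 2) ^ j) * ((1 / 2) ^ Suc j) powr (1 / p)) powr q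
        = ((1 / 2) powr (1 / p)) powr q * (R ((1 / 2) ^ j) * ((1 / 2) ^ j) powr (1 / p)) powr q"
      using R0 by (simp add: powr_mult mult_ac)
    moreover have "2 powr (q / p) * ((1 / 2) powr (1 / p)) powr q = (1::real)"
      by (simp add: powr_powr powr_divide)
    ultimately have "2 powr (q / p) * (R ((1 / 2) ^ j) * ((1 / 2) ^ Suc j) powr (1 / p)) powr q
        = (R ((1 / 2) ^ j) * ((1 / 2) ^ j) powr (1 / p)) powr q"
      by (simp add: mult.assoc[symmetric])
    then show "2 * 2 powr (q / p) * (c j * (1 / 2) ^ Suc j) = (R ((1 / 2) ^ j) * ((1 / 2) ^ j) powr (1 / p)) powr q"
      by (simp add: c_def)
  qed
  finally show ?thesis by (simp add: R_def)
qed

end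

lemma lorentz_norm_finite_iff: "lorentz_norm p q g < \<infinity> \<longleftrightarrow> lorentz_integral p q g < \<infinity>"
  by (auto simp: lorentz_norm_def top.not_eq_extremum)

section \<open>Coefficient estimates on dyadic blocks\<close>

lemma coefficient_le_integral_mean:
  fixes a :: "nat \<Rightarrow> complex"
  assumes f: "\<And>z. norm z < 1 \<Longrightarrow> (\<lambda>n. a n * z ^ n) sums f z" and r: "0 \<le> r" "r < 1"
    and hol: "f holomorphic_on ball 0 1"
  shows "norm (a k) * r ^ k \<le> (\<integral>w. norm (f (of_real r * w)) \<partial>circle_measure)"
proof -
  note abs = power_series_abs_summable[OF f r]
  let ?h = "\<lambda>i w. a i * of_real r ^ i * (w ^ i * cnj (w ^ k))"
  have i: "integrable circle_measure (?h i)" for i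
    by (intro continuous_on_sphere_integrable continuous_intros)
  have nh: "norm (?h i w) = norm (a i * of_real r ^ i)" if "norm w = 1" for i w
    using that by (simp add: norm_mult norm_power)
  have I: "(\<integral>w. norm (?h i w) \<partial>circle_measure) = norm (a i * of_real r ^ i)" for i
  proof -
    have "(\<integral>w. norm (?h i w) \<partial>circle_measure) = (\<integral>w. norm (a i * of_real r ^ i) \<partial>circle_measure)"
      by (rule Bochner_Integration.integral_cong[OF refl], rule nh) simp
    then show ?thesis using circle.prob_space by simp
  qed
  have "(\<integral>w. (\<Sum>i. ?h i w) \<partial>circle_measure) = (\<Sum>i. \<integral>w. ?h i w \<partial>circle_measure)"
  proof (rule integral_suminf)
    show "integrable circle_measure (?h i)" for i by (rule i)
    show "AE w in circle_measure. summable (\<lambda>i. norm (?h i w))"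
      by (rule AE_I2) (use abs nh in simp)
    show "summable (\<lambda>i. \<integral>w. norm (?h i w) \<partial>circle_measure)" unfolding I by (rule abs)
  qed
  also have "\<dots> = (\<Sum>i. a i * of_real r ^ i * (if i = k then 1 else 0))"
    by (simp only: integral_mult_right_zero circle_orthogonal)
  also have "\<dots> = a k * of_real r ^ k"
    by (subst suminf_finite[of "{k}"]) auto
  finally have "a k * of_real r ^ k = (\<integral>w. (\<Sum>i. ?h i w) \<partial>circle_measure)" ..
  also have "\<dots> = (\<integral>w. f (of_real r * w) * cnj (w ^ k) \<partial>circle_measure)"
  proof (rule Bochner_Integration.integral_cong[OF refl])
    fix w assume "w \<in> space circle_measure"
    then have "norm (of_real r * w) < 1" using r by (simp add: norm_mult)
    from sums_mult2[OF f[OF this], of "cnj (w ^ k)"]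
    have "(\<lambda>i. ?h i w) sums (f (of_real r * w) * cnj (w ^ k))"
      by (simp add: power_mult_distrib mult_ac)
    then show "(\<Sum>i. ?h i w) = f (of_real r * w) * cnj (w ^ k)" by (rule sums_unique[symmetric])
  qed
  finally have ak: "a k * of_real r ^ k = (\<integral>w. f (of_real r * w) * cnj (w ^ k) \<partial>circle_measure)" .
  have "norm (a k) * r ^ k = norm (\<integral>w. f (of_real r * w) * cnj (w ^ k) \<partial>circle_measure)"
    unfolding ak[symmetric] using r by (simp add: norm_mult norm_power)
  also have "\<dots> \<le> (\<integral>w. norm (f (of_real r * w) * cnj (w ^ k)) \<partial>circle_measure)"
    by (rule integral_norm_bound)
  also have "\<dots> = (\<integral>w. norm (f (of_real r * w)) \<partial>circle_measure)"
    by (rule Bochner_Integration.integral_cong) (auto simp: norm_mult norm_power)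
  finally show ?thesis .
qed

text \<open>The sequence (1 - 2^-n)^(2^n) increases, by 1 - x <= (1 - x/2)^2, and starts with 1/4 at
  n = 1. Exponents k below 2^n only enlarge the power.\<close>

lemma dyadic_power_ge:
  assumes "1 \<le> n" "k \<in> dyadic_block n"
  shows "1 / 4 \<le> (1 - (1 / 2) ^ n :: real) ^ k"
proof -
  have "1 / 4 \<le> (1 - (1 / 2) ^ Suc n :: real) ^ (2 ^ Suc n)" for n
  proof (induction n)
    case (Suc n)
    have "1 - x \<le> (1 - x / 2)\<^sup>2" for x :: real
      by (simp add: power2_eq_square algebra_simps)
    from this[of "(1 / 2) ^ Suc n"] have "1 - (1 / 2 :: real) ^ Suc n \<le> (1 - (1 / 2) ^ Suc (Suc n))\<^sup>2"
      by simp
    moreover have "(1 / 2 :: real) ^ Suc n \<le> 1" by (rule power_le_one) auto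
    ultimately have "(1 - (1 / 2 :: real) ^ Suc n) ^ (2 ^ Suc n) \<le> ((1 - (1 / 2) ^ Suc (Suc n))\<^sup>2) ^ (2 ^ Suc n)"
      by (intro power_mono) auto
    also have "\<dots> = (1 - (1 / 2) ^ Suc (Suc n)) ^ (2 ^ Suc (Suc n))"
      unfolding power_mult[symmetric] by simp
    finally show ?case using Suc by linarith
  qed (simp add: power2_eq_square)
  from this[of "n - 1"] have "1 / 4 \<le> (1 - (1 / 2) ^ n :: real) ^ (2 ^ n)" using assms(1) by simp
  also have "\<dots> \<le> (1 - (1 / 2) ^ n) ^ k"
    using assms by (intro power_decreasing) (auto simp: dyadic_block_def power_le_one)
  finally show ?thesis .
qed


lemma half_powr_lt_one: "0 < x \<Longrightarrow> (1 / 2 :: real) powr x < 1"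
  using powr_less_mono2[of x "1 / 2" 1] by simp

theorem hardy_lorentz_coefficients:
  fixes a :: "nat \<Rightarrow> complex"
  assumes a: "a \<in> coeff_space (hardy_lorentz p q)" and p: "0 < p" "p < 1" and q: "0 < q"
  obtains D where "\<And>n. 0 \<le> D n" "summable (\<lambda>n. D n powr q)"
    "\<And>n k. k \<in> dyadic_block n \<Longrightarrow> norm (a k) * ((1 / 2) powr (1 / p - 1)) ^ n \<le> D n"
proof -
  obtain f where f: "f \<in> hardy_lorentz p q" and fa: "\<And>z. norm z < 1 \<Longrightarrow> (\<lambda>n. a n * z ^ n) sums f z"
    using a by (auto simp: coeff_space_def)
  have S: "f \<in> smirnov_class" and L: "lorentz_integral p q (boundary_fun f) < \<infinity>"
    using f unfolding hardy_lorentz_def lorentz_norm_finite_iff by auto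
  have hol: "f holomorphic_on ball 0 1" using S by (simp add: smirnov_class_def nevanlinna_class_def)
  have bm [measurable]: "boundary_fun f \<in> borel_measurable circle_measure" by (rule boundary_fun_measurable[OF hol])
  define R where "R j = decreasing_rearrangement (boundary_fun f) ((1 / 2) ^ j)" for j :: nat
  have R0: "0 \<le> R j" for j unfolding R_def by (rule decreasing_rearrangement_nonneg[OF bm]) simp
  define \<tau> where "\<tau> j = R j + 1" for j
  have \<tau>1: "1 \<le> \<tau> j" for j using R0[of j] by (simp add: \<tau>_def)
  have \<tau>0: "0 \<le> \<tau> j" for j using \<tau>1[of j] by simp
  define G where "G w = max 1 (norm (boundary_fun f w))" for w
  have G [measurable]: "G \<in> borel_measurable circle_measure" unfolding G_def by measurable
  have G1: "1 \<le> G w" for w by (simp add: G_def)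
  have lnG: "ln (G w) = log_plus (norm (boundary_fun f w))" for w
    by (simp add: G_def log_plus_altdef)
  have \<tau>: "emeasure circle_measure {w \<in> space circle_measure. \<tau> j < G w} \<le> ennreal ((1 / 2) ^ j)" for j
  proof -
    have "{w \<in> space circle_measure. \<tau> j < G w} = {w \<in> space circle_measure. R j + 1 < norm (boundary_fun f w)}"
      using \<tau>1[of j] by (auto simp: G_def \<tau>_def)
    then show ?thesis using emeasure_rearrangement_le[OF bm, of "(1 / 2) ^ j"] by (simp add: R_def)
  qed
  \<comment> \<open>Dyadic samples of f*(s) s^(1/p), with the levels \<tau> in place of f*.\<close>
  define b where "b j = ((1 / 2) ^ j) powr (1 / p) * \<tau> j" for j :: nat
  have b0: "0 \<le> b j" for j using \<tau>1[of j] by (simp add: b_def)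
  have half: "((1 / 2) ^ j) powr x = ((1 / 2) powr x) ^ j" for j :: nat and x :: real
    by (simp add: powr_realpow[symmetric] powr_powr mult.commute)
  have bsum: "summable (\<lambda>j. b j powr q)"
  proof -
    have "summable (\<lambda>j. (R j * ((1 / 2) ^ j) powr (1 / p) + ((1 / 2) ^ j) powr (1 / p)) powr q)"
    proof (rule summable_powr_add)
      show "summable (\<lambda>j. (R j * ((1 / 2) ^ j) powr (1 / p)) powr q)"
        unfolding R_def by (rule summable_rearrangement[OF bm p(1) q L])
      have "(1 / 2 :: real) powr (q / p) < 1" using p q by (intro half_powr_lt_one) auto
      then have "summable (\<lambda>j. ((1 / 2 :: real) powr (q / p)) ^ j)" by (intro summable_geometric) simp
      then show "summable (\<lambda>j::nat. (((1 / 2 :: real) ^ j) powr (1 / p)) powr q)"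
        unfolding powr_powr unfolding half by simp
    qed (use q R0 in auto)
    then show ?thesis by (simp add: b_def \<tau>_def algebra_simps)
  qed
  \<comment> \<open>N + 1 > 1/p gives \<theta> / p < 1, so that the ratio \<rho>1 governing the
    upper layers is below 1. The ratio \<rho>2 of the lower layers is below 1 because p < 1.\<close>
  obtain N :: nat where "1 / p < real N" using reals_Archimedean2 by blast
  then have N: "1 / p < real (Suc N)" by simp
  define \<theta> where "\<theta> = 1 / real (Suc N)"
  have \<theta>: "0 < \<theta>" "\<theta> * real (Suc N) = 1" by (auto simp: \<theta>_def)
  have \<theta>p: "0 < 1 - \<theta> / p"
    using N p by (simp add: \<theta>_def field_simps)
  define \<rho>1 where "\<rho>1 = (1 / 2 :: real) powr (1 - \<theta> / p)"
  define \<rho>2 where "\<rho>2 = (1 / 2 :: real) powr (1 / p - 1)"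
  have \<rho>1: "0 < \<rho>1" "\<rho>1 < 1" unfolding \<rho>1_def using half_powr_lt_one[OF \<theta>p] by auto
  have \<rho>2: "0 < \<rho>2" "\<rho>2 < 1" unfolding \<rho>2_def using p by (auto intro!: half_powr_lt_one)
  \<comment> \<open>Per unit of n, 2^N is the growth of the N kernel suprema, \<rho>1^(N+1) the
    decay of the upper layers and \<rho>2 the weight of the coefficients. They balance exactly,
    which leaves only the power of \<open>c1 n\<close> in the final bound.\<close>
  have \<rho>12: "2 ^ N * \<rho>1 ^ Suc N * \<rho>2 = 1"
  proof -
    have "\<rho>1 ^ Suc N = (1 / 2) powr ((1 - \<theta> / p) * real (Suc N))"
      unfolding \<rho>1_def by (subst powr_realpow[symmetric]) (auto simp: powr_powr)
    also have "(1 - \<theta> / p) * real (Suc N) = real (Suc N) - (\<theta> * real (Suc N)) / p"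
      by (simp only: left_diff_distrib mult_1_left times_divide_eq_left)
    also have "\<dots> = real (Suc N) - 1 / p" by (simp only: \<theta>(2))
    finally have "\<rho>1 ^ Suc N * \<rho>2 = (1 / 2) powr (real (Suc N) - 1 / p + (1 / p - 1))"
      unfolding \<rho>2_def by (simp only: powr_add)
    also have "real (Suc N) - 1 / p + (1 / p - 1) = real N" by simp
    also have "(1 / 2 :: real) powr real N = (1 / 2) ^ N" by (rule powr_realpow) simp
    finally show ?thesis by (simp add: mult.assoc power_mult_distrib[symmetric])
  qed
  \<comment> \<open>As a power \<theta> of an l^q sequence this lies in l^(q(N+1)). The power N + 1
    in the mean estimate brings its convolution back to l^q.\<close>
  define b' where "b' j = b j powr \<theta>" for j
  have b'0: "0 \<le> b' j" for j by (simp add: b'_def)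
  have b'sum: "summable (\<lambda>j. b' j powr (q * real (Suc N)))"
  proof -
    have "\<theta> * (q * real (Suc N)) = q * (\<theta> * real (Suc N))" by (simp only: mult.left_commute)
    then have "\<theta> * (q * real (Suc N)) = q" by (simp only: \<theta>(2) mult_1_right)
    then show ?thesis using bsum by (simp only: b'_def powr_powr)
  qed
  have qN: "0 < q * real (Suc N)" using q by simp
  note c1 = geom_conv[OF b'0 b'sum qN \<rho>1]
  note c2 = geom_conv[OF b0 bsum q \<rho>2]
  define c1 where "c1 n = geom_conv \<rho>1 b' n" for n
  define c2 where "c2 n = geom_conv \<rho>2 b n" for n
  have upper: "(\<integral>\<^sup>+ w. ennreal (G w powr \<theta>) * indicator {w. \<tau> n < G w} w \<partial>circle_measure) \<le> ennreal (2 * \<rho>1 ^ n * c1 n)" for n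
  proof -
    \<comment> \<open>The factor 2 pays for the index shift: layer i has measure 2^-(n+i), but its
      level has index n + i + 1.\<close>
    have eq: "\<tau> (Suc (n + i)) powr \<theta> * (1 / 2) ^ (n + i) = 2 * \<rho>1 ^ n * (\<rho>1 ^ nat_dist n (i + Suc n) * b' (i + Suc n))" for i
    proof -
      define m where "m = Suc (n + i)"
      have "b' m = (((1 / 2) ^ m) powr (1 / p)) powr \<theta> * \<tau> m powr \<theta>"
        unfolding b'_def b_def by (rule powr_mult)
      also have "(((1 / 2 :: real) ^ m) powr (1 / p)) powr \<theta> = ((1 / 2) powr (\<theta> / p)) ^ m"
        unfolding powr_powr unfolding half by simp
      finally have "\<rho>1 ^ m * b' m = (\<rho>1 * (1 / 2) powr (\<theta> / p)) ^ m * \<tau> m powr \<theta>"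
        by (simp add: power_mult_distrib)
      also have "\<rho>1 * (1 / 2) powr (\<theta> / p) = 1 / 2"
        unfolding \<rho>1_def by (simp add: powr_add[symmetric])
      finally have fe: "\<rho>1 ^ m * b' m = (1 / 2) ^ m * \<tau> m powr \<theta>" .
      have im: "i + Suc n = m" by (simp add: m_def)
      have nm: "\<rho>1 ^ m = \<rho>1 ^ n * \<rho>1 ^ nat_dist n m"
        by (simp add: m_def nat_dist_def power_add[symmetric])
      have "\<tau> m powr \<theta> * (1 / 2) ^ (n + i) = 2 * ((1 / 2) ^ m * \<tau> m powr \<theta>)"
        by (simp add: m_def)
      also have "\<dots> = 2 * (\<rho>1 ^ m * b' m)" by (simp only: fe)
      also have "\<dots> = 2 * \<rho>1 ^ n * (\<rho>1 ^ nat_dist n m * b' m)" unfolding nm by (simp only: mult.assoc)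
      finally show ?thesis unfolding im m_def[symmetric] .
    qed
    have s: "summable (\<lambda>i. \<rho>1 ^ nat_dist n (i + Suc n) * b' (i + Suc n))"
      using summable_iff_shift[of "\<lambda>j. \<rho>1 ^ nat_dist n j * b' j" "Suc n"] c1(1)[of n] by simp
    have "(\<integral>\<^sup>+ w. ennreal (G w powr \<theta>) * indicator {w. \<tau> n < G w} w \<partial>circle_measure)
      \<le> (\<Sum>i. ennreal (\<tau> (Suc (n + i)) powr \<theta>) * ennreal ((1 / 2) ^ (n + i)))"
      by (rule upper_layers[OF G G1 \<tau> \<theta>(1)])
    also have "\<dots> = (\<Sum>i. ennreal (2 * \<rho>1 ^ n * (\<rho>1 ^ nat_dist n (i + Suc n) * b' (i + Suc n))))"
      unfolding eq[symmetric] by (intro suminf_cong ennreal_mult[symmetric]) auto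
    also have "\<dots> = ennreal (\<Sum>i. 2 * \<rho>1 ^ n * (\<rho>1 ^ nat_dist n (i + Suc n) * b' (i + Suc n)))"
      by (rule suminf_ennreal2) (use \<rho>1 b'0 s in \<open>auto intro!: summable_mult\<close>)
    also have "\<dots> \<le> ennreal (2 * \<rho>1 ^ n * c1 n)"
    proof (rule ennreal_leI)
      have "(\<Sum>i. \<rho>1 ^ nat_dist n (i + Suc n) * b' (i + Suc n)) \<le> c1 n"
        unfolding c1_def geom_conv_def using suminf_split_initial_segment[OF c1(1)[of n], of "Suc n"]
          sum_nonneg[of "{..<Suc n}" "\<lambda>j. \<rho>1 ^ nat_dist n j * b' j"] \<rho>1 b'0 by simp
      then show "(\<Sum>i. 2 * \<rho>1 ^ n * (\<rho>1 ^ nat_dist n (i + Suc n) * b' (i + Suc n))) \<le> 2 * \<rho>1 ^ n * c1 n"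
        unfolding suminf_mult[OF s] using \<rho>1 by (intro mult_left_mono) auto
    qed
    finally show ?thesis .
  qed
  have lower: "ennreal (\<rho>2 ^ n) * (\<integral>\<^sup>+ w. ennreal (G w) * indicator {w. G w \<le> \<tau> n} w \<partial>circle_measure) \<le> ennreal (2 * c2 n)" for n
  proof -
    \<comment> \<open>Since \<rho>2 / 2 = (1/2)^(1/p), a level \<tau> j counted with measure 2^-j
      and weight \<rho>2^n is \<rho>2^(n-j) b j. The lower layers are thus one half of a geometric
      convolution.\<close>
    have bm: "\<rho>2 ^ m * ((1 / 2) ^ m * \<tau> m) = b m" for m
    proof -
      have "b m = ((1 / 2) powr (1 / p)) ^ m * \<tau> m" by (simp add: b_def half)
      also have "(1 / 2 :: real) powr (1 / p) = \<rho>2 * (1 / 2)"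
        unfolding \<rho>2_def by (simp add: powr_diff)
      finally show ?thesis by (simp only: power_mult_distrib mult.assoc)
    qed
    have split: "\<rho>2 ^ n = \<rho>2 ^ (n - m) * \<rho>2 ^ m" if "m \<le> n" for m
      using that by (simp add: power_add[symmetric])
    have "(\<integral>\<^sup>+ w. ennreal (G w) * indicator {w. G w \<le> \<tau> n} w \<partial>circle_measure)
      \<le> ennreal (\<tau> 0) + (\<Sum>j<n. ennreal (\<tau> (Suc j)) * ennreal ((1 / 2) ^ j))"
      by (rule lower_layers[OF G _ \<tau>]) (use \<tau>1[of 0] in simp)
    also have "\<dots> = ennreal (\<tau> 0 + (\<Sum>j<n. \<tau> (Suc j) * (1 / 2) ^ j))"
    proof -
      have "(\<Sum>j<n. ennreal (\<tau> (Suc j)) * ennreal ((1 / 2) ^ j)) = (\<Sum>j<n. ennreal (\<tau> (Suc j) * (1 / 2) ^ j))"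
        by (intro sum.cong refl ennreal_mult[symmetric] \<tau>0) auto
      also have "\<dots> = ennreal (\<Sum>j<n. \<tau> (Suc j) * (1 / 2) ^ j)"
        by (intro sum_ennreal mult_nonneg_nonneg \<tau>0) auto
      finally show ?thesis
        by (simp add: ennreal_plus sum_nonneg \<tau>0)
    qed
    finally have "ennreal (\<rho>2 ^ n) * (\<integral>\<^sup>+ w. ennreal (G w) * indicator {w. G w \<le> \<tau> n} w \<partial>circle_measure)
        \<le> ennreal (\<rho>2 ^ n) * ennreal (\<tau> 0 + (\<Sum>j<n. \<tau> (Suc j) * (1 / 2) ^ j))"
      by (rule mult_left_mono) simp
    also have "\<dots> = ennreal (\<rho>2 ^ n * (\<tau> 0 + (\<Sum>j<n. \<tau> (Suc j) * (1 / 2) ^ j)))"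
      using \<rho>2 by (intro ennreal_mult[symmetric] add_nonneg_nonneg sum_nonneg mult_nonneg_nonneg \<tau>0) auto
    also have "\<dots> \<le> ennreal (2 * c2 n)"
    proof (rule ennreal_leI)
      have "\<rho>2 ^ n * \<tau> 0 \<le> 2 * (\<rho>2 ^ nat_dist n 0 * b 0)"
        using bm[of 0] b0[of 0] \<rho>2 by (simp add: nat_dist_def)
      moreover have "\<rho>2 ^ n * (\<tau> (Suc j) * (1 / 2) ^ j) = 2 * (\<rho>2 ^ nat_dist n (Suc j) * b (Suc j))" if "j < n" for j
        using that split[of "Suc j"] by (simp add: bm[symmetric] nat_dist_def)
      then have "\<rho>2 ^ n * (\<Sum>j<n. \<tau> (Suc j) * (1 / 2) ^ j) = (\<Sum>j<n. 2 * (\<rho>2 ^ nat_dist n (Suc j) * b (Suc j)))"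
        by (simp add: sum_distrib_left)
      ultimately have "\<rho>2 ^ n * (\<tau> 0 + (\<Sum>j<n. \<tau> (Suc j) * (1 / 2) ^ j))
          \<le> 2 * (\<Sum>j<Suc n. \<rho>2 ^ nat_dist n j * b j)"
        by (simp add: distrib_left sum.lessThan_Suc_shift sum_distrib_left del: sum.lessThan_Suc)
      also have "(\<Sum>j<Suc n. \<rho>2 ^ nat_dist n j * b j) \<le> c2 n"
        unfolding c2_def geom_conv_def using \<rho>2 b0 by (intro sum_le_suminf c2(1)) auto
      finally show "\<rho>2 ^ n * (\<tau> 0 + (\<Sum>j<n. \<tau> (Suc j) * (1 / 2) ^ j)) \<le> 2 * c2 n" by simp
    qed
    finally show ?thesis .
  qed
  define M where "M n = (\<integral>w. norm (f (of_real (1 - (1 / 2) ^ n) * w)) \<partial>circle_measure)" for n :: nat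
  define C where "C = (2::real) ^ Suc N"
  have Mle: "\<rho>2 ^ n * M n \<le> C * (2 ^ N * 2 ^ Suc N * c1 n ^ Suc N + 2 * c2 n)" for n
  proof -
    let ?r = "1 - (1 / 2 :: real) ^ n"
    have r: "0 \<le> ?r" "?r < 1" by (auto simp: power_le_one)
    have c10: "0 \<le> c1 n" and c20: "0 \<le> c2 n" unfolding c1_def c2_def by (rule c1(2), rule c2(2))
    have bnd: "norm (f z) \<le> exp (\<integral>w. poisson z w * ln (G w) \<partial>circle_measure)" if z: "norm z < 1" for z
    proof -
      have "norm (f z) \<le> exp (log_plus (norm (f z)))" by (rule le_exp_log_plus) simp
      also have "\<dots> \<le> exp (\<integral>w. poisson z w * ln (G w) \<partial>circle_measure)"
        using smirnov_log_plus_le(2)[OF S z] by (simp add: lnG)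
      finally show ?thesis .
    qed
    have iln: "integrable circle_measure (\<lambda>w. ln (G w))"
      unfolding lnG by (rule smirnov_log_plus_le(1)[OF S, of 0]) simp
    have "ennreal (M n) = (\<integral>\<^sup>+ v. ennreal (norm (f (of_real ?r * v))) \<partial>circle_measure)"
      unfolding M_def
      by (rule nn_integral_eq_integral[symmetric, OF continuous_on_sphere_integrable])
         (intro continuous_on_norm dilate_holomorphic(3)[OF hol r], simp)
    also have "\<dots> \<le> 2 ^ Suc N * (ennreal (2 / (1 - ?r)) ^ N * (\<integral>\<^sup>+ w. ennreal (G w powr (1 / real (Suc N))) * indicator {w. \<tau> n < G w} w \<partial>circle_measure) ^ Suc N
        + (\<integral>\<^sup>+ w. ennreal (G w) * indicator {w. G w \<le> \<tau> n} w \<partial>circle_measure))"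
      by (rule integral_mean_le[OF G G1 iln bnd r])
    finally have "ennreal (\<rho>2 ^ n) * ennreal (M n) \<le> ennreal (\<rho>2 ^ n) * (2 ^ Suc N * (ennreal (2 / (1 - ?r)) ^ N * (\<integral>\<^sup>+ w. ennreal (G w powr \<theta>) * indicator {w. \<tau> n < G w} w \<partial>circle_measure) ^ Suc N
        + (\<integral>\<^sup>+ w. ennreal (G w) * indicator {w. G w \<le> \<tau> n} w \<partial>circle_measure)))"
      unfolding \<theta>_def by (rule mult_left_mono) simp
    also have "\<dots> = 2 ^ Suc N * (ennreal (\<rho>2 ^ n) * (ennreal (2 / (1 - ?r)) ^ N * (\<integral>\<^sup>+ w. ennreal (G w powr \<theta>) * indicator {w. \<tau> n < G w} w \<partial>circle_measure) ^ Suc N)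
        + ennreal (\<rho>2 ^ n) * (\<integral>\<^sup>+ w. ennreal (G w) * indicator {w. G w \<le> \<tau> n} w \<partial>circle_measure))"
      by (simp only: distrib_left mult.left_commute)
    also have "\<dots> \<le> 2 ^ Suc N * (ennreal (\<rho>2 ^ n) * (ennreal (2 / (1 - ?r)) ^ N * ennreal (2 * \<rho>1 ^ n * c1 n) ^ Suc N)
        + ennreal (2 * c2 n))"
      by (intro mult_left_mono add_mono power_mono upper lower) auto
    also have "\<dots> = ennreal (C * (\<rho>2 ^ n * ((2 / (1 - ?r)) ^ N * (2 * \<rho>1 ^ n * c1 n) ^ Suc N) + 2 * c2 n))"
    proof -
      have C: "ennreal C = 2 ^ Suc N"
        unfolding C_def by (subst ennreal_power[symmetric]) simp_all
      have "ennreal C * (ennreal x * (ennreal y ^ N * ennreal u ^ Suc N) + ennreal v)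
          = ennreal (C * (x * (y ^ N * u ^ Suc N) + v))"
        if "0 \<le> x" "0 \<le> y" "0 \<le> u" "0 \<le> v" for x y u v
        using that by (simp add: ennreal_power ennreal_mult ennreal_plus C_def del: power_Suc)
      from this[of "\<rho>2 ^ n" "2 / (1 - ?r)" "2 * \<rho>1 ^ n * c1 n" "2 * c2 n"] show ?thesis
        unfolding C using \<rho>2 \<rho>1 c10 c20 r by simp
    qed
    also have "\<rho>2 ^ n * ((2 / (1 - ?r)) ^ N * (2 * \<rho>1 ^ n * c1 n) ^ Suc N) = 2 ^ N * 2 ^ Suc N * c1 n ^ Suc N"
    proof -
      have "2 / (1 - ?r) = 2 * 2 ^ n" by (simp add: power_divide)
      then have "\<rho>2 ^ n * ((2 / (1 - ?r)) ^ N * (2 * \<rho>1 ^ n * c1 n) ^ Suc N)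
          = \<rho>2 ^ n * ((2 * 2 ^ n) ^ N * (2 * \<rho>1 ^ n * c1 n) ^ Suc N)" by (simp only:)
      also have "\<dots> = 2 ^ N * 2 ^ Suc N * c1 n ^ Suc N * ((2 ^ n) ^ N * (\<rho>1 ^ n) ^ Suc N * \<rho>2 ^ n)"
        by (simp only: power_mult_distrib mult_ac)
      also have "(2 ^ n) ^ N * (\<rho>1 ^ n) ^ Suc N * \<rho>2 ^ n = (2 ^ N * \<rho>1 ^ Suc N * \<rho>2) ^ n"
        by (simp only: power_mult_distrib power_mult[symmetric] mult.commute[of n])
      finally show ?thesis by (simp only: \<rho>12 power_one mult_1_right)
    qed
    finally have "ennreal (\<rho>2 ^ n * M n) \<le> ennreal (C * (2 ^ N * 2 ^ Suc N * c1 n ^ Suc N + 2 * c2 n))"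
      using \<rho>2 by (simp only: ennreal_mult'[symmetric] zero_le_power less_imp_le)
    moreover have "0 \<le> C * (2 ^ N * 2 ^ Suc N * c1 n ^ Suc N + 2 * c2 n)"
      using c10 c20 by (simp add: C_def)
    ultimately show ?thesis by simp
  qed
  \<comment> \<open>For n = 0 the circle degenerates to the origin and the block is
    \<open>{0}\<close>, so the coefficient itself is added. For n >= 1 a factor 4 undoes the lower
    bound 1/4 of \<open>dyadic_power_ge\<close>.\<close>
  define D where "D n = (if n = 0 then norm (a 0) else 0) + (4 * C * 2 ^ N * 2 ^ Suc N * c1 n ^ Suc N + 8 * C * c2 n)" for n
  have c10: "0 \<le> c1 n" and c20: "0 \<le> c2 n" for n unfolding c1_def c2_def by (rule c1(2), rule c2(2))
  have C0: "0 < C" by (simp add: C_def)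
  show ?thesis
  proof (rule that[of D])
    show "0 \<le> D n" for n using c10 c20 C0 by (simp add: D_def)
    show "summable (\<lambda>n. D n powr q)"
      unfolding D_def
    proof (intro summable_powr_add)
      show "summable (\<lambda>n. (if n = 0 then norm (a 0) else 0) powr q)"
        by (rule summable_finite[of "{0}"]) auto
      have "(c1 n ^ Suc N) powr q = c1 n powr (q * real (Suc N))" for n
      proof (cases "c1 n = 0")
        case False
        then have "0 < c1 n" using c10[of n] by simp
        then show ?thesis by (subst powr_realpow[symmetric]) (auto simp: powr_powr mult.commute)
      qed simp
      then have "summable (\<lambda>n. (c1 n ^ Suc N) powr q)" using c1(3) by (simp only: c1_def)
      then show "summable (\<lambda>n. (4 * C * 2 ^ N * 2 ^ Suc N * c1 n ^ Suc N) powr q)"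
        by (rule summable_powr_cmult[rotated 2]) (use c10 C0 in auto)
      show "summable (\<lambda>n. (8 * C * c2 n) powr q)"
        by (rule summable_powr_cmult) (use c20 C0 c2(3) in \<open>auto simp: c2_def\<close>)
    qed (use q c10 c20 C0 in auto)
    fix n k assume k: "k \<in> dyadic_block n"
    show "norm (a k) * ((1 / 2) powr (1 / p - 1)) ^ n \<le> D n"
    proof (cases "n = 0")
      case True
      then have "k = 0" using k by (simp add: dyadic_block_def)
      then show ?thesis using True c10[of 0] c20[of 0] C0 by (simp add: D_def)
    next
      case False
      let ?r = "1 - (1 / 2 :: real) ^ n"
      have r: "0 \<le> ?r" "?r < 1" by (auto simp: power_le_one)
      have "norm (a k) * (1 / 4) \<le> norm (a k) * ?r ^ k"
        using dyadic_power_ge[OF _ k] False by (intro mult_left_mono) auto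
      also have "\<dots> \<le> M n" unfolding M_def by (rule coefficient_le_integral_mean[OF fa r hol])
      finally have "\<rho>2 ^ n * (norm (a k) * (1 / 4)) \<le> \<rho>2 ^ n * M n" using \<rho>2 by (intro mult_left_mono) auto
      also note Mle[of n]
      finally show ?thesis using False by (simp add: D_def \<rho>2_def[symmetric] algebra_simps)
    qed
  qed
qed

section \<open>Test functions\<close>

text \<open>Each product with the geometric series raises the exponent by one; on coefficients this
  is the hockey-stick identity \<open>choose_rising_sum\<close>.\<close>

lemma negative_binomial_sums:
  fixes x :: complex
  assumes "norm x < 1"
  shows "(\<lambda>k. of_nat (m + k choose m) * x ^ k) sums (1 / (1 - x) ^ Suc m)"
  using assms
proof (induction m arbitrary: x)
  case 0
  then show ?case using geometric_sums[of x] by simp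
next
  case (Suc m)
  have abs: "summable (\<lambda>k. norm (of_nat (m + k choose m) * x ^ k))"
  proof -
    have "summable (\<lambda>k. of_nat (m + k choose m) * complex_of_real (norm x) ^ k)"
      using Suc.IH[of "of_real (norm x)"] Suc.prems by (intro sums_summable) simp
    then have "summable (\<lambda>k. complex_of_real (of_nat (m + k choose m) * norm x ^ k))" by simp
    then have "summable (\<lambda>k. of_nat (m + k choose m) * norm x ^ k)" by (simp only: summable_of_real_iff)
    then show ?thesis by (simp add: norm_mult norm_power)
  qed
  have geo: "(\<lambda>k. x ^ k) sums (1 / (1 - x))" by (rule geometric_sums[OF Suc.prems])
  have absg: "summable (\<lambda>k. norm (x ^ k))" using Suc.prems by (simp add: norm_power summable_geometric)
  have "(\<lambda>k. \<Sum>i\<le>k. of_nat (m + i choose m) * x ^ i * x ^ (k - i)) sums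
      ((\<Sum>k. of_nat (m + k choose m) * x ^ k) * (\<Sum>k. x ^ k))"
    by (rule Cauchy_product_sums[OF abs absg])
  also have "(\<Sum>k. of_nat (m + k choose m) * x ^ k) * (\<Sum>k. x ^ k) = 1 / (1 - x) ^ Suc (Suc m)"
    unfolding sums_unique[OF Suc.IH[OF Suc.prems], symmetric] sums_unique[OF geo, symmetric] by simp
  also have "(\<lambda>k. \<Sum>i\<le>k. of_nat (m + i choose m) * x ^ i * x ^ (k - i))
      = (\<lambda>k. of_nat (Suc m + k choose Suc m) * x ^ k)"
  proof
    fix k
    have "(\<Sum>i\<le>k. of_nat (m + i choose m) * x ^ i * x ^ (k - i)) = (\<Sum>i\<le>k. of_nat (m + i choose m) * x ^ k)"
      by (intro sum.cong refl) (simp add: mult.assoc power_add[symmetric])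
    also have "\<dots> = of_nat (\<Sum>i\<le>k. m + i choose m) * x ^ k" by (simp only: of_nat_sum sum_distrib_right)
    also have "(\<Sum>i\<le>k. m + i choose m) = Suc m + k choose Suc m"
      using choose_rising_sum(1)[where n = m and m = k] by simp
    finally show "(\<Sum>i\<le>k. of_nat (m + i choose m) * x ^ i * x ^ (k - i)) = of_nat (Suc m + k choose Suc m) * x ^ k" .
  qed
  finally show ?case .
qed

text \<open>For the second bound, 1 - z and 1 - \<rho> z differ by at most 1 - \<rho>, which the
  first bound controls.\<close>

lemma norm_one_minus_ge:
  fixes z :: complex
  assumes "norm z \<le> 1" "0 \<le> \<rho>" "\<rho> \<le> 1"
  shows "1 - \<rho> \<le> norm (1 - of_real \<rho> * z)" "norm (1 - z) / 2 \<le> norm (1 - of_real \<rho> * z)"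
proof -
  have "norm (of_real \<rho> * z) \<le> \<rho>" using assms mult_left_le[of "norm z" \<rho>] by (simp add: norm_mult)
  then show 1: "1 - \<rho> \<le> norm (1 - of_real \<rho> * z)"
    using norm_triangle_ineq2[of 1 "of_real \<rho> * z"] by simp
  have "1 - z = (1 - of_real \<rho> * z) - of_real (1 - \<rho>) * z" by (simp add: algebra_simps)
  then have "norm (1 - z) \<le> norm (1 - of_real \<rho> * z) + norm (of_real (1 - \<rho>) * z)"
    by (metis norm_triangle_ineq4)
  also have "norm (of_real (1 - \<rho>) * z) \<le> 1 - \<rho>"
    using assms mult_left_le[of "norm z" "1 - \<rho>"] by (simp add: norm_mult del: of_real_diff)
  finally show "norm (1 - z) / 2 \<le> norm (1 - of_real \<rho> * z)" using 1 by simp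
qed

section \<open>Integrability of the logarithm of the distance to 1\<close>

text \<open>As ln 2 < 1, each doubling step below y accounts for at most one unit of the logarithm.
  Integrating the count reduces integrability of log^+ to summing measures of superlevel
  sets.\<close>

lemma log_plus_le_count:
  fixes y :: real
  assumes "0 \<le> y"
  shows "ennreal (log_plus y) \<le> (\<Sum>j. if 2 ^ j < y then 1 else 0)"
proof (cases "1 < y")
  case True
  obtain n where "y < 2 ^ n" using real_arch_pow[of 2 y] by auto
  then have ex: "\<exists>n. y \<le> 2 ^ n" by (auto intro: less_imp_le)
  define J where "J = (LEAST n. y \<le> 2 ^ n)"
  have J: "y \<le> 2 ^ J" unfolding J_def using ex by (rule LeastI_ex)
  have less: "2 ^ j < y" if "j < J" for j
  proof -
    have "\<not> y \<le> 2 ^ j" using that unfolding J_def by (rule not_less_Least)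
    then show ?thesis by simp
  qed
  have "ln y \<le> ln (2 ^ J)" using J True by (intro ln_mono) auto
  also have "\<dots> = real J * ln 2" by (simp add: ln_realpow)
  also have "\<dots> \<le> real J * 1" by (intro mult_left_mono) (use ln_2_less_1 in auto)
  finally have "log_plus y \<le> real J" by (simp add: log_plus_def)
  then have "ennreal (log_plus y) \<le> ennreal (real J)" by (rule ennreal_leI)
  also have "\<dots> = (\<Sum>j<J. if 2 ^ j < y then 1 else 0)"
    using less by (simp add: ennreal_of_nat_eq_real_of_nat)
  also have "\<dots> \<le> (\<Sum>j. if 2 ^ j < y then 1 else 0)" by (rule sum_le_suminf) auto
  finally show ?thesis .
next
  case False
  then have "log_plus y = 0" using assms by (simp add: log_plus_altdef max_def)
  then show ?thesis by simp
qed

text \<open>This provides the integrable majorant for the test functions. The constant 4 arises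
  there as 2 / x with x = |1 - w| / 2.\<close>

lemma log_plus_distance_integral_finite:
  "(\<integral>\<^sup>+ w. ennreal (log_plus (4 / norm (1 - w))) \<partial>circle_measure) < \<infinity>"
proof -
  have "(\<integral>\<^sup>+ w. ennreal (log_plus (4 / norm (1 - w))) \<partial>circle_measure)
      \<le> (\<integral>\<^sup>+ w. (\<Sum>j. indicator (ball 1 (4 / 2 ^ j)) w) \<partial>circle_measure)"
  proof (rule nn_integral_mono)
    fix w :: complex
    have "ennreal (log_plus (4 / norm (1 - w))) \<le> (\<Sum>j. if 2 ^ j < 4 / norm (1 - w) then 1 else 0)"
      by (rule log_plus_le_count) simp
    also have "\<dots> \<le> (\<Sum>j. indicator (ball 1 (4 / 2 ^ j)) w)"
    proof (intro suminf_le)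
      fix j :: nat
      show "(if 2 ^ j < 4 / norm (1 - w) then 1 else 0) \<le> (indicator (ball 1 (4 / 2 ^ j)) w :: ennreal)"
      proof (cases "2 ^ j < 4 / norm (1 - w)")
        case True
        have "norm (1 - w) < 4 / 2 ^ j"
        proof (cases "w = 1")
          case False
          then show ?thesis using True by (simp add: field_simps)
        qed simp
        then show ?thesis using True by (simp add: dist_norm)
      qed simp
    qed auto
    finally show "ennreal (log_plus (4 / norm (1 - w))) \<le> (\<Sum>j. indicator (ball 1 (4 / 2 ^ j)) w)" .
  qed
  also have "\<dots> = (\<Sum>j. \<integral>\<^sup>+ w. indicator (ball 1 (4 / 2 ^ j)) w \<partial>circle_measure)"
    by (rule nn_integral_suminf) (rule ball_measurable_circle)
  also have "\<dots> \<le> (\<Sum>j. ennreal (8 * (1 / 2) ^ j))"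
  proof (intro suminf_le)
    fix j :: nat
    have "(\<integral>\<^sup>+ w. indicator (ball 1 (4 / 2 ^ j)) w \<partial>circle_measure)
        = (\<integral>\<^sup>+ w. indicator (sphere 0 1 \<inter> ball 1 (4 / 2 ^ j)) w \<partial>circle_measure)"
      by (rule nn_integral_cong) (auto split: split_indicator)
    also have "\<dots> = emeasure circle_measure (sphere 0 1 \<inter> ball 1 (4 / 2 ^ j))"
      by (rule nn_integral_indicator) (auto simp: sets_circle_measure sets_restrict_space)
    also have "\<dots> \<le> ennreal (2 * (4 / 2 ^ j))" by (rule emeasure_circle_ball_le) auto
    finally show "(\<integral>\<^sup>+ w. indicator (ball 1 (4 / 2 ^ j)) w \<partial>circle_measure) \<le> ennreal (8 * (1 / 2) ^ j)"
      by (simp add: power_divide)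
  qed auto
  also have "\<dots> = ennreal (\<Sum>j. 8 * (1 / 2) ^ j)"
    by (rule suminf_ennreal2) (auto intro!: summable_mult summable_geometric)
  finally show ?thesis by (rule le_less_trans) simp
qed

text \<open>At the point 1, where the kernels concentrate, the estimates break down; it is discarded
  almost everywhere.\<close>

lemma circle_singleton_null: "{1} \<in> null_sets circle_measure"
proof -
  have s: "{1} \<in> sets circle_measure" by (auto simp: sets_circle_measure sets_restrict_space intro!: image_eqI[of _ _ "{1}"])
  have "emeasure circle_measure {1} \<le> ennreal (2 * (1 / real (Suc n)))" for n
  proof -
    have "emeasure circle_measure {1} \<le> emeasure circle_measure (sphere 0 1 \<inter> ball 1 (1 / real (Suc n)))"
      by (rule emeasure_mono) (auto simp: sets_circle_measure sets_restrict_space)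
    also have "\<dots> \<le> ennreal (2 * (1 / real (Suc n)))" by (rule emeasure_circle_ball_le) auto
    finally show ?thesis .
  qed
  moreover have "(\<lambda>n. ennreal (2 * (1 / real (Suc n)))) \<longlonglongrightarrow> ennreal (2 * 0)"
    by (intro tendsto_ennrealI tendsto_intros LIMSEQ_Suc lim_1_over_n)
  ultimately have "emeasure circle_measure {1} \<le> ennreal (2 * 0)"
    by (intro LIMSEQ_le_const) auto
  then show ?thesis using s by (simp add: null_sets_def)
qed

section \<open>Sums of kernels: boundary values, Smirnov class, rearrangement\<close>

definition kernel_radius :: "nat \<Rightarrow> real" where
  "kernel_radius n = 1 - (1 / 2) ^ n"

lemma kernel_radius: "0 \<le> kernel_radius n" "kernel_radius n < 1" "kernel_radius n \<le> 1"
  by (auto simp: kernel_radius_def power_le_one)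

lemma kernel_nonzero:
  fixes z :: complex
  assumes "norm z < 1 \<or> (norm z \<le> 1 \<and> z \<noteq> 1)"
  shows "1 - of_real (kernel_radius n) * z \<noteq> 0"
proof -
  have "norm z \<le> 1" "0 < norm (1 - z)" using assms by auto
  then have "0 < norm (1 - of_real (kernel_radius n) * z)"
    using norm_one_minus_ge(2)[OF _ kernel_radius(1,3), of z n] by linarith
  then show ?thesis by auto
qed

definition kernel_sum :: "nat \<Rightarrow> (nat \<Rightarrow> real) \<Rightarrow> complex \<Rightarrow> complex" where
  "kernel_sum m d z = (\<Sum>n. of_real (d n) / (1 - of_real (kernel_radius n) * z) ^ Suc m)"

text \<open>The n-th kernel is at most 2^(n(m+1)), because 1 - r_n = 2^-n, and at most (2/x)^(m+1)
  at distance x from 1. Taking the smaller bound term by term gives a radial majorant, so superlevel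
  sets lie in arcs around 1.\<close>

definition kernel_envelope :: "nat \<Rightarrow> (nat \<Rightarrow> real) \<Rightarrow> real \<Rightarrow> real" where
  "kernel_envelope m d x = (\<Sum>n. d n * (min (2 ^ n) (2 / x)) ^ Suc m)"

context
  fixes m :: nat and d :: "nat \<Rightarrow> real"
  assumes d0: "\<And>n. 0 \<le> d n" and dsum: "summable d"
begin

lemma kernel_term_le:
  fixes z :: complex
  assumes "norm z \<le> 1" "0 < x" "x \<le> norm (1 - z)"
  shows "norm (of_real (d n) / (1 - of_real (kernel_radius n) * z) ^ Suc m) \<le> d n * (min (2 ^ n) (2 / x)) ^ Suc m"
proof -
  let ?u = "norm (1 - of_real (kernel_radius n) * z)"
  have u1: "(1 / 2) ^ n \<le> ?u"
    using norm_one_minus_ge(1)[OF assms(1) kernel_radius(1,3), of n] by (simp add: kernel_radius_def)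
  have u2: "x / 2 \<le> ?u"
    using norm_one_minus_ge(2)[OF assms(1) kernel_radius(1,3), of n] assms(3) by simp
  have u0: "0 < ?u" using u2 assms(2) by linarith
  have "1 / ?u \<le> 1 / (1 / 2) ^ n"
    by (rule divide_left_mono[OF u1]) (use u0 in simp_all)
  moreover have "1 / ?u \<le> 1 / (x / 2)"
    by (rule divide_left_mono[OF u2]) (use u0 assms(2) in simp_all)
  ultimately have "1 / ?u \<le> 2 ^ n" "1 / ?u \<le> 2 / x" by (simp_all add: power_divide)
  then have "1 / ?u \<le> min (2 ^ n) (2 / x)" by simp
  then have "(1 / ?u) ^ Suc m \<le> (min (2 ^ n) (2 / x)) ^ Suc m" by (intro power_mono) auto
  then have "d n * (1 / ?u) ^ Suc m \<le> d n * (min (2 ^ n) (2 / x)) ^ Suc m" by (rule mult_left_mono) (rule d0)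
  then show ?thesis using d0[of n] by (simp add: norm_divide norm_power norm_mult power_divide)
qed

lemma kernel_envelope_summable:
  assumes "0 < x"
  shows "summable (\<lambda>n. d n * (min (2 ^ n) (2 / x)) ^ Suc m)"
proof (rule summable_comparison_test'[OF summable_mult2[OF dsum, of "(2 / x) ^ Suc m"]])
  fix n
  have "(min (2 ^ n) (2 / x)) ^ Suc m \<le> (2 / x) ^ Suc m" using assms by (intro power_mono) auto
  moreover have "0 \<le> (min (2 ^ n) (2 / x)) ^ Suc m" using assms by (intro zero_le_power) auto
  ultimately show "norm (d n * (min (2 ^ n) (2 / x)) ^ Suc m) \<le> d n * (2 / x) ^ Suc m"
    using d0[of n] by (simp add: abs_mult mult_left_mono del: power_Suc)
qed

lemma kernel_envelope_nonneg: "0 < x \<Longrightarrow> 0 \<le> kernel_envelope m d x"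
  unfolding kernel_envelope_def
  by (intro suminf_nonneg kernel_envelope_summable mult_nonneg_nonneg d0 zero_le_power) auto

lemma kernel_envelope_le:
  assumes "0 < x"
  shows "kernel_envelope m d x \<le> (2 / x) ^ Suc m * (\<Sum>n. d n)"
proof -
  have "kernel_envelope m d x \<le> (\<Sum>n. (2 / x) ^ Suc m * d n)"
    unfolding kernel_envelope_def
  proof (rule suminf_le[OF _ kernel_envelope_summable[OF assms] summable_mult[OF dsum]])
    fix n
    have "(min (2 ^ n) (2 / x)) ^ Suc m \<le> (2 / x) ^ Suc m" using assms by (intro power_mono) auto
    then show "d n * (min (2 ^ n) (2 / x)) ^ Suc m \<le> (2 / x) ^ Suc m * d n"
      using d0[of n] by (simp add: mult.commute[of _ "d n"] mult_left_mono del: power_Suc)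
  qed
  then show ?thesis by (simp add: suminf_mult[OF dsum] del: power_Suc)
qed

lemma kernel_sum_le:
  assumes "norm z \<le> 1" "0 < x" "x \<le> norm (1 - z)"
  shows "norm (kernel_sum m d z) \<le> kernel_envelope m d x"
  unfolding kernel_sum_def kernel_envelope_def
  by (rule norm_suminf_le[OF kernel_term_le[OF assms] kernel_envelope_summable[OF assms(2)]])

lemma kernel_sum_uniform_limit:
  assumes "0 < x"
  shows "uniform_limit {z. norm z \<le> 1 \<and> x \<le> norm (1 - z)}
    (\<lambda>N z. \<Sum>n<N. of_real (d n) / (1 - of_real (kernel_radius n) * z) ^ Suc m) (kernel_sum m d) sequentially"
  unfolding kernel_sum_def
  by (rule Weierstrass_m_test[OF _ kernel_envelope_summable[OF assms]]) (use kernel_term_le assms in blast)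

lemma kernel_sum_holomorphic: "kernel_sum m d holomorphic_on ball 0 1"
proof (rule holomorphic_uniform_sequence)
  show "(\<lambda>z. \<Sum>n<N. of_real (d n) / (1 - of_real (kernel_radius n) * z) ^ Suc m) holomorphic_on ball 0 1" for N
    by (intro holomorphic_intros) (use kernel_nonzero in auto)
  fix x :: complex assume "x \<in> ball 0 1"
  then have x: "norm x < 1" by simp
  define e where "e = (1 - norm x) / 2"
  have e: "0 < e" using x by (simp add: e_def)
  have nz: "norm z \<le> 1 - e" if "z \<in> cball x e" for z
  proof -
    have "norm (z - x) \<le> e" using that by (simp add: dist_norm norm_minus_commute)
    moreover have "norm z \<le> norm x + norm (z - x)" using norm_triangle_ineq[of x "z - x"] by simp
    moreover have "2 * e = 1 - norm x" by (simp add: e_def)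
    ultimately show ?thesis by linarith
  qed
  have sub: "cball x e \<subseteq> {z. norm z \<le> 1 \<and> e \<le> norm (1 - z)}"
  proof
    fix z assume "z \<in> cball x e"
    from nz[OF this] show "z \<in> {z. norm z \<le> 1 \<and> e \<le> norm (1 - z)}"
      using norm_triangle_ineq2[of 1 z] e by auto
  qed
  have "cball x e \<subseteq> ball 0 1" using nz e by force
  moreover have "uniform_limit (cball x e) (\<lambda>N z. \<Sum>n<N. of_real (d n) / (1 - of_real (kernel_radius n) * z) ^ Suc m) (kernel_sum m d) sequentially"
    by (rule uniform_limit_on_subset[OF kernel_sum_uniform_limit[OF e] sub])
  ultimately show "\<exists>e. 0 < e \<and> cball x e \<subseteq> ball 0 1 \<and> uniform_limit (cball x e) (\<lambda>N z. \<Sum>n<N. of_real (d n) / (1 - of_real (kernel_radius n) * z) ^ Suc m) (kernel_sum m d) sequentially"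
    using e by blast
qed simp

text \<open>The series converges uniformly on the closed disk minus a neighbourhood of 1. There
  \<open>kernel_sum\<close> is continuous up to the circle, and its nontangential limits are its own
  values.\<close>

lemma kernel_sum_nontangential:
  assumes \<zeta>: "norm \<zeta> = 1" "\<zeta> \<noteq> 1"
  shows "has_nontangential_limit (kernel_sum m d) \<zeta> (kernel_sum m d \<zeta>)"
proof -
  define e where "e = norm (1 - \<zeta>) / 2"
  have e: "0 < e" using \<zeta> by (simp add: e_def)
  let ?S = "{z::complex. norm z \<le> 1 \<and> e \<le> norm (1 - z)}"
  have "continuous_on ?S (kernel_sum m d)"
  proof (rule uniform_limit_theorem[OF _ kernel_sum_uniform_limit[OF e]])
    have "continuous_on ?S (\<lambda>z. \<Sum>n<N. of_real (d n) / (1 - of_real (kernel_radius n) * z) ^ Suc m)" for N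
    proof (intro continuous_intros ballI)
      fix n and z :: complex assume "z \<in> ?S"
      then have "norm z < 1 \<or> (norm z \<le> 1 \<and> z \<noteq> 1)" using e by auto
      then show "(1 - of_real (kernel_radius n) * z) ^ Suc m \<noteq> 0" using kernel_nonzero by simp
    qed
    then show "\<forall>\<^sub>F N in sequentially. continuous_on ?S (\<lambda>z. \<Sum>n<N. of_real (d n) / (1 - of_real (kernel_radius n) * z) ^ Suc m)"
      by simp
  qed simp
  moreover have "\<zeta> \<in> ?S" using \<zeta> by (simp add: e_def)
  ultimately have lim: "(kernel_sum m d \<longlongrightarrow> kernel_sum m d \<zeta>) (at \<zeta> within ?S)"
    by (simp add: continuous_on_def)
  show ?thesis
    unfolding has_nontangential_limit_def Lim_within
  proof (intro allI impI)
    fix M \<epsilon> :: real assume "0 < \<epsilon>"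
    then obtain r where r: "0 < r" "\<And>z. z \<in> ?S \<Longrightarrow> 0 < dist z \<zeta> \<and> dist z \<zeta> < r \<Longrightarrow> dist (kernel_sum m d z) (kernel_sum m d \<zeta>) < \<epsilon>"
      using lim unfolding Lim_within by blast
    have "dist (kernel_sum m d z) (kernel_sum m d \<zeta>) < \<epsilon>"
      if z: "z \<in> stolz_region M \<zeta>" "0 < dist z \<zeta>" "dist z \<zeta> < min r e" for z
    proof (rule r(2))
      have "norm (1 - \<zeta>) \<le> norm (1 - z) + dist z \<zeta>"
        using norm_triangle_ineq[of "1 - z" "z - \<zeta>"] by (simp add: dist_norm)
      then have "e \<le> norm (1 - z)" using z(3) by (simp add: e_def)
      then show "z \<in> ?S" using z(1) by (simp add: stolz_region_def)
      show "0 < dist z \<zeta> \<and> dist z \<zeta> < r" using z by simp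
    qed
    then show "\<exists>r>0. \<forall>z\<in>stolz_region M \<zeta>. 0 < dist z \<zeta> \<and> dist z \<zeta> < r \<longrightarrow> dist (kernel_sum m d z) (kernel_sum m d \<zeta>) < \<epsilon>"
      using r(1) e by (intro exI[of _ "min r e"]) auto
  qed
qed

lemma kernel_sum_boundary:
  assumes "norm \<zeta> = 1" "\<zeta> \<noteq> 1"
  shows "boundary_fun (kernel_sum m d) \<zeta> = kernel_sum m d \<zeta>"
  by (rule boundary_fun_eq[OF kernel_sum_nontangential[OF assms] assms(1)])

lemma kernel_sum_log_plus_bound:
  assumes w: "norm w = 1" "w \<noteq> 1" and r: "0 \<le> r" "r < 1"
  shows "log_plus (norm (kernel_sum m d (of_real r * w)))
    \<le> log_plus (\<Sum>n. d n) + real (Suc m) * log_plus (4 / norm (1 - w))"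
proof -
  define x where "x = norm (1 - w) / 2"
  have x: "0 < x" using w by (simp add: x_def)
  have "norm (kernel_sum m d (of_real r * w)) \<le> kernel_envelope m d x"
  proof (rule kernel_sum_le[OF _ x])
    show "norm (of_real r * w) \<le> 1" using w r by (simp add: norm_mult)
    show "x \<le> norm (1 - of_real r * w)"
      unfolding x_def by (rule norm_one_minus_ge(2)) (use w r in auto)
  qed
  also have "\<dots> \<le> (2 / x) ^ Suc m * (\<Sum>n. d n)" by (rule kernel_envelope_le[OF x])
  also have "2 / x = 4 / norm (1 - w)" by (simp add: x_def)
  also have "(4 / norm (1 - w)) ^ Suc m * (\<Sum>n. d n)
      \<le> exp (log_plus (4 / norm (1 - w))) ^ Suc m * exp (log_plus (\<Sum>n. d n))"
    by (intro mult_mono power_mono le_exp_log_plus suminf_nonneg dsum d0) auto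
  also have "\<dots> = exp (log_plus (\<Sum>n. d n) + real (Suc m) * log_plus (4 / norm (1 - w)))"
    by (simp only: exp_of_nat_mult[symmetric] exp_add mult.commute)
  finally show ?thesis
    by (intro log_plus_le) (auto intro!: add_nonneg_nonneg mult_nonneg_nonneg log_plus_nonneg)
qed

text \<open>One integrable majorant \<open>H\<close> of log^+ |f(r w)|, valid for all r, gives the
  Nevanlinna bound and, by dominated convergence, the Smirnov limit.\<close>

lemma kernel_sum_smirnov: "kernel_sum m d \<in> smirnov_class"
proof -
  let ?f = "kernel_sum m d"
  define H where "H w = ennreal (log_plus (\<Sum>n. d n) + real (Suc m) * log_plus (4 / norm (1 - w)))" for w :: complex
  have Hm [measurable]: "H \<in> borel_measurable circle_measure"
    unfolding H_def by measurable
  have ae1: "AE w in circle_measure. w \<noteq> 1"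
    using AE_not_in[OF circle_singleton_null] by simp
  have Hfin: "(\<integral>\<^sup>+ w. H w \<partial>circle_measure) < \<infinity>"
  proof -
    have m4: "(\<lambda>w. ennreal (log_plus (4 / norm (1 - w)))) \<in> borel_measurable circle_measure" by measurable
    have "(\<integral>\<^sup>+ w. H w \<partial>circle_measure)
        = (\<integral>\<^sup>+ w. ennreal (log_plus (\<Sum>n. d n)) + ennreal (real (Suc m)) * ennreal (log_plus (4 / norm (1 - w))) \<partial>circle_measure)"
      unfolding H_def by (rule nn_integral_cong) (simp add: log_plus_nonneg ennreal_mult ennreal_plus del: of_nat_Suc)
    also have "\<dots> = ennreal (log_plus (\<Sum>n. d n)) + ennreal (real (Suc m)) * (\<integral>\<^sup>+ w. ennreal (log_plus (4 / norm (1 - w))) \<partial>circle_measure)"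
      using m4 circle.emeasure_space_1 by (simp add: nn_integral_add nn_integral_cmult del: of_nat_Suc)
    also have "\<dots> < \<infinity>"
      using log_plus_distance_integral_finite by (simp add: ennreal_mult_less_top del: of_nat_Suc)
    finally show ?thesis .
  qed
  have bound: "AE w in circle_measure. ennreal (log_plus (norm (?f (of_real r * w)))) \<le> H w" if "0 \<le> r" "r < 1" for r
    using ae1 AE_space
  proof eventually_elim
    case (elim w)
    then show ?case unfolding H_def by (intro ennreal_leI kernel_sum_log_plus_bound that) auto
  qed
  have rm: "(\<lambda>w. ennreal (log_plus (norm (?f (of_real r * w))))) \<in> borel_measurable circle_measure" if "0 \<le> r" "r < 1" for r
  proof -
    have "continuous_on (sphere 0 1) (\<lambda>w. log_plus (norm (?f (of_real r * w))))"
      by (intro continuous_intros dilate_holomorphic(3)[OF kernel_sum_holomorphic that])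
    then show ?thesis by (intro measurable_compose[OF _ measurable_ennreal] continuous_on_sphere_measurable)
  qed
  have N: "?f \<in> nevanlinna_class"
  proof -
    have "(SUP r\<in>{0..<1::real}. log_plus_integral (\<lambda>z. ?f (complex_of_real r * z))) \<le> (\<integral>\<^sup>+ w. H w \<partial>circle_measure)"
      unfolding log_plus_integral_def by (intro SUP_least nn_integral_mono_AE bound) auto
    then have "(SUP r\<in>{0..<1::real}. log_plus_integral (\<lambda>z. ?f (complex_of_real r * z))) < \<infinity>"
      using Hfin by (rule le_less_trans)
    then show ?thesis using kernel_sum_holomorphic by (simp add: nevanlinna_class_def)
  qed
  have [measurable]: "boundary_fun ?f \<in> borel_measurable circle_measure"
    by (rule boundary_fun_measurable[OF kernel_sum_holomorphic])
  have "((\<lambda>r. log_plus_integral (\<lambda>z. ?f (complex_of_real r * z))) \<longlongrightarrow> log_plus_integral (boundary_fun ?f)) (at_left (1::real))"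
  proof (rule tendsto_at_left_sequentially[of 0])
    fix S :: "nat \<Rightarrow> real"
    assume S: "\<And>n. S n < 1" "\<And>n. 0 < S n" and lim: "S \<longlonglongrightarrow> 1"
    have fl: "filterlim S (at_left 1) sequentially"
      by (rule tendsto_imp_filterlim_at_left[OF lim]) (use S in auto)
    show "(\<lambda>n. log_plus_integral (\<lambda>z. ?f (complex_of_real (S n) * z))) \<longlonglongrightarrow> log_plus_integral (boundary_fun ?f)"
      unfolding log_plus_integral_def
    proof (rule nn_integral_dominated_convergence[where w = H])
      show "(\<lambda>w. ennreal (log_plus (norm (?f (complex_of_real (S n) * w))))) \<in> borel_measurable circle_measure" for n
        by (rule rm) (use S[of n] in auto)
      show "AE w in circle_measure. ennreal (log_plus (norm (?f (complex_of_real (S n) * w)))) \<le> H w" for n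
        by (rule bound) (use S(1)[of n] S(2)[of n] in auto)
      show "AE w in circle_measure. (\<lambda>n. ennreal (log_plus (norm (?f (complex_of_real (S n) * w)))))
          \<longlonglongrightarrow> ennreal (log_plus (norm (boundary_fun ?f w)))"
        using ae1 AE_space
      proof eventually_elim
        case (elim w)
        then have w: "norm w = 1" "w \<noteq> 1" by auto
        have "(\<lambda>n. ?f (complex_of_real (S n) * w)) \<longlonglongrightarrow> boundary_fun ?f w"
          unfolding kernel_sum_boundary[OF w]
          by (rule filterlim_compose[OF has_nontangential_limit_radial[OF kernel_sum_nontangential[OF w] w(1)] fl])
        then show ?case by (intro tendsto_ennrealI tendsto_log_plus)
      qed
    qed (use Hfin in auto)
  qed simp
  with N show ?thesis by (simp add: smirnov_class_def)
qed

text \<open>Where |1 - z| >= s/2 the function is at most the envelope at s/2, and the remaining arc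
  has measure at most s by \<open>emeasure_circle_ball_le\<close>.\<close>

lemma kernel_sum_rearrangement_le:
  assumes s: "0 < s"
  shows "decreasing_rearrangement (boundary_fun (kernel_sum m d)) s \<le> kernel_envelope m d (s / 2)"
  unfolding decreasing_rearrangement_def
proof (rule cInf_lower)
  let ?g = "boundary_fun (kernel_sum m d)" and ?x = "s / 2"
  have x: "0 < ?x" using s by simp
  have "{z \<in> space circle_measure. kernel_envelope m d ?x < norm (?g z)} \<subseteq> sphere 0 1 \<inter> ball 1 ?x"
  proof
    fix z assume z: "z \<in> {z \<in> space circle_measure. kernel_envelope m d ?x < norm (?g z)}"
    then have n: "norm z = 1" by simp
    have "norm (1 - z) < ?x"
    proof (rule ccontr)
      assume "\<not> norm (1 - z) < ?x"
      then have "?x \<le> norm (1 - z)" by simp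
      moreover from this have "z \<noteq> 1" using x by auto
      ultimately have "norm (?g z) \<le> kernel_envelope m d ?x"
        using kernel_sum_le[of z ?x] n x by (simp add: kernel_sum_boundary)
      then show False using z by simp
    qed
    then show "z \<in> sphere 0 1 \<inter> ball 1 ?x" using n by (simp add: dist_norm)
  qed
  then have "measure circle_measure {z \<in> space circle_measure. kernel_envelope m d ?x < norm (?g z)}
      \<le> measure circle_measure (sphere 0 1 \<inter> ball 1 ?x)"
    by (rule circle.finite_measure_mono) (auto simp: sets_circle_measure sets_restrict_space)
  also have "\<dots> \<le> 2 * ?x"
    using emeasure_circle_ball_le[of 1 ?x] x by (simp add: circle.emeasure_eq_measure)
  finally show "kernel_envelope m d ?x \<in> {t. 0 \<le> t \<and> distribution_fun ?g t \<le> s}"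
    using kernel_envelope_nonneg[OF x] by (simp add: distribution_fun_def)
  show "bdd_below {t. 0 \<le> t \<and> distribution_fun ?g t \<le> s}" by (rule bdd_belowI[of _ 0]) auto
qed

end

section \<open>Coefficients of kernel sums, and test sequences\<close>

text \<open>The coefficient a k is the limit of sums of nonnegative terms t n k, so it dominates the
  single term whose n is the index of the block of k. In that term the binomial coefficient is at
  least ((m + k) / m)^m, at least of order 2^(n m), and r_n^k is at least 1/4.\<close>

lemma kernel_sum_coefficients:
  fixes m :: nat and d :: "nat \<Rightarrow> real"
  assumes d0: "\<And>n. 0 \<le> d n" and dsum: "summable d" and m: "1 \<le> m"
  obtains a where "\<And>z. norm z < 1 \<Longrightarrow> (\<lambda>n. a n * z ^ n) sums kernel_sum m d z"
    "\<And>n k. k \<in> dyadic_block n \<Longrightarrow> (1 / (2 * real m)) ^ m / 4 * (d n * (2 ^ n) ^ m) \<le> norm (a k)"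
proof -
  note hol = kernel_sum_holomorphic[OF d0 dsum, where m = m]
  obtain a where a: "\<And>z. norm z < 1 \<Longrightarrow> (\<lambda>n. a n * z ^ n) sums kernel_sum m d z"
    using power_series_on_disk[OF hol] by blast
  define t where "t n k = d n * real (m + k choose m) * kernel_radius n ^ k" for n k
  have t0: "0 \<le> t n k" for n k using d0[of n] kernel_radius(1)[of n] by (simp add: t_def)
  define A where "A N k = (\<Sum>n<N. t n k)" for N k
  define F where "F N z = (\<Sum>n<N. of_real (d n) / (1 - of_real (kernel_radius n) * z) ^ Suc m)" for N and z :: complex
  have Fhol: "F N holomorphic_on ball 0 1" for N
    unfolding F_def by (intro holomorphic_intros) (use kernel_nonzero in auto)
  have Fs: "(\<lambda>k. of_real (A N k) * z ^ k) sums F N z" if z: "norm z < 1" for N z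
  proof -
    have "(\<lambda>k. of_real (t n k) * z ^ k) sums (of_real (d n) / (1 - of_real (kernel_radius n) * z) ^ Suc m)" for n
    proof -
      have "kernel_radius n * norm z \<le> norm z"
        using kernel_radius[of n] by (simp add: mult_left_le_one_le)
      then have "norm (of_real (kernel_radius n) * z) < 1"
        using z kernel_radius(1)[of n] by (simp add: norm_mult)
      from sums_mult[OF negative_binomial_sums[OF this, of m], of "of_real (d n)"]
      show ?thesis by (simp add: t_def power_mult_distrib mult_ac del: power_Suc)
    qed
    then have "(\<lambda>k. \<Sum>n<N. of_real (t n k) * z ^ k) sums F N z"
      unfolding F_def by (rule sums_sum)
    then show ?thesis by (simp add: A_def sum_distrib_right)
  qed
  have lim: "(\<lambda>N. complex_of_real (A N k)) \<longlonglongrightarrow> a k" for k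
  proof (rule LIMSEQ_I)
    fix \<epsilon> :: real assume \<epsilon>: "0 < \<epsilon>"
    \<comment> \<open>Comparison on the circle of radius 1/2 costs a factor 2^k in the k-th
      coefficient; the further halving makes the final inequality strict.\<close>
    define e where "e = \<epsilon> * (1 / 2) ^ k / 2"
    have e: "0 < e" using \<epsilon> by (simp add: e_def)
    obtain N0 where N0: "\<And>N z. N \<ge> N0 \<Longrightarrow> norm z \<le> 1 \<Longrightarrow> 1 / 2 \<le> norm (1 - z) \<Longrightarrow> dist (F N z) (kernel_sum m d z) < e"
      using kernel_sum_uniform_limit[OF d0 dsum, of "1 / 2", where m = m] e
      unfolding uniform_limit_iff eventually_sequentially F_def by fastforce
    have "norm (complex_of_real (A N k) - a k) < \<epsilon>" if N: "N \<ge> N0" for N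
    proof -
      have "norm (a k - of_real (A N k)) * (1 / 2) ^ k
          \<le> (\<integral>w. norm (kernel_sum m d (of_real (1 / 2) * w) - F N (of_real (1 / 2) * w)) \<partial>circle_measure)"
      proof (rule coefficient_le_integral_mean)
        show "(\<lambda>n. (a n - of_real (A N n)) * z ^ n) sums (kernel_sum m d z - F N z)" if "norm z < 1" for z
          using sums_diff[OF a[OF that] Fs[OF that]] by (simp add: left_diff_distrib)
        show "(\<lambda>z. kernel_sum m d z - F N z) holomorphic_on ball 0 1"
          by (intro holomorphic_intros hol Fhol)
      qed auto
      also have "\<dots> \<le> (\<integral>w. e \<partial>circle_measure)"
      proof (rule integral_mono')
        fix w assume "w \<in> space circle_measure"
        then have w: "norm w = 1" by simp
        let ?z = "of_real (1 / 2) * w"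
        have nz: "norm ?z = 1 / 2" using w by (simp add: norm_mult del: of_real_divide)
        have "1 / 2 \<le> norm (1 - ?z)" using norm_triangle_ineq2[of 1 ?z] nz by simp
        then have "dist (F N ?z) (kernel_sum m d ?z) < e" using N0[OF N, of ?z] nz by simp
        then show "norm (kernel_sum m d ?z - F N ?z) \<le> e" by (simp add: dist_norm norm_minus_commute)
      qed (use e in auto)
      finally have "norm (a k - of_real (A N k)) * (1 / 2) ^ k \<le> e" using circle.prob_space by simp
      also have "e < \<epsilon> * (1 / 2) ^ k" using \<epsilon> by (simp add: e_def)
      finally have "norm (a k - of_real (A N k)) < \<epsilon>" by simp
      then show ?thesis by (simp add: norm_minus_commute)
    qed
    then show "\<exists>N0. \<forall>N\<ge>N0. norm (complex_of_real (A N k) - a k) < \<epsilon>" by blast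
  qed
  show ?thesis
  proof (rule that[OF a])
    fix n k assume k: "k \<in> dyadic_block n"
    have "(1 / (2 * real m)) ^ m / 4 * (d n * (2 ^ n) ^ m) \<le> t n k"
    proof -
      have mk: "2 ^ n / 2 \<le> real (m + k)"
      proof (cases "n = 0")
        case False
        then obtain i where i: "n = Suc i" by (cases n) auto
        then have "2 ^ i \<le> k" using k by (simp add: dyadic_block_def)
        then have "2 ^ i \<le> m + k" by simp
        then have le: "real (2 ^ i) \<le> real (m + k)" by (simp only: of_nat_le_iff)
        have "2 ^ n / 2 = real (2 ^ i)" using i by simp
        then show ?thesis using le by (simp only:)
      qed (use m in simp)
      have "(2 ^ n / 2 / real m) ^ m \<le> (real (m + k) / real m) ^ m"
        using mk m by (intro power_mono divide_right_mono) auto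
      also have "\<dots> \<le> real (m + k choose m)"
        by (rule binomial_ge_n_over_k_pow_k) simp
      finally have 1: "(2 ^ n / 2 / real m) ^ m \<le> real (m + k choose m)" .
      have 2: "1 / 4 \<le> kernel_radius n ^ k"
      proof (cases "n = 0")
        case True
        then show ?thesis using k by (simp add: dyadic_block_def)
      next
        case False
        then show ?thesis using dyadic_power_ge[OF _ k] by (simp add: kernel_radius_def)
      qed
      have "d n * ((2 ^ n / 2 / real m) ^ m * (1 / 4)) \<le> d n * (real (m + k choose m) * kernel_radius n ^ k)"
        by (intro mult_left_mono mult_mono 1 2 d0) auto
      moreover have "(2 ^ n / 2 / real m) ^ m = (1 / (2 * real m)) ^ m * (2 ^ n) ^ m"
        by (simp add: power_mult_distrib[symmetric])
      ultimately show ?thesis by (simp add: t_def mult_ac)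
    qed
    moreover have "t n k \<le> norm (a k)"
    proof (rule LIMSEQ_le_const[OF tendsto_norm[OF lim[of k]]])
      have "t n k \<le> norm (complex_of_real (A N k))" if "N \<ge> Suc n" for N
      proof -
        have "t n k \<le> A N k" unfolding A_def using that t0 by (intro member_le_sum) auto
        then show ?thesis by simp
      qed
      then show "\<exists>N0. \<forall>N\<ge>N0. t n k \<le> norm (complex_of_real (A N k))" by blast
    qed
    ultimately show "(1 / (2 * real m)) ^ m / 4 * (d n * (2 ^ n) ^ m) \<le> norm (a k)" by simp
  qed
qed

text \<open>Counterpart of \<open>summable_rearrangement\<close>. For an upper bound the
  rearrangement is taken at the left end of the dyadic interval and s^(1/p) at the right end, whence
  the shift between \<open>Suc j\<close> and \<open>j\<close>. Dividing by the left end, which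
  equals the length, makes each piece contribute exactly the q-th power of E j.\<close>

lemma lorentz_integral_finite:
  fixes g :: "complex \<Rightarrow> complex"
  assumes g: "g \<in> borel_measurable circle_measure" and p: "0 < p" and q: "0 < q"
    and E0: "\<And>j. 0 \<le> E j" and Esum: "summable (\<lambda>j. E j powr q)"
    and le: "\<And>j. decreasing_rearrangement g ((1 / 2) ^ Suc j) * ((1 / 2) powr (1 / p)) ^ j \<le> E j"
  shows "lorentz_integral p q g < \<infinity>"
proof -
  define R where "R = decreasing_rearrangement g"
  define I where "I j = {(1 / 2) ^ Suc j ..< (1 / 2 :: real) ^ j}" for j :: nat
  define c where "c j = E j powr q / (1 / 2) ^ Suc j" for j
  have c0: "0 \<le> c j" for j by (simp add: c_def)
  have "lorentz_integral p q g \<le> (\<integral>\<^sup>+ s. (\<Sum>j. ennreal (c j) * indicator (I j) s) \<partial>lborel)"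
    unfolding lorentz_integral_def
  proof (rule nn_integral_mono)
    fix s :: real
    show "ennreal ((decreasing_rearrangement g s * s powr (1 / p)) powr q / s) * indicator {0<..<1} s
        \<le> (\<Sum>j. ennreal (c j) * indicator (I j) s)"
    proof (cases "0 < s \<and> s < 1")
      case True
      obtain n where "(1 / 2) ^ n < s" using real_arch_pow_inv[of s "1 / 2"] True by auto
      then have ex: "\<exists>n. (1 / 2) ^ n \<le> s" by (auto intro: less_imp_le)
      define k where "k = (LEAST n. (1 / 2) ^ n \<le> s)"
      have k: "(1 / 2) ^ k \<le> s" unfolding k_def using ex by (rule LeastI_ex)
      then have "k \<noteq> 0" using True by (intro notI) simp
      then obtain j where j: "k = Suc j" by (cases k) auto
      then have "j < k" by simp
      then have "\<not> (1 / 2) ^ j \<le> s" unfolding k_def by (rule not_less_Least)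
      then have sj: "s < (1 / 2) ^ j" by simp
      have kj: "(1 / 2) ^ Suc j \<le> s" using k j by simp
      have "R s \<le> R ((1 / 2) ^ Suc j)"
        unfolding R_def by (rule decreasing_rearrangement_antimono[OF g _ kj]) simp
      moreover have "s powr (1 / p) \<le> ((1 / 2) powr (1 / p)) ^ j"
      proof -
        have "s powr (1 / p) \<le> ((1 / 2) ^ j) powr (1 / p)" using True sj p by (intro powr_mono2) auto
        also have "\<dots> = ((1 / 2) powr (1 / p)) ^ j"
          by (simp add: powr_realpow[symmetric] powr_powr mult.commute)
        finally show ?thesis .
      qed
      ultimately have "R s * s powr (1 / p) \<le> R ((1 / 2) ^ Suc j) * ((1 / 2) powr (1 / p)) ^ j"
        using True decreasing_rearrangement_nonneg[OF g, of "(1 / 2) ^ Suc j"]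
        by (intro mult_mono) (auto simp: R_def)
      also have "\<dots> \<le> E j" unfolding R_def by (rule le)
      finally have "(R s * s powr (1 / p)) powr q \<le> E j powr q"
        using True q decreasing_rearrangement_nonneg[OF g, of s] by (intro powr_mono2) (auto simp: R_def)
      then have "(R s * s powr (1 / p)) powr q / s \<le> c j"
        unfolding c_def using kj by (intro frac_le) auto
      then have "ennreal ((R s * s powr (1 / p)) powr q / s) * indicator {0<..<1} s \<le> ennreal (c j) * indicator (I j) s"
        using True kj sj by (simp add: I_def ennreal_leI)
      also have "\<dots> \<le> (\<Sum>j. ennreal (c j) * indicator (I j) s)" by (rule ennreal_le_suminf)
      finally show ?thesis by (simp add: R_def)
    qed auto
  qed
  also have "\<dots> = (\<Sum>j. \<integral>\<^sup>+ s. ennreal (c j) * indicator (I j) s \<partial>lborel)"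
    by (rule nn_integral_suminf) (simp add: I_def)
  also have "\<dots> = (\<Sum>j. ennreal (c j) * emeasure lborel (I j))"
    by (intro suminf_cong nn_integral_cmult_indicator) (simp add: I_def)
  also have "\<dots> = (\<Sum>j. ennreal (E j powr q))"
  proof (rule suminf_cong)
    fix j :: nat
    have "emeasure lborel (I j) = ennreal ((1 / 2) ^ Suc j)" unfolding I_def by simp
    moreover have "c j * (1 / 2) ^ Suc j = E j powr q" by (simp add: c_def)
    ultimately show "ennreal (c j) * emeasure lborel (I j) = ennreal (E j powr q)"
      using c0[of j] by (metis ennreal_mult zero_le_power zero_le_divide_1_iff zero_le_numeral)
  qed
  also have "\<dots> = ennreal (\<Sum>j. E j powr q)" by (rule suminf_ennreal2[OF _ Esum]) simp
  finally show ?thesis by (rule le_less_trans) simp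
qed

text \<open>The choice d n = b n \<rho>3^n gives d n 2^(n(m+1)) = b n 2^(n/p): the n-th kernel has
  this height on an arc of length about 2^-n, hence Lorentz size about b n. Its coefficients on the
  n-th block are then of size d n 2^(n m) = b n 2^(n(1/p-1)).\<close>

theorem hardy_lorentz_test_sequence:
  fixes b :: "nat \<Rightarrow> real"
  assumes p: "0 < p" and q: "0 < q" and b0: "\<And>n. 0 \<le> b n" and bsum: "summable (\<lambda>n. b n powr q)"
  obtains a \<kappa> where "a \<in> coeff_space (hardy_lorentz p q)" "0 < \<kappa>"
    "\<And>n k. k \<in> dyadic_block n \<Longrightarrow> \<kappa> * (b n * (2 powr (1 / p - 1)) ^ n) \<le> norm (a k)"
proof -
  obtain m' :: nat where "1 / p < real m'" using reals_Archimedean2 by blast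
  define m where "m = Suc m'"
  have m: "1 \<le> m" "1 / p < real m" using \<open>1 / p < real m'\<close> by (auto simp: m_def)
  define \<rho>3 where "\<rho>3 = (1 / 2 :: real) powr (real (Suc m) - 1 / p)"
  define \<rho>0 where "\<rho>0 = (1 / 2 :: real) powr (1 / p)"
  have \<rho>3: "0 < \<rho>3" "\<rho>3 < 1" unfolding \<rho>3_def using half_powr_lt_one[of "real (Suc m) - 1 / p"] m by auto
  have \<rho>0: "0 < \<rho>0" "\<rho>0 < 1" unfolding \<rho>0_def using half_powr_lt_one[of "1 / p"] p by auto
  have r1: "\<rho>0 * \<rho>3 * 2 ^ Suc m = 1"
  proof -
    have "\<rho>0 * \<rho>3 = (1 / 2) powr real (Suc m)"
      unfolding \<rho>0_def \<rho>3_def by (simp only: powr_add[symmetric]) simp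
    also have "\<dots> = (1 / 2) ^ Suc m" by (rule powr_realpow) simp
    finally show ?thesis by (simp only: power_mult_distrib[symmetric]) simp
  qed
  have r2: "\<rho>3 * 2 ^ m = 2 powr (1 / p - 1)"
  proof -
    have "\<rho>3 = 2 powr (1 / p - real (Suc m))"
      unfolding \<rho>3_def by (simp add: powr_divide powr_minus_divide[symmetric])
    then have "\<rho>3 * 2 ^ m = 2 powr (1 / p - real (Suc m)) * 2 powr real m" by (simp add: powr_realpow)
    also have "\<dots> = 2 powr (1 / p - 1)" by (simp add: powr_add[symmetric])
    finally show ?thesis .
  qed
  define d where "d n = b n * \<rho>3 ^ n" for n
  have d0: "0 \<le> d n" for n using b0[of n] \<rho>3 by (simp add: d_def)
  obtain B where B: "\<And>j. b j \<le> B" by (rule summable_powr_bounded[OF b0 bsum q]) blast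
  have dsum: "summable d"
  proof (rule summable_comparison_test')
    show "summable (\<lambda>n. B * \<rho>3 ^ n)" using \<rho>3 by (intro summable_mult summable_geometric) simp
    show "norm (d n) \<le> B * \<rho>3 ^ n" for n
      using b0[of n] B[of n] \<rho>3 by (simp add: d_def abs_mult mult_right_mono)
  qed
  let ?f = "kernel_sum m d"
  have bm: "boundary_fun ?f \<in> borel_measurable circle_measure"
    by (rule boundary_fun_measurable[OF kernel_sum_holomorphic[OF d0 dsum]])
  define \<rho> where "\<rho> = max \<rho>0 \<rho>3"
  have \<rho>: "0 < \<rho>" "\<rho> < 1" using \<rho>0 \<rho>3 by (auto simp: \<rho>_def)
  define E where "E j = 8 ^ Suc m * geom_conv \<rho> b j" for j
  note gc = geom_conv[OF b0 bsum q \<rho>]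
  have "lorentz_integral p q (boundary_fun ?f) < \<infinity>"
  proof (rule lorentz_integral_finite[OF bm p q])
    show "0 \<le> E j" for j using gc(2) by (simp add: E_def)
    show "summable (\<lambda>j. E j powr q)"
      unfolding E_def by (rule summable_powr_cmult[OF gc(2) _ gc(3)]) simp
    fix j
    let ?x = "(1 / 2) ^ Suc j / 2 :: real"
    have x: "0 < ?x" by simp
    have x2: "2 / ?x = 8 * 2 ^ j" by (simp add: power_divide)
    have "decreasing_rearrangement (boundary_fun ?f) ((1 / 2) ^ Suc j) \<le> kernel_envelope m d ?x"
      by (rule kernel_sum_rearrangement_le[OF d0 dsum]) simp
    then have "decreasing_rearrangement (boundary_fun ?f) ((1 / 2) ^ Suc j) * \<rho>0 ^ j \<le> \<rho>0 ^ j * kernel_envelope m d ?x"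
      using \<rho>0 by (simp add: mult.commute[of _ "\<rho>0 ^ j"] mult_left_mono)
    also have "\<dots> = (\<Sum>n. \<rho>0 ^ j * (d n * (min (2 ^ n) (2 / ?x)) ^ Suc m))"
      unfolding kernel_envelope_def by (rule suminf_mult[OF kernel_envelope_summable[OF d0 dsum x], symmetric])
    also have "\<dots> \<le> (\<Sum>n. 8 ^ Suc m * (\<rho> ^ nat_dist j n * b n))"
    proof (rule suminf_le)
      fix n
      \<comment> \<open>Here 2 / ?x = 8 * 2^j, because ?x = 2^(-j-2): one halving comes from
        \<open>kernel_sum_rearrangement_le\<close>, the other from the endpoint
        \<open>Suc j\<close>.\<close>
      have "min (2 ^ n) (2 / ?x) \<le> 8 * 2 ^ min n j"
      proof (cases "n \<le> j")
        case True
        have "(2::real) ^ n \<le> 8 * 2 ^ n" by simp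
        then show ?thesis using True by (intro min.coboundedI1) simp
      next
        case False
        then show ?thesis unfolding x2 by (intro min.coboundedI2) simp
      qed
      then have "(min (2 ^ n) (2 / ?x)) ^ Suc m \<le> (8 * 2 ^ min n j) ^ Suc m"
        by (rule power_mono) simp
      then have "\<rho>0 ^ j * (d n * (min (2 ^ n) (2 / ?x)) ^ Suc m) \<le> \<rho>0 ^ j * (d n * (8 * 2 ^ min n j) ^ Suc m)"
        using \<rho>0 d0[of n] by (intro mult_left_mono) auto
      also have "\<dots> = 8 ^ Suc m * (\<rho>0 ^ j * \<rho>3 ^ n * (2 ^ Suc m) ^ min n j * b n)"
      proof -
        have "(8 * 2 ^ min n j :: real) ^ Suc m = 8 ^ Suc m * (2 ^ Suc m) ^ min n j"
          by (simp only: power_mult_distrib power_mult[symmetric] mult.commute[of "min n j"])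
        then show ?thesis by (simp only: d_def mult_ac)
      qed
      \<comment> \<open>By \<open>r1\<close> the factors cancel up to index min n j. What remains is
        \<rho>0^(j-n) for kernels broader than the scale 2^-j and \<rho>3^(n-j) for kernels more
        concentrated than it.\<close>
      also have "\<rho>0 ^ j * \<rho>3 ^ n * (2 ^ Suc m) ^ min n j \<le> \<rho> ^ nat_dist j n"
      proof (cases "n \<le> j")
        case True
        then have "\<rho>0 ^ j = \<rho>0 ^ (j - n) * \<rho>0 ^ n" by (simp add: power_add[symmetric])
        then have "\<rho>0 ^ j * \<rho>3 ^ n * (2 ^ Suc m) ^ min n j = \<rho>0 ^ (j - n) * (\<rho>0 * \<rho>3 * 2 ^ Suc m) ^ n"
          using True by (simp only: power_mult_distrib min_absorb1 mult.assoc)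
        also have "\<dots> = \<rho>0 ^ (j - n)" by (simp only: r1 power_one mult_1_right)
        also have "\<dots> \<le> \<rho> ^ (j - n)" using \<rho>0 by (intro power_mono) (auto simp: \<rho>_def)
        finally show ?thesis using True by (simp add: nat_dist_def)
      next
        case False
        then have "\<rho>3 ^ n = \<rho>3 ^ (n - j) * \<rho>3 ^ j" by (simp add: power_add[symmetric])
        then have "\<rho>0 ^ j * \<rho>3 ^ n * (2 ^ Suc m) ^ min n j = \<rho>3 ^ (n - j) * (\<rho>0 * \<rho>3 * 2 ^ Suc m) ^ j"
          using False by (simp only: power_mult_distrib min_absorb2 nat_le_linear not_le less_imp_le mult_ac)
        also have "\<dots> = \<rho>3 ^ (n - j)" by (simp only: r1 power_one mult_1_right)
        also have "\<dots> \<le> \<rho> ^ (n - j)" using \<rho>3 by (intro power_mono) (auto simp: \<rho>_def)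
        finally show ?thesis using False by (simp add: nat_dist_def)
      qed
      finally show "\<rho>0 ^ j * (d n * (min (2 ^ n) (2 / ?x)) ^ Suc m) \<le> 8 ^ Suc m * (\<rho> ^ nat_dist j n * b n)"
        using b0[of n] by (simp add: mult_left_mono mult_right_mono)
    next
      show "summable (\<lambda>n. \<rho>0 ^ j * (d n * (min (2 ^ n) (2 / ?x)) ^ Suc m))"
        by (rule summable_mult[OF kernel_envelope_summable[OF d0 dsum x]])
      show "summable (\<lambda>n. 8 ^ Suc m * (\<rho> ^ nat_dist j n * b n))"
        by (rule summable_mult[OF gc(1)])
    qed
    also have "\<dots> = E j"
      unfolding E_def geom_conv_def by (rule suminf_mult[OF gc(1)])
    finally show "decreasing_rearrangement (boundary_fun ?f) ((1 / 2) ^ Suc j) * ((1 / 2) powr (1 / p)) ^ j \<le> E j"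
      by (simp only: \<rho>0_def)
  qed
  then have fH: "?f \<in> hardy_lorentz p q"
    using kernel_sum_smirnov[OF d0 dsum] unfolding hardy_lorentz_def lorentz_norm_finite_iff by blast
  obtain a where a: "\<And>z. norm z < 1 \<Longrightarrow> (\<lambda>n. a n * z ^ n) sums ?f z"
    "\<And>n k. k \<in> dyadic_block n \<Longrightarrow> (1 / (2 * real m)) ^ m / 4 * (d n * (2 ^ n) ^ m) \<le> norm (a k)"
    by (rule kernel_sum_coefficients[OF d0 dsum m(1)]) blast
  show ?thesis
  proof (rule that[of a "(1 / (2 * real m)) ^ m / 4"])
    show "a \<in> coeff_space (hardy_lorentz p q)"
      unfolding coeff_space_def by (intro CollectI bexI[OF _ fH] ballI a(1)) simp
    show "0 < (1 / (2 * real m)) ^ m / 4" using m by simp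
    fix n k assume k: "k \<in> dyadic_block n"
    have "(2 powr (1 / p - 1)) ^ n = \<rho>3 ^ n * (2 ^ n) ^ m"
      unfolding r2[symmetric] by (simp only: power_mult_distrib power_mult[symmetric] mult.commute[of n])
    then have "d n * (2 ^ n) ^ m = b n * (2 powr (1 / p - 1)) ^ n"
      by (simp only: d_def mult.assoc)
    then show "(1 / (2 * real m)) ^ m / 4 * (b n * (2 powr (1 / p - 1)) ^ n) \<le> norm (a k)"
      using a(2)[OF k] by simp
  qed
qed

section \<open>Sequence spaces\<close>

lemma dyadic_block_exists: "\<exists>n. k \<in> dyadic_block n"
proof (cases "k = 0")
  case True
  then show ?thesis by (intro exI[of _ 0]) (simp add: dyadic_block_def)
next
  case False
  obtain n where n: "2 ^ n \<le> k" "k < 2 ^ Suc n"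
    using ex_power_ivl1[of 2 k] False by auto
  then show ?thesis by (intro exI[of _ "Suc n"]) (simp add: dyadic_block_def)
qed

lemma finite_dyadic_block: "finite (dyadic_block n)"
  by (simp add: dyadic_block_def)

lemma dyadic_block_nonempty: "dyadic_block n \<noteq> {}"
  by (auto simp: dyadic_block_def intro!: less_imp_neq power_strict_increasing)

text \<open>Block 0 is \<open>{0}\<close>, so the N + 1 blocks with index at most N fill exactly the
  indices below 2^N.\<close>

lemma sum_dyadic_blocks: "(\<Sum>n<Suc N. \<Sum>k\<in>dyadic_block n. u k) = (\<Sum>k<2 ^ N. u k)"
  for u :: "nat \<Rightarrow> real"
proof (induction N)
  case 0
  then show ?case by (simp add: dyadic_block_def)
next
  case (Suc N)
  have "{..<(2::nat) ^ Suc N} = {..<2 ^ N} \<union> dyadic_block (Suc N)"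
    by (auto simp: dyadic_block_def)
  moreover have "{..<(2::nat) ^ N} \<inter> dyadic_block (Suc N) = {}" by (auto simp: dyadic_block_def)
  ultimately have "(\<Sum>k<2 ^ Suc N. u k) = (\<Sum>k<2 ^ N. u k) + (\<Sum>k\<in>dyadic_block (Suc N). u k)"
    by (simp only: sum.union_disjoint finite_lessThan finite_dyadic_block)
  then show ?case using Suc by simp
qed

lemma summable_dyadic_blocks:
  fixes u :: "nat \<Rightarrow> real"
  assumes u: "\<And>k. 0 \<le> u k"
  shows "summable u \<longleftrightarrow> summable (\<lambda>n. \<Sum>k\<in>dyadic_block n. u k)"
proof
  assume s: "summable u"
  show "summable (\<lambda>n. \<Sum>k\<in>dyadic_block n. u k)"
  proof (rule summableI_nonneg_bounded)
    fix N
    have "(\<Sum>n<N. \<Sum>k\<in>dyadic_block n. u k) \<le> (\<Sum>n<Suc N. \<Sum>k\<in>dyadic_block n. u k)"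
      by (simp add: sum_nonneg u)
    also have "\<dots> = (\<Sum>k<2 ^ N. u k)" by (rule sum_dyadic_blocks)
    also have "\<dots> \<le> suminf u" by (rule sum_le_suminf[OF s]) (use u in auto)
    finally show "(\<Sum>n<N. \<Sum>k\<in>dyadic_block n. u k) \<le> suminf u" .
  qed (simp add: sum_nonneg u)
next
  assume s: "summable (\<lambda>n. \<Sum>k\<in>dyadic_block n. u k)"
  show "summable u"
  proof (rule summableI_nonneg_bounded)
    fix N
    have "N < 2 ^ N" by (rule less_exp)
    then have "(\<Sum>k<N. u k) \<le> (\<Sum>k<2 ^ N. u k)" by (intro sum_mono2) (auto simp: u)
    also have "\<dots> = (\<Sum>n<Suc N. \<Sum>k\<in>dyadic_block n. u k)" by (rule sum_dyadic_blocks[symmetric])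
    also have "\<dots> \<le> (\<Sum>n. \<Sum>k\<in>dyadic_block n. u k)"
      by (rule sum_le_suminf[OF s]) (auto simp: sum_nonneg u)
    finally show "(\<Sum>k<N. u k) \<le> (\<Sum>n. \<Sum>k\<in>dyadic_block n. u k)" .
  qed (rule u)
qed

section \<open>Multipliers of nonnegative sequences from l^q into l^s\<close>

lemma unbounded_subsequence:
  fixes \<mu> :: "nat \<Rightarrow> real"
  assumes "\<not> bdd_above (range \<mu>)"
  obtains \<sigma> where "strict_mono \<sigma>" "\<And>i. 4 ^ i \<le> \<mu> (\<sigma> i)"
proof -
  have large: "\<exists>n. N < n \<and> B \<le> \<mu> n" for N :: nat and B
  proof (rule ccontr)
    assume neg: "\<not> ?thesis"
    have "\<mu> n \<le> max B (Max (\<mu> ` {..N}))" for n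
    proof (cases "n \<le> N")
      case True
      then have "\<mu> n \<le> Max (\<mu> ` {..N})" by (intro Max_ge) auto
      then show ?thesis by simp
    next
      case False
      then show ?thesis using neg by (metis le_max_iff_disj linear not_le)
    qed
    then have "bdd_above (range \<mu>)" by (auto intro!: bdd_aboveI)
    with assms show False by simp
  qed
  have "\<exists>f. \<forall>n. 4 ^ n \<le> \<mu> (f n) \<and> f n < f (Suc n)"
  proof (rule dependent_nat_choice)
    show "\<exists>x. 4 ^ 0 \<le> \<mu> x" using large[of 0 "4 ^ 0"] by auto
    show "\<exists>y. 4 ^ Suc n \<le> \<mu> y \<and> x < y" for x n using large[of x "4 ^ Suc n"] by auto
  qed
  then obtain f where f: "\<And>n. 4 ^ n \<le> \<mu> (f n)" "\<And>n. f n < f (Suc n)" by blast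
  have "strict_mono f" using f(2) by (simp add: strict_mono_Suc_iff)
  then show ?thesis using f(1) that by blast
qed

text \<open>Gliding hump: if \<mu> were unbounded, the sequence with values 2^-i at sparse positions
  where \<mu> >= 4^i would be q-summable for every q > 0, while its product with \<mu> grows like
  2^i.\<close>

lemma bounded_multiplier_bound:
  fixes \<mu> :: "nat \<Rightarrow> real"
  assumes q: "0 < q" and \<mu>: "\<And>n. 0 \<le> \<mu> n"
    and bd: "\<And>b. (\<And>n. 0 \<le> b n) \<Longrightarrow> summable (\<lambda>n. b n powr q) \<Longrightarrow> bdd_above (range (\<lambda>n. b n * \<mu> n))"
  shows "bdd_above (range \<mu>)"
proof (rule ccontr)
  assume "\<not> bdd_above (range \<mu>)"
  then obtain \<sigma> where \<sigma>: "strict_mono \<sigma>" "\<And>i. 4 ^ i \<le> \<mu> (\<sigma> i)" by (rule unbounded_subsequence) blast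
  have inj: "inj \<sigma>" using \<sigma>(1) by (rule strict_mono_imp_inj_on)
  define b where "b n = (if n \<in> range \<sigma> then (1 / 2 :: real) ^ inv \<sigma> n else 0)" for n
  have b\<sigma>: "b (\<sigma> i) = (1 / 2) ^ i" for i using inj by (simp add: b_def)
  have "summable (\<lambda>i. b (\<sigma> i) powr q)"
  proof -
    have "b (\<sigma> i) powr q = ((1 / 2) powr q) ^ i" for i
      unfolding b\<sigma> by (simp add: powr_realpow[symmetric] powr_powr mult.commute)
    then show ?thesis using half_powr_lt_one[OF q] by (simp add: summable_geometric)
  qed
  then have "summable (\<lambda>n. b n powr q)"
    by (subst summable_mono_reindex[OF \<sigma>(1), symmetric]) (auto simp: b_def)
  then have "bdd_above (range (\<lambda>n. b n * \<mu> n))" by (intro bd) (auto simp: b_def)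
  then obtain C where C: "\<And>n. b n * \<mu> n \<le> C" by (auto simp: bdd_above_def)
  obtain i where i: "C < 2 ^ i" using real_arch_pow[of 2 C] by auto
  have "(1 / 2) ^ i * 4 ^ i \<le> b (\<sigma> i) * \<mu> (\<sigma> i)"
    unfolding b\<sigma> by (intro mult_left_mono \<sigma>) auto
  also have "\<dots> \<le> C" by (rule C)
  also have "(1 / 2 :: real) ^ i * 4 ^ i = 2 ^ i" by (simp add: power_mult_distrib[symmetric])
  finally show False using i by simp
qed

context
  fixes x :: "nat \<Rightarrow> real"
  assumes x: "\<And>n. 0 \<le> x n" and div: "\<not> summable x"
begin

lemma partial_sums_unbounded: "\<exists>M. B < (\<Sum>i<M. x i)"
proof (rule ccontr)
  assume "\<not> ?thesis"
  then have "summable x" by (intro summableI_nonneg_bounded[of x B]) (use x in \<open>auto simp: not_less\<close>)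
  with div show False by simp
qed

text \<open>With S n the sum of the first n terms, the quotients from N to M - 1 add up to at least
  (S M - S N) / S M, which is at least 1/2 once S M > 2 S N. This contradicts the Cauchy
  criterion.\<close>

lemma abel_dini_divergent: "\<not> summable (\<lambda>n. x n / (\<Sum>i<Suc n. x i))"
proof
  assume "summable (\<lambda>n. x n / (\<Sum>i<Suc n. x i))"
  then obtain N where N: "\<And>m n. N \<le> m \<Longrightarrow> norm (\<Sum>n=m..<n. x n / (\<Sum>i<Suc n. x i)) < 1 / 2"
    unfolding summable_Cauchy by (metis half_gt_zero zero_less_one)
  define S where "S n = (\<Sum>i<n. x i)" for n
  have S0: "0 \<le> S n" for n unfolding S_def by (rule sum_nonneg) (use x in auto)
  have Smono: "S m \<le> S n" if "m \<le> n" for m n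
    unfolding S_def using that x by (intro sum_mono2) auto
  obtain M where M: "2 * S N + 1 < S M" using partial_sums_unbounded[of "2 * S N + 1"] by (auto simp: S_def)
  have SM: "0 < S M" using M S0[of N] by linarith
  have "N \<le> M"
  proof (rule ccontr)
    assume "\<not> N \<le> M"
    then have "S M \<le> S N" by (intro Smono) simp
    then show False using M S0[of N] by linarith
  qed
  then have "S M = S N + (\<Sum>n=N..<M. x n)"
    unfolding S_def by (simp add: sum.atLeastLessThan_concat lessThan_atLeast0)
  then have "1 / 2 \<le> (\<Sum>n=N..<M. x n) / S M" using M SM S0[of N] by (simp add: field_simps)
  also have "\<dots> = (\<Sum>n=N..<M. x n / S M)" by (rule sum_divide_distrib)
  also have "\<dots> \<le> (\<Sum>n=N..<M. x n / S (Suc n))"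
  proof (rule sum_mono)
    fix n assume n: "n \<in> {N..<M}"
    then have le: "S (Suc n) \<le> S M" by (intro Smono) auto
    show "x n / S M \<le> x n / S (Suc n)"
    proof (cases "x n = 0")
      case False
      then have "0 < S (Suc n)" using x[of n] S0[of n] by (simp add: S_def)
      then show ?thesis using le x[of n] SM by (intro divide_left_mono mult_pos_pos)
    qed simp
  qed
  also have "\<dots> \<le> norm (\<Sum>n=N..<M. x n / (\<Sum>i<Suc n. x i))" by (simp add: S_def)
  also have "\<dots> < 1 / 2" by (rule N) simp
  finally show False by simp
qed

text \<open>By the mean value theorem each quotient is at most the increment, between consecutive
  partial sums, of the antiderivative -y^(1-P) / (P-1) of y^(-P). These increments telescope and
  stay bounded, from the first positive partial sum on.\<close>

lemma abel_dini_convergent: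
  assumes P: "1 < P"
  shows "summable (\<lambda>n. x n / (\<Sum>i<Suc n. x i) powr P)"
proof -
  define S where "S n = (\<Sum>i<n. x i)" for n
  have SSuc: "S (Suc n) = S n + x n" for n by (simp add: S_def)
  obtain N where N: "0 < S N" using partial_sums_unbounded[of 0] by (auto simp: S_def)
  have pos: "0 < S (n + N)" for n
  proof -
    have "S N \<le> S (n + N)" unfolding S_def using x by (intro sum_mono2) auto
    then show ?thesis using N by simp
  qed
  define f where "f y = - (y powr (1 - P)) / (P - 1)" for y :: real
  have step: "x n / S (Suc n) powr P \<le> f (S (Suc n)) - f (S n)" if "0 < S n" for n
  proof (cases "x n = 0")
    case True
    then show ?thesis by (simp add: SSuc)
  next
    case False
    then have less: "S n < S (Suc n)" using x[of n] by (simp add: SSuc)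
    have "(f has_real_derivative y powr (- P)) (at y)" if "S n \<le> y" for y
    proof -
      have y: "0 < y" using that \<open>0 < S n\<close> by linarith
      have "(f has_real_derivative - ((1 - P) * y powr (1 - P - 1)) / (P - 1)) (at y)"
        unfolding f_def by (intro derivative_eq_intros refl) (use y P in auto)
      also have "- ((1 - P) * y powr (1 - P - 1)) / (P - 1) = y powr (- P)" using P by (simp add: field_simps)
      finally show ?thesis .
    qed
    then obtain z where z: "S n < z" "z < S (Suc n)" "f (S (Suc n)) - f (S n) = (S (Suc n) - S n) * z powr (- P)"
      using MVT2[OF less, of f "\<lambda>y. y powr (- P)"] by blast
    have "S (Suc n) powr (- P) \<le> z powr (- P)" using z that P by (intro powr_mono2') auto
    then have "x n * S (Suc n) powr (- P) \<le> x n * z powr (- P)" using x by (rule mult_left_mono)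
    then show ?thesis unfolding z(3) by (simp add: SSuc powr_minus divide_inverse)
  qed
  have "summable (\<lambda>n. x (n + N) / S (Suc (n + N)) powr P)"
  proof (rule summableI_nonneg_bounded)
    fix M
    have "(\<Sum>n<M. x (n + N) / S (Suc (n + N)) powr P) \<le> (\<Sum>n<M. f (S (Suc n + N)) - f (S (n + N)))"
      by (rule sum_mono) (use step pos in auto)
    also have "\<dots> = f (S (M + N)) - f (S (0 + N))" by (rule sum_lessThan_telescope)
    also have "\<dots> \<le> - f (S N)" using P by (simp add: f_def)
    finally show "(\<Sum>n<M. x (n + N) / S (Suc (n + N)) powr P) \<le> - f (S N)" .
  qed (use x in auto)
  then have "summable (\<lambda>n. x n / S (Suc n) powr P)"
    using summable_iff_shift[of "\<lambda>n. x n / S (Suc n) powr P" N] by simp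
  then show ?thesis by (simp only: S_def)
qed

end

text \<open>Put t = q s / (q - s) and x = \<mu>^t, and suppose that x is not summable. The sequence
  b with b^q = x / S^(q/s), S being the partial sums of x, is q-summable by Abel-Dini since q/s > 1.
  As t s / q + s = t, the product satisfies (b \<mu>)^s = x / S, which Abel-Dini shows to
  diverge.\<close>

lemma summable_multiplier_converse:
  fixes \<mu> :: "nat \<Rightarrow> real"
  assumes q: "0 < q" and s: "0 < s" "s < q" and \<mu>: "\<And>n. 0 \<le> \<mu> n"
    and bd: "\<And>b. (\<And>n. 0 \<le> b n) \<Longrightarrow> summable (\<lambda>n. b n powr q) \<Longrightarrow> summable (\<lambda>n. (b n * \<mu> n) powr s)"
  shows "summable (\<lambda>n. \<mu> n powr (q * s / (q - s)))"
proof (rule ccontr)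
  define t where "t = q * s / (q - s)"
  have t: "0 < t" using q s by (simp add: t_def)
  define x where "x n = \<mu> n powr t" for n
  assume "\<not> summable (\<lambda>n. \<mu> n powr (q * s / (q - s)))"
  then have div: "\<not> summable x" by (simp add: x_def[abs_def] t_def)
  have x0: "0 \<le> x n" for n by (simp add: x_def)
  define S where "S n = (\<Sum>i<Suc n. x i)" for n
  have S0: "0 \<le> S n" for n unfolding S_def by (rule sum_nonneg) (use x0 in auto)
  have P: "1 < q / s" using s by simp
  define b where "b n = (x n / S n powr (q / s)) powr (1 / q)" for n
  have bq: "b n powr q = x n / S n powr (q / s)" for n
    using q x0[of n] by (simp add: b_def powr_powr)
  have "summable (\<lambda>n. b n powr q)"
    unfolding bq S_def by (rule abel_dini_convergent[OF x0 div P])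
  then have "summable (\<lambda>n. (b n * \<mu> n) powr s)" by (intro bd) (auto simp: b_def)
  also have "(\<lambda>n. (b n * \<mu> n) powr s) = (\<lambda>n. x n / S n)"
  proof
    fix n
    show "(b n * \<mu> n) powr s = x n / S n"
    proof (cases "\<mu> n = 0")
      case True
      then show ?thesis by (simp add: x_def)
    next
      case False
      then have m: "0 < \<mu> n" using \<mu>[of n] by simp
      have "x n \<le> S n" unfolding S_def using x0 by (intro member_le_sum) auto
      moreover have "0 < x n" using m by (simp add: x_def)
      ultimately have Sn: "0 < S n" by simp
      have e1: "t * (s / q) + s = t"
      proof -
        have "t * (s / q) + s = s * s / (q - s) + s" using q by (simp add: t_def)
        also have "\<dots> = t" using s by (simp add: t_def field_simps)
        finally show ?thesis .
      qed
      have "(b n * \<mu> n) powr s = b n powr s * \<mu> n powr s" using m by (simp add: powr_mult)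
      also have "b n powr s = (x n / S n powr (q / s)) powr (s / q)" by (simp add: b_def powr_powr)
      also have "\<dots> = x n powr (s / q) / (S n powr (q / s)) powr (s / q)" by (rule powr_divide)
      also have "(S n powr (q / s)) powr (s / q) = S n" using Sn q s by (simp add: powr_powr)
      also have "x n powr (s / q) = \<mu> n powr (t * (s / q))" by (simp add: x_def powr_powr)
      finally have "(b n * \<mu> n) powr s = (\<mu> n powr (t * (s / q)) * \<mu> n powr s) / S n" by simp
      also have "\<mu> n powr (t * (s / q)) * \<mu> n powr s = x n"
        unfolding powr_add[symmetric] e1 x_def ..
      finally show ?thesis .
    qed
  qed
  finally show False using abel_dini_divergent[OF x0 div] by (simp add: S_def)
qed

text \<open>A crude form of Young's inequality suffices: since s/q + s/t = 1 for t = q s / (q - s),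
  the term (D \<mu>)^s is at most the larger of D^q and \<mu>^t.\<close>

lemma summable_hoelder:
  fixes D \<mu> :: "nat \<Rightarrow> real"
  assumes s: "0 < s" "s < q" and D: "\<And>n. 0 \<le> D n" "summable (\<lambda>n. D n powr q)"
    and \<mu>: "\<And>n. 0 \<le> \<mu> n" "summable (\<lambda>n. \<mu> n powr (q * s / (q - s)))"
  shows "summable (\<lambda>n. (D n * \<mu> n) powr s)"
proof (rule summable_comparison_test'[OF summable_add[OF D(2) \<mu>(2)]])
  fix n
  define t where "t = q * s / (q - s)"
  define X where "X = max (D n powr q) (\<mu> n powr t)"
  have q: "0 < q" and t: "0 < t" using s by (auto simp: t_def)
  have e: "s / q + s / t = 1"
  proof -
    have "s / t = (q - s) / q" using s by (simp add: t_def field_simps)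
    then show ?thesis using q by (simp add: diff_divide_distrib)
  qed
  have X0: "0 \<le> X" by (simp add: X_def le_max_iff_disj)
  have "D n powr s = (D n powr q) powr (s / q)" using q by (simp add: powr_powr)
  also have "\<dots> \<le> X powr (s / q)" using s q by (intro powr_mono2) (auto simp: X_def)
  finally have 1: "D n powr s \<le> X powr (s / q)" .
  have "\<mu> n powr s = (\<mu> n powr t) powr (s / t)" using t by (simp add: powr_powr)
  also have "\<dots> \<le> X powr (s / t)" using s t by (intro powr_mono2) (auto simp: X_def)
  finally have 2: "\<mu> n powr s \<le> X powr (s / t)" .
  have "(D n * \<mu> n) powr s = D n powr s * \<mu> n powr s" by (simp add: powr_mult D \<mu>)
  also have "\<dots> \<le> X powr (s / q) * X powr (s / t)" by (intro mult_mono 1 2) auto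
  also have "\<dots> = X" using X0 by (simp add: powr_add[symmetric] e)
  also have "\<dots> \<le> D n powr q + \<mu> n powr t" by (simp add: X_def)
  finally show "norm ((D n * \<mu> n) powr s) \<le> D n powr q + \<mu> n powr (q * s / (q - s))"
    by (simp add: t_def)
qed

lemma summable_powr_exponent_mono:
  fixes D :: "nat \<Rightarrow> real"
  assumes q: "0 < q" "q \<le> s" and D: "\<And>n. 0 \<le> D n" "summable (\<lambda>n. D n powr q)"
  shows "summable (\<lambda>n. D n powr s)"
proof -
  obtain B where B: "\<And>n. D n \<le> B" by (rule summable_powr_bounded[OF D q(1)]) blast
  show ?thesis
  proof (rule summable_comparison_test'[OF summable_mult[OF D(2), of "B powr (s - q)"]])
    fix n
    have "D n powr s = D n powr (s - q) * D n powr q" by (simp add: powr_add[symmetric])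
    also have "\<dots> \<le> B powr (s - q) * D n powr q"
      by (intro mult_right_mono powr_mono2) (use q D B in auto)
    finally show "norm (D n powr s) \<le> B powr (s - q) * D n powr q" by simp
  qed
qed

section \<open>Block norms, exponents and weights\<close>

lemma block_norm_nonneg: "0 \<le> block_norm s y n"
proof (cases "s = \<infinity>")
  case True
  obtain k where k: "k \<in> dyadic_block n" using dyadic_block_nonempty by blast
  have "0 \<le> norm (y k)" by simp
  also have "\<dots> \<le> (SUP k\<in>dyadic_block n. norm (y k))"
    using k finite_dyadic_block by (intro cSUP_upper) (auto intro: bdd_above_finite)
  finally show ?thesis using True by (simp add: block_norm_def)
qed (simp add: block_norm_def)

lemma norm_le_block_norm_infinity:
  assumes "k \<in> dyadic_block n"
  shows "norm (y k) \<le> block_norm \<infinity> y n"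
  using assms finite_dyadic_block unfolding block_norm_def
  by (auto intro!: cSUP_upper bdd_above_finite)

lemma block_norm_infinity_attained:
  obtains k where "k \<in> dyadic_block n" "block_norm \<infinity> y n = norm (y k)"
proof -
  have "(SUP k\<in>dyadic_block n. norm (y k)) = Max ((\<lambda>k. norm (y k)) ` dyadic_block n)"
    using finite_dyadic_block dyadic_block_nonempty by (intro cSup_eq_Max) auto
  moreover have "Max ((\<lambda>k. norm (y k)) ` dyadic_block n) \<in> (\<lambda>k. norm (y k)) ` dyadic_block n"
    using finite_dyadic_block dyadic_block_nonempty by (intro Max_in) auto
  ultimately show ?thesis using that by (auto simp: block_norm_def)
qed

lemma block_norm_powr:
  assumes "s \<noteq> \<infinity>" "0 < s"
  shows "block_norm s y n powr enn2real s = (\<Sum>k\<in>dyadic_block n. norm (y k) powr enn2real s)"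
proof -
  have "0 < enn2real s" using assms by (simp add: enn2real_positive_iff top.not_eq_extremum)
  then show ?thesis using assms by (simp add: block_norm_def powr_powr sum_nonneg)
qed

lemma ell_infinity_iff:
  assumes "\<And>n. 0 \<le> \<mu> n"
  shows "(\<lambda>n. complex_of_real (\<mu> n)) \<in> ell \<infinity> \<longleftrightarrow> bdd_above (range \<mu>)"
  using assms by (auto simp: ell_def bounded_iff bdd_above_def)

lemma ell_finite_iff:
  assumes "\<And>n. 0 \<le> \<mu> n" "s \<noteq> \<infinity>"
  shows "(\<lambda>n. complex_of_real (\<mu> n)) \<in> ell s \<longleftrightarrow> summable (\<lambda>n. \<mu> n powr enn2real s)"
  using assms by (simp add: ell_def)

lemma exponent_star_real:
  assumes "0 < s" "s < q"
  shows "exponent_star (ennreal q) (ennreal s) = ennreal (q * s / (q - s))"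
  using assms by (simp add: exponent_star_def ennreal_less_iff ennreal_mult[symmetric] ennreal_minus divide_ennreal)

text \<open>Indices in one block differ by less than a factor 2, which costs 2^\<alpha>. Block 0
  fits because the weight at 0 is set to 1.\<close>

lemma power_weight_le:
  assumes "0 \<le> \<alpha>" "k \<in> dyadic_block n"
  shows "power_weight \<alpha> k \<le> (2 powr \<alpha>) ^ n" "(2 powr \<alpha>) ^ n \<le> 2 powr \<alpha> * power_weight \<alpha> k"
proof -
  have pw: "(2 powr \<alpha>) ^ i = (2 ^ i) powr \<alpha>" for i :: nat
    by (simp add: powr_realpow[symmetric] powr_powr mult.commute)
  have one: "1 \<le> 2 powr \<alpha>" using assms by (simp add: ge_one_powr_ge_zero)
  have "power_weight \<alpha> k \<le> (2 powr \<alpha>) ^ n \<and> (2 powr \<alpha>) ^ n \<le> 2 powr \<alpha> * power_weight \<alpha> k"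
  proof (cases n)
    case 0
    then show ?thesis using assms one by (simp add: dyadic_block_def power_weight_def)
  next
    case (Suc i)
    then have k: "2 ^ i \<le> k" "k < 2 ^ Suc i" using assms by (auto simp: dyadic_block_def)
    then have "0 < k" by (metis gr0I not_le zero_less_numeral zero_less_power)
    then have w: "power_weight \<alpha> k = real k powr \<alpha>" by (simp add: power_weight_def)
    have r: "2 ^ i \<le> real k" "real k \<le> 2 ^ Suc i"
      using k by (metis of_nat_le_iff of_nat_numeral of_nat_power, metis less_imp_le of_nat_le_iff of_nat_numeral of_nat_power)
    have "real k powr \<alpha> \<le> (2 ^ Suc i) powr \<alpha>" using r assms by (intro powr_mono2) auto
    moreover have "(2 ^ i) powr \<alpha> \<le> real k powr \<alpha>" using r assms by (intro powr_mono2) auto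
    then have "2 powr \<alpha> * (2 ^ i) powr \<alpha> \<le> 2 powr \<alpha> * real k powr \<alpha>" by (intro mult_left_mono) auto
    ultimately show ?thesis unfolding w pw[symmetric] Suc by simp
  qed
  then show "power_weight \<alpha> k \<le> (2 powr \<alpha>) ^ n" "(2 powr \<alpha>) ^ n \<le> 2 powr \<alpha> * power_weight \<alpha> k" by auto
qed

lemma power_weight_nonneg: "0 \<le> power_weight \<alpha> k"
  by (simp add: power_weight_def)

section \<open>Reduction of the multiplier problem to block norms\<close>

theorem theorem5p6:
  fixes p q :: real and s :: ennreal
  assumes "0 < p" and "p < 1" and "0 < q" and "0 < s"
  shows "multipliers (coeff_space (hardy_lorentz p q)) (ell s) =
         ell_mixed_weighted s (exponent_star (ennreal q) s) (1 / p - 1)"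
proof -
  define \<alpha> where "\<alpha> = 1 / p - 1"
  have \<alpha>: "0 < \<alpha>" using assms by (simp add: \<alpha>_def)
  define \<sigma> where "\<sigma> = 2 powr \<alpha>"
  have \<sigma>: "0 < \<sigma>" by (simp add: \<sigma>_def)
  have \<sigma>': "((1 / 2) powr \<alpha>) ^ n * \<sigma> ^ n = 1" for n
  proof -
    have "(1 / 2) powr \<alpha> * \<sigma> = 1" by (simp add: \<sigma>_def powr_mult[symmetric])
    then show ?thesis by (simp add: power_mult_distrib[symmetric])
  qed
  note pw = power_weight_le[OF less_imp_le[OF \<alpha>], folded \<sigma>_def]
  define y where "y l k = complex_of_real (power_weight \<alpha> k) * l k" for l k
  define \<mu> where "\<mu> l = block_norm s (y l)" for l
  have \<mu>0: "0 \<le> \<mu> l n" for l n unfolding \<mu>_def by (rule block_norm_nonneg)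
  have mem: "l \<in> ell_mixed_weighted s t \<alpha> \<longleftrightarrow> (\<lambda>n. complex_of_real (\<mu> l n)) \<in> ell t" for l t
    by (simp add: ell_mixed_weighted_def ell_mixed_def \<mu>_def y_def[abs_def])
  have ny: "norm (y l k) = power_weight \<alpha> k * norm (l k)" for l k
    using power_weight_nonneg[of \<alpha> k] by (simp add: y_def norm_mult)
  have upper: "(\<lambda>k. l k * a k) \<in> ell s"
    if l: "l \<in> ell_mixed_weighted s (exponent_star (ennreal q) s) \<alpha>" and a: "a \<in> coeff_space (hardy_lorentz p q)" for l a
  proof -
    obtain D where D: "\<And>n. 0 \<le> D n" "summable (\<lambda>n. D n powr q)"
      "\<And>n k. k \<in> dyadic_block n \<Longrightarrow> norm (a k) * ((1 / 2) powr (1 / p - 1)) ^ n \<le> D n"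
      by (rule hardy_lorentz_coefficients[OF a assms(1-3)]) blast
    \<comment> \<open>On block n the coefficients are at most D n \<sigma>^n, and \<sigma>^n is the
      weight up to a factor \<sigma>. All cases below therefore only concern the product of D with
      the block norms of the weighted multiplier.\<close>
    have la: "norm (l k * a k) \<le> \<sigma> * D n * norm (y l k)" if k: "k \<in> dyadic_block n" for n k
    proof -
      have "norm (a k) = norm (a k) * ((1 / 2) powr \<alpha>) ^ n * \<sigma> ^ n" using \<sigma>'[of n] by (simp add: mult.assoc)
      also have "\<dots> \<le> D n * \<sigma> ^ n"
        using D(3)[OF k] \<sigma> by (intro mult_right_mono) (auto simp: \<alpha>_def)
      also have "\<dots> \<le> D n * (\<sigma> * power_weight \<alpha> k)" by (intro mult_left_mono pw(2) k D(1))
      finally have "norm (l k) * norm (a k) \<le> norm (l k) * (D n * (\<sigma> * power_weight \<alpha> k))" by (rule mult_left_mono) simp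
      then show ?thesis by (simp add: norm_mult ny mult_ac)
    qed
    obtain B where B: "\<And>n. D n \<le> B" by (rule summable_powr_bounded[OF D(1,2) assms(3)]) blast
    show ?thesis
    proof (cases "s = \<infinity>")
      case True
      then have "exponent_star (ennreal q) s = \<infinity>" by (simp add: exponent_star_def)
      then have "bdd_above (range (\<mu> l))" using l ell_infinity_iff[OF \<mu>0] by (simp add: mem)
      then obtain C where C: "\<And>n. \<mu> l n \<le> C" by (auto simp: bdd_above_def)
      have "norm (l k * a k) \<le> \<sigma> * B * C" for k
      proof -
        obtain n where k: "k \<in> dyadic_block n" using dyadic_block_exists by blast
        have "norm (y l k) \<le> \<mu> l n" unfolding \<mu>_def True by (rule norm_le_block_norm_infinity[OF k])
        then have yC: "norm (y l k) \<le> C" using C[of n] by simp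
        have "norm (l k * a k) \<le> \<sigma> * D n * norm (y l k)" by (rule la[OF k])
        also have "\<dots> \<le> \<sigma> * B * C"
          by (intro mult_mono mult_left_mono B yC mult_nonneg_nonneg) (use \<sigma> D(1)[of n] B[of n] in auto)
        finally show ?thesis .
      qed
      then show ?thesis using True by (auto simp: ell_def bounded_iff)
    next
      case fin: False
      define s' where "s' = enn2real s"
      have ss: "s = ennreal s'" using fin by (simp add: s'_def top.not_eq_extremum)
      have s': "0 < s'" using assms(4) by (simp add: ss)
      have \<mu>s: "\<mu> l n powr s' = (\<Sum>k\<in>dyadic_block n. norm (y l k) powr s')" for n
        unfolding \<mu>_def s'_def by (rule block_norm_powr[OF fin assms(4)])
      \<comment> \<open>For s' < q this is Hoelder's inequality with the conjugate-type exponent q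
        s' / (q - s'). For s' >= q the block norms are bounded and l^q is contained in l^s'.\<close>
      have D\<mu>: "summable (\<lambda>n. (D n * \<mu> l n) powr s')"
      proof (cases "s' < q")
        case True
        have es: "exponent_star (ennreal q) s = ennreal (q * s' / (q - s'))"
          by (simp only: ss exponent_star_real[OF s' True])
        have "(\<lambda>n. complex_of_real (\<mu> l n)) \<in> ell (ennreal (q * s' / (q - s')))"
          using l unfolding mem es .
        then have "summable (\<lambda>n. \<mu> l n powr (q * s' / (q - s')))"
          using s' True by (simp add: ell_finite_iff[OF \<mu>0])
        then show ?thesis by (rule summable_hoelder[OF s' True D(1,2) \<mu>0])
      next
        case False
        then have "exponent_star (ennreal q) s = \<infinity>"
          using s' by (simp add: exponent_star_def ss ennreal_less_iff)
        then have "bdd_above (range (\<mu> l))" using l ell_infinity_iff[OF \<mu>0] by (simp add: mem)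
        then obtain C where C: "\<And>n. \<mu> l n \<le> C" by (auto simp: bdd_above_def)
        have "summable (\<lambda>n. D n powr s')"
          by (rule summable_powr_exponent_mono[OF assms(3) _ D(1,2)]) (use False in simp)
        moreover have "0 \<le> C" using C[of 0] \<mu>0[of l 0] by simp
        ultimately have "summable (\<lambda>n. (C * D n) powr s')" using D(1) by (intro summable_powr_cmult)
        then show ?thesis
          by (rule summable_powr_mono[rotated 3])
             (use D(1) \<mu>0 C s' in \<open>auto simp: mult.commute[of "D _"] mult_right_mono\<close>)
      qed
      have "summable (\<lambda>n. \<Sum>k\<in>dyadic_block n. norm (l k * a k) powr s')"
      proof (rule summable_comparison_test'[OF summable_mult[OF D\<mu>, of "\<sigma> powr s'"]])
        fix n
        have "(\<Sum>k\<in>dyadic_block n. norm (l k * a k) powr s') \<le> (\<Sum>k\<in>dyadic_block n. (\<sigma> * D n) powr s' * norm (y l k) powr s')"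
        proof (rule sum_mono)
          fix k assume k: "k \<in> dyadic_block n"
          have "norm (l k * a k) powr s' \<le> (\<sigma> * D n * norm (y l k)) powr s'"
            using la[OF k] s' by (intro powr_mono2) auto
          also have "\<dots> = (\<sigma> * D n) powr s' * norm (y l k) powr s'"
            using \<sigma> D(1)[of n] by (simp add: powr_mult)
          finally show "norm (l k * a k) powr s' \<le> (\<sigma> * D n) powr s' * norm (y l k) powr s'" .
        qed
        also have "\<dots> = (\<sigma> * D n) powr s' * \<mu> l n powr s'" unfolding \<mu>s by (rule sum_distrib_left[symmetric])
        also have "\<dots> = \<sigma> powr s' * (D n * \<mu> l n) powr s'"
          using \<sigma> D(1)[of n] \<mu>0[of l n] by (simp add: powr_mult)
        finally show "norm (\<Sum>k\<in>dyadic_block n. norm (l k * a k) powr s') \<le> \<sigma> powr s' * (D n * \<mu> l n) powr s'"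
          by (simp add: sum_nonneg)
      qed
      then have "summable (\<lambda>k. norm (l k * a k) powr s')"
        by (subst summable_dyadic_blocks) auto
      then show ?thesis using fin by (simp add: ell_def s'_def)
    qed
  qed
  have lower: "l \<in> ell_mixed_weighted s (exponent_star (ennreal q) s) \<alpha>"
    if l: "l \<in> multipliers (coeff_space (hardy_lorentz p q)) (ell s)" for l
  proof -
    \<comment> \<open>Every nonnegative q-summable b is realized, up to the constant \<kappa>, as a
      lower bound for the coefficients of one function of the space. Taking l^s norms over blocks
      then shows that multiplication by the block norms maps such b into l^s.\<close>
    have test: "\<exists>a \<kappa>. (\<lambda>k. l k * a k) \<in> ell s \<and> 0 < \<kappa> \<and> (\<forall>n. \<forall>k\<in>dyadic_block n. \<kappa> * (b n * norm (y l k)) \<le> norm (l k * a k))"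
      if b: "\<And>n. 0 \<le> b n" "summable (\<lambda>n. b n powr q)" for b
    proof -
      obtain a \<kappa> where a: "a \<in> coeff_space (hardy_lorentz p q)" "0 < \<kappa>"
        "\<And>n k. k \<in> dyadic_block n \<Longrightarrow> \<kappa> * (b n * (2 powr (1 / p - 1)) ^ n) \<le> norm (a k)"
        by (rule hardy_lorentz_test_sequence[OF assms(1,3) b]) blast
      have "\<kappa> * (b n * norm (y l k)) \<le> norm (l k * a k)" if k: "k \<in> dyadic_block n" for n k
      proof -
        have "\<kappa> * (b n * power_weight \<alpha> k) \<le> \<kappa> * (b n * \<sigma> ^ n)"
          using a(2) b(1)[of n] by (intro mult_left_mono pw(1) k) auto
        also have "\<dots> \<le> norm (a k)" using a(3)[OF k] by (simp only: \<sigma>_def \<alpha>_def)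
        finally have "norm (l k) * (\<kappa> * (b n * power_weight \<alpha> k)) \<le> norm (l k) * norm (a k)" by (rule mult_left_mono) simp
        then show ?thesis by (simp add: ny norm_mult mult_ac)
      qed
      moreover have "(\<lambda>k. l k * a k) \<in> ell s" using l a(1) by (simp add: multipliers_def)
      ultimately show ?thesis using a(2) by blast
    qed
    show ?thesis
    proof (cases "s = \<infinity>")
      case True
      then have e: "exponent_star (ennreal q) s = \<infinity>" by (simp add: exponent_star_def)
      have "bdd_above (range (\<mu> l))"
      proof (rule bounded_multiplier_bound[OF assms(3) \<mu>0])
        fix b :: "nat \<Rightarrow> real" assume b: "\<And>n. 0 \<le> b n" "summable (\<lambda>n. b n powr q)"
        obtain a \<kappa> where a: "(\<lambda>k. l k * a k) \<in> ell s" "0 < \<kappa>"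
          "\<And>n k. k \<in> dyadic_block n \<Longrightarrow> \<kappa> * (b n * norm (y l k)) \<le> norm (l k * a k)"
          using test[OF b] by blast
        obtain C where C: "\<And>k. norm (l k * a k) \<le> C"
          using a(1) True by (auto simp: ell_def bounded_iff)
        have "b n * \<mu> l n \<le> C / \<kappa>" for n
        proof -
          obtain k where k: "k \<in> dyadic_block n" "\<mu> l n = norm (y l k)"
            unfolding \<mu>_def True by (rule block_norm_infinity_attained)
          have "\<kappa> * (b n * \<mu> l n) \<le> C" using a(3)[OF k(1)] C[of k] k(2) by simp
          then show ?thesis using a(2) by (simp add: field_simps)
        qed
        then show "bdd_above (range (\<lambda>n. b n * \<mu> l n))" by (auto intro!: bdd_aboveI)
      qed
      then show ?thesis unfolding mem e ell_infinity_iff[OF \<mu>0] .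
    next
      case fin: False
      define s' where "s' = enn2real s"
      have ss: "s = ennreal s'" using fin by (simp add: s'_def top.not_eq_extremum)
      have s': "0 < s'" using assms(4) by (simp add: ss)
      have \<mu>s: "\<mu> l n powr s' = (\<Sum>k\<in>dyadic_block n. norm (y l k) powr s')" for n
        unfolding \<mu>_def s'_def by (rule block_norm_powr[OF fin assms(4)])
      have sum: "summable (\<lambda>n. (b n * \<mu> l n) powr s')"
        if b: "\<And>n. 0 \<le> b n" "summable (\<lambda>n. b n powr q)" for b
      proof -
        obtain a \<kappa> where a: "(\<lambda>k. l k * a k) \<in> ell s" "0 < \<kappa>"
          "\<And>n k. k \<in> dyadic_block n \<Longrightarrow> \<kappa> * (b n * norm (y l k)) \<le> norm (l k * a k)"
          using test[OF b] by blast
        have "summable (\<lambda>k. norm (l k * a k) powr s')" using a(1) fin by (simp add: ell_def s'_def)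
        then have "summable (\<lambda>n. \<Sum>k\<in>dyadic_block n. norm (l k * a k) powr s')"
          by (subst (asm) summable_dyadic_blocks) auto
        then have "summable (\<lambda>n. (\<kappa> * (b n * \<mu> l n)) powr s')"
        proof (rule summable_comparison_test')
          fix n
          have "(\<kappa> * (b n * \<mu> l n)) powr s' = (\<kappa> * b n) powr s' * \<mu> l n powr s'"
            using a(2) b(1)[of n] \<mu>0[of l n] by (simp add: powr_mult mult.assoc)
          also have "\<dots> = (\<Sum>k\<in>dyadic_block n. (\<kappa> * (b n * norm (y l k))) powr s')"
            unfolding \<mu>s sum_distrib_left using a(2) b(1)[of n] by (simp add: powr_mult mult.assoc)
          also have "\<dots> \<le> (\<Sum>k\<in>dyadic_block n. norm (l k * a k) powr s')"
            using a(2) b(1)[of n] s' by (intro sum_mono powr_mono2 a(3)) auto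
          finally show "norm ((\<kappa> * (b n * \<mu> l n)) powr s') \<le> (\<Sum>k\<in>dyadic_block n. norm (l k * a k) powr s')" by simp
        qed
        then have "summable (\<lambda>n. (1 / \<kappa> * (\<kappa> * (b n * \<mu> l n))) powr s')"
          by (rule summable_powr_cmult[rotated 2]) (use a(2) b(1) \<mu>0 in auto)
        then show ?thesis using a(2) by simp
      qed
      show ?thesis
      proof (cases "s' < q")
        case True
        have es: "exponent_star (ennreal q) s = ennreal (q * s' / (q - s'))"
          by (simp only: ss exponent_star_real[OF s' True])
        have "summable (\<lambda>n. \<mu> l n powr (q * s' / (q - s')))"
          by (rule summable_multiplier_converse[OF assms(3) s' True \<mu>0 sum])
        then have "(\<lambda>n. complex_of_real (\<mu> l n)) \<in> ell (ennreal (q * s' / (q - s')))"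
          using s' True by (simp add: ell_finite_iff[OF \<mu>0])
        then show ?thesis unfolding mem es .
      next
        case False
        then have e: "exponent_star (ennreal q) s = \<infinity>"
          using s' by (simp add: exponent_star_def ss ennreal_less_iff)
        have "bdd_above (range (\<mu> l))"
        proof (rule bounded_multiplier_bound[OF assms(3) \<mu>0])
          fix b :: "nat \<Rightarrow> real" assume b: "\<And>n. 0 \<le> b n" "summable (\<lambda>n. b n powr q)"
          \<comment> \<open>Summability of the s'-th powers enters through the boundedness of the
            terms, which is what the gliding hump argument asks for.\<close>
          obtain C where "\<And>n. b n * \<mu> l n \<le> C"
            by (rule summable_powr_bounded[OF _ sum[OF b] s']) (use b \<mu>0 in auto)
          then show "bdd_above (range (\<lambda>n. b n * \<mu> l n))" by (auto intro!: bdd_aboveI)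
        qed
        then show ?thesis unfolding mem e ell_infinity_iff[OF \<mu>0] .
      qed
    qed
  qed
  show ?thesis
    unfolding \<alpha>_def[symmetric] using upper lower by (auto simp: multipliers_def)
qed

end
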